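(* Fix $\beta>0$. Then the white noise measure $$d\mu^\beta_{wn}=\prod_{n\in\mathbb Z}\frac{1+2\beta}{\pi}\,\frac{d\mathrm{Area}(\alpha_n)}{(1+|\alpha_n|^2)^{2+2\beta}}$$ on $\mathbb C^{\mathbb Z}$ is left invariant by the flow of the Ablowitz--Ladik system $$i\tfrac{d}{dt}\alpha_n=-(1+|\alpha_n|^2)\,[\alpha_{n+1}+\alpha_{n-1}]+2\alpha_n,\qquad n\in\mathbb Z .$$ That is, for every $t\in\mathbb R$, if $\alpha(0)$ has law $\mu^\beta_{wn}$ and $\alpha(t)$ is the value at time $t$ of the ($\mu^\beta_{wn}$-almost surely existing and unique) global good solution with initial data $\alpha(0)$, then $\alpha(t)$ has law $\mu^\beta_{wn}$.
   Context: $\langle n\rangle=(1+n^2)^{1/2}$, and $d\mathrm{Area}$ is Lebesgue measure on $\mathbb C\cong\mathbb R^2$. A global (classical) solution $\alpha:\mathbb Z\times\mathbb R\to\mathbb C$ of the Ablowitz--Ladik system is called a good solution if $$\int_{-T}^T\sum_{n\in\mathbb Z}\langle n\rangle^{-q}|\alpha_n(t)|^{2p}\,dt<\infty\quad\text{for some }p>q>1\text{ and all }T>0,$$ $$\sup_{|t|\le T}\sum_{n\in\mathbb Z}e^{-c\langle n\rangle}|\alpha_n(t)|^2<\infty\quad\text{for some }c>0\text{ and all }T>0.$$ The flow of the Ablowitz--Ladik system is the map $\alpha(0)\mapsto\alpha(t)$ given by the unique global good solution, which exists for $\mu^\beta_{wn}$-almost every $\alpha(0)$. *)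

theory Defs
  imports "HOL-Probability.Probability"
begin

definition japanese_bracket :: "int \<Rightarrow> real" where
  "japanese_bracket n = sqrt (1 + (real_of_int n)\<^sup>2)"

text \<open>
  On the type \<^typ>\<open>complex\<close>, \<^term>\<open>lborel\<close> is the planar Lebesgue measure. The space of the
  product is the whole type \<^typ>\<open>int \<Rightarrow> complex\<close>, with the product Borel sigma-algebra.
\<close>

definition white_noise :: "real \<Rightarrow> (int \<Rightarrow> complex) measure" where
  "white_noise \<beta> =
     (\<Pi>\<^sub>M n\<in>(UNIV :: int set).
        density lborel
          (\<lambda>z :: complex. ennreal ((1 + 2 * \<beta>) / pi * (1 / (1 + (cmod z)\<^sup>2) powr (2 + 2 * \<beta>)))))"

text \<open>
  Continuity of the derivatives is automatic: the equation expresses the derivative of each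
  coordinate as a continuous function of finitely many (differentiable) coordinates.
\<close>

definition AL_solution :: "(int \<Rightarrow> real \<Rightarrow> complex) \<Rightarrow> bool" where
  "AL_solution \<alpha> \<longleftrightarrow>
     (\<forall>n t. \<alpha> n differentiable (at t) \<and>
        \<i> * vector_derivative (\<alpha> n) (at t) =
          - (1 + of_real ((cmod (\<alpha> n t))\<^sup>2)) * (\<alpha> (n + 1) t + \<alpha> (n - 1) t) + 2 * \<alpha> n t)"

text \<open>
  The exponents \<open>p\<close>, \<open>q\<close> and the rate \<open>c\<close> may depend on the solution, but not on the time
  horizon \<open>T\<close>. Sums, integrals and suprema of nonnegative quantities are taken in
  \<^typ>\<open>ennreal\<close>, where they always exist.
\<close>

definition good_solution :: "(int \<Rightarrow> real \<Rightarrow> complex) \<Rightarrow> bool" where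
  "good_solution \<alpha> \<longleftrightarrow>
     AL_solution \<alpha> \<and>
     (\<exists>p q :: real. p > q \<and> q > 1 \<and>
        (\<forall>T>0. (\<integral>\<^sup>+t\<in>{-T..T}.
            (\<Sum>\<^sub>\<infinity>n. ennreal (japanese_bracket n powr (- q) * cmod (\<alpha> n t) powr (2 * p)))
            \<partial>lborel) < \<infinity>)) \<and>
     (\<exists>c :: real. c > 0 \<and>
        (\<forall>T>0. (SUP t\<in>{-T..T}.
            (\<Sum>\<^sub>\<infinity>n. ennreal (exp (- c * japanese_bracket n) * (cmod (\<alpha> n t))\<^sup>2))) < \<infinity>))"

definition good_solution_from :: "(int \<Rightarrow> complex) \<Rightarrow> (int \<Rightarrow> real \<Rightarrow> complex) \<Rightarrow> bool" where
  "good_solution_from a \<alpha> \<longleftrightarrow> good_solution \<alpha> \<and> (\<forall>n. \<alpha> n 0 = a n)"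

text \<open>
  The value of the flow is meaningful only at initial data with exactly one good solution;
  elsewhere it is unspecified.
\<close>

definition AL_flow :: "real \<Rightarrow> (int \<Rightarrow> complex) \<Rightarrow> (int \<Rightarrow> complex)" where
  "AL_flow t a = (\<lambda>n. (THE \<alpha>. good_solution_from a \<alpha>) n t)"

text \<open>
  Since the flow is meaningful only almost everywhere, measurability and the push-forward are
  taken with respect to the completion of \<open>M\<close>; the result does not depend on the values
  on a null set. Measurability is demanded explicitly because \<^const>\<open>distr\<close> is
  meaningful only for measurable maps.
\<close>

definition leaves_invariant :: "('a \<Rightarrow> 'a) \<Rightarrow> 'a measure \<Rightarrow> bool" where
  "leaves_invariant f M \<longleftrightarrow>
     f \<in> measurable (completion M) M \<and> distr (completion M) M f = M"

end

theory Submission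
  imports Defs
begin

text \<open>
  Write the system as \<open>\<alpha>\<^sub>n' = F(\<alpha>\<^sub>n, \<alpha>\<^sub>n\<^sub>+\<^sub>1 + \<alpha>\<^sub>n\<^sub>-\<^sub>1)\<close> with \<open>F z w = \<i>((1 + |z|\<^sup>2) w - 2 z)\<close>. Truncated to
  \<open>|n| \<le> N\<close>, it is divergence free with respect to the white noise density, because the terms
  \<open>Im (\<alpha>\<^sub>n\<^sup>* (\<alpha>\<^sub>n\<^sub>+\<^sub>1 + \<alpha>\<^sub>n\<^sub>-\<^sub>1))\<close> sum to zero. Liouville's theorem is replaced by an explicit time
  discretisation that updates one real coordinate at a time: such an update is a shear, its
  Jacobian is one-dimensional, and over a full sweep the first-order changes of the density cancel.
  With a small step the discrete trajectories therefore almost solve the truncated equation and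
  satisfy \<open>E f(y(t)) \<le> (1 + o(1)) E f\<close> for \<open>f \<ge> 0\<close>, up to an event of small probability.

  Moments of order \<open>2p\<close> with \<open>1 < q < p < 1 + 2\<beta>\<close> then bound the time integral of \<open>|y\<^sub>n|\<^sup>2\<close> over
  \<open>|n| \<le> M\<close> by \<open>O(M\<^bsup>q/p\<^esup>)\<close>, which is sublinear in \<open>M\<close>. Iterating the integral inequality for the
  difference of two solutions \<open>m \<approx> M\<close> times gains \<open>O(M\<^bsup>q/p\<^esup>)\<^sup>m / m!\<close>, which beats any exponential
  growth in \<open>M\<close>. This gives uniqueness of good solutions, and almost sure convergence of the
  approximations on the boxes \<open>|n| \<le> 2\<^bsup>j\<^esup>\<close> to a good solution. By Fatou's lemma the law \<open>\<nu>\<close> of the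
  limit at a fixed time satisfies \<open>\<nu>(U) \<le> \<mu>(U)\<close> for open \<open>U\<close>, and two Borel probability measures so
  related on a Polish space coincide.
\<close>

section \<open>The single-site law\<close>

text \<open>The field is cubic, so comparing two solutions on a box costs a Lipschitz constant of
  the size of the largest |alpha_n|^2 there, and under white noise this maximum is unbounded as the
  box grows. Besides the moments a cruder a priori bound is needed. The log energy, the sum of ln (1
  + |alpha_n|^2) over the box, is conserved by the truncated system, and since 1 + |alpha_n|^2 has
  finite mean it is linear in the size of the box except on events of exponentially small
  probability. It yields pointwise bounds exp (O(M)): this is the exponential growth that the
  factorial has to beat, and it explains the second condition on good solutions. The same bound
  confines each discrete trajectory to a compact set, so no rate in the time step is needed: box,
  energy level, time horizon and tolerance are fixed first, and uniform continuity then provides a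
  step size. The moment condition for the limit is not inherited from the approximations; it follows
  afterwards from the invariance of the law at each fixed time.\<close>

lemma measurable_Complex [measurable (raw)]:
  assumes [measurable]: "f \<in> borel_measurable M" "g \<in> borel_measurable M"
  shows "(\<lambda>x. Complex (f x) (g x)) \<in> borel_measurable M"
  unfolding Complex_eq by measurable

text \<open>Writing the planar measure as a product gives Fubini in both orders, so the real
  coordinate moved by a shear can always be the inner variable.\<close>

lemma lborel_complex:
  "(lborel :: complex measure) = distr (lborel \<Otimes>\<^sub>M lborel) borel (\<lambda>(x, y). Complex x y)"
proof (rule lborel_eqI)
  fix l u :: complex
  assume le: "\<And>b. b \<in> Basis \<Longrightarrow> l \<bullet> b \<le> u \<bullet> b"
  have le': "Re l \<le> Re u" "Im l \<le> Im u"
    using le[of 1] le[of \<i>] by (auto simp: Basis_complex_def)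
  have vim: "(\<lambda>(x, y). Complex x y) -` box l u = {Re l<..<Re u} \<times> {Im l<..<Im u}"
    by (auto simp: box_def Basis_complex_def)
  have "emeasure (distr (lborel \<Otimes>\<^sub>M lborel) borel (\<lambda>(x, y). Complex x y)) (box l u)
      = emeasure (lborel \<Otimes>\<^sub>M lborel) ({Re l<..<Re u} \<times> {Im l<..<Im u})"
    by (subst emeasure_distr) (auto simp: vim space_pair_measure)
  also have "\<dots> = ennreal (Re u - Re l) * ennreal (Im u - Im l)"
    using le' by (subst lborel.emeasure_pair_measure_Times) auto
  also have "\<dots> = ennreal (\<Prod>b\<in>Basis. (u - l) \<bullet> b)"
    using le' by (simp add: Basis_complex_def ennreal_mult)
  finally show "emeasure (distr (lborel \<Otimes>\<^sub>M lborel) borel (\<lambda>(x, y). Complex x y)) (box l u)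
      = ennreal (\<Prod>b\<in>Basis. (u - l) \<bullet> b)" .
qed simp

lemma nn_integral_lborel_complex:
  assumes [measurable]: "f \<in> borel_measurable borel"
  shows "(\<integral>\<^sup>+z. f z \<partial>(lborel :: complex measure)) = (\<integral>\<^sup>+y. \<integral>\<^sup>+x. f (Complex x y) \<partial>lborel \<partial>lborel)"
    and "(\<integral>\<^sup>+z. f z \<partial>(lborel :: complex measure)) = (\<integral>\<^sup>+x. \<integral>\<^sup>+y. f (Complex x y) \<partial>lborel \<partial>lborel)"
proof -
  have *: "(\<integral>\<^sup>+z. f z \<partial>lborel) = (\<integral>\<^sup>+p. f (Complex (fst p) (snd p)) \<partial>(lborel \<Otimes>\<^sub>M lborel))"
    by (subst lborel_complex, subst nn_integral_distr) (auto simp: case_prod_beta)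
  show "(\<integral>\<^sup>+z. f z \<partial>(lborel :: complex measure)) = (\<integral>\<^sup>+y. \<integral>\<^sup>+x. f (Complex x y) \<partial>lborel \<partial>lborel)"
    unfolding * by (subst lborel_pair.nn_integral_snd[symmetric]) auto
  show "(\<integral>\<^sup>+z. f z \<partial>(lborel :: complex measure)) = (\<integral>\<^sup>+x. \<integral>\<^sup>+y. f (Complex x y) \<partial>lborel \<partial>lborel)"
    unfolding * by (subst lborel.nn_integral_fst[symmetric]) auto
qed

text \<open>A disc of squared radius r has area pi * r, so the push-forward has constant density.
  This replaces polar coordinates.\<close>

lemma distr_lborel_cmod_square:
  "distr lborel borel (\<lambda>z::complex. (cmod z)\<^sup>2) = density lborel (\<lambda>u. ennreal pi * indicator {0..} u)"
proof (rule measure_eqI_generator_eq[where E = "range (\<lambda>r::real. {..r})" and \<Omega> = UNIV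
      and A = "\<lambda>i::nat. {..real i}"])
  have *: "emeasure (distr lborel borel (\<lambda>z::complex. (cmod z)\<^sup>2)) {..r}
      = (if r < 0 then 0 else ennreal (pi * r))" for r
  proof -
    have "(\<lambda>z::complex. (cmod z)\<^sup>2) -` {..r} = (if r < 0 then {} else cball 0 (sqrt r))"
    proof (intro set_eqI)
      fix z :: complex
      have "(cmod z)\<^sup>2 \<le> r \<longleftrightarrow> cmod z \<le> sqrt r"
        using real_sqrt_le_iff[of "(cmod z)\<^sup>2" r] by simp
      moreover have "\<not> (cmod z)\<^sup>2 \<le> r" if "r < 0"
        using that zero_le_power2[of "cmod z"] by linarith
      ultimately show "z \<in> (\<lambda>z::complex. (cmod z)\<^sup>2) -` {..r} \<longleftrightarrow> z \<in> (if r < 0 then {} else cball 0 (sqrt r))"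
        by auto
    qed
    then show ?thesis
      by (subst emeasure_distr) (auto simp: emeasure_cball unit_ball_vol_2)
  qed
  have **: "emeasure (density lborel (\<lambda>u. ennreal pi * indicator {0..} u)) {..r}
      = (if r < 0 then 0 else ennreal (pi * r))" for r :: real
  proof -
    have "emeasure (density lborel (\<lambda>u. ennreal pi * indicator {0..} u)) {..r}
        = (\<integral>\<^sup>+u. ennreal pi * indicator {0..r} u \<partial>lborel)"
      by (subst emeasure_density) (auto intro!: nn_integral_cong simp: indicator_def)
    also have "\<dots> = ennreal pi * emeasure lborel {0..r}"
      by (subst nn_integral_cmult) auto
    finally show ?thesis by (auto simp: ennreal_mult)
  qed
  show "emeasure (distr lborel borel (\<lambda>z::complex. (cmod z)\<^sup>2)) X
      = emeasure (density lborel (\<lambda>u. ennreal pi * indicator {0..} u)) X" if "X \<in> range (\<lambda>r::real. {..r})" for X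
    using that * ** by auto
  show "emeasure (distr lborel borel (\<lambda>z::complex. (cmod z)\<^sup>2)) {..real i} \<noteq> \<infinity>" for i
    unfolding * by auto
  show "Int_stable (range (\<lambda>r::real. {..r}))"
    by (auto simp: Int_stable_def)
  show "(\<Union>i. {..real i}) = UNIV"
    using real_arch_simple by (auto)
  show "sets (distr lborel borel (\<lambda>z::complex. (cmod z)\<^sup>2)) = sigma_sets UNIV (range (\<lambda>r::real. {..r}))"
    unfolding sets_distr borel_eq_atMost by simp
  show "sets (density lborel (\<lambda>u. ennreal pi * indicator {0..} u)) = sigma_sets UNIV (range (\<lambda>r::real. {..r}))"
    unfolding sets_density sets_lborel borel_eq_atMost by simp
qed auto

lemma nn_integral_radial:
  assumes [measurable]: "f \<in> borel_measurable borel"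
  shows "(\<integral>\<^sup>+z. f ((cmod z)\<^sup>2) \<partial>lborel) = ennreal pi * (\<integral>\<^sup>+u. f u * indicator {0..} u \<partial>lborel)"
proof -
  have "(\<integral>\<^sup>+z. f ((cmod z)\<^sup>2) \<partial>lborel) = (\<integral>\<^sup>+u. f u \<partial>distr lborel borel (\<lambda>z::complex. (cmod z)\<^sup>2))"
    by (subst nn_integral_distr) auto
  also have "\<dots> = (\<integral>\<^sup>+u. ennreal pi * (f u * indicator {0..} u) \<partial>lborel)"
    unfolding distr_lborel_cmod_square
    by (subst nn_integral_density) (auto intro!: nn_integral_cong simp: mult_ac)
  finally show ?thesis by (simp add: nn_integral_cmult)
qed

lemma nn_integral_japanese_complex:
  assumes s: "s < -1"
  shows "(\<integral>\<^sup>+z. ennreal ((1 + (cmod z)\<^sup>2) powr s) \<partial>lborel) = ennreal (pi / (- s - 1))"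
proof -
  have "(\<integral>\<^sup>+u. ennreal ((1 + u) powr s) * indicator {0..} u \<partial>lborel)
      = ennreal (0 - (1 + 0) powr (s + 1) / (s + 1))"
  proof (rule nn_integral_FTC_atLeast)
    show "((\<lambda>u. (1 + u) powr (s + 1) / (s + 1)) has_real_derivative (1 + x) powr s) (at x)"
      if "0 \<le> x" for x
      using s that by (auto intro!: derivative_eq_intros)
    have "((\<lambda>u::real. (1 + u) powr (s + 1)) \<longlongrightarrow> 0) at_top"
      using s by (intro tendsto_neg_powr filterlim_tendsto_add_at_top[OF tendsto_const])
                 (auto simp: filterlim_ident)
    from tendsto_divide[OF this tendsto_const[of "s + 1"]]
    show "((\<lambda>u. (1 + u) powr (s + 1) / (s + 1)) \<longlongrightarrow> 0) at_top"
      using s by simp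
  qed auto
  then show ?thesis
    using s by (subst nn_integral_radial[where f = "\<lambda>u. ennreal ((1 + u) powr s)"])
      (auto simp: ennreal_mult[symmetric] field_simps)
qed

definition site_density :: "real \<Rightarrow> complex \<Rightarrow> real" where
  "site_density \<beta> z = (1 + 2 * \<beta>) / pi * (1 / (1 + (cmod z)\<^sup>2) powr (2 + 2 * \<beta>))"

definition site_law :: "real \<Rightarrow> complex measure" where
  "site_law \<beta> = density lborel (\<lambda>z. ennreal (site_density \<beta> z))"

lemma white_noise_eq: "white_noise \<beta> = (\<Pi>\<^sub>M n\<in>UNIV. site_law \<beta>)"
  by (simp add: white_noise_def site_law_def site_density_def[abs_def])

lemma sets_site_law [simp, measurable_cong]: "sets (site_law \<beta>) = sets borel"
  and space_site_law [simp]: "space (site_law \<beta>) = UNIV"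
  by (simp_all add: site_law_def)

lemma measurable_site_density [measurable]: "site_density \<beta> \<in> borel_measurable borel"
  unfolding site_density_def by measurable

lemma nn_integral_site_law:
  assumes [measurable]: "f \<in> borel_measurable borel"
  shows "(\<integral>\<^sup>+z. f z \<partial>site_law \<beta>) = (\<integral>\<^sup>+z. ennreal (site_density \<beta> z) * f z \<partial>lborel)"
  unfolding site_law_def by (rule nn_integral_density) auto

text \<open>Exponent 0 gives the normalisation, exponent 1 the mean that bounds the log energy, and
  an exponent between 1 and 1 + 2 \<beta> the mass estimate.\<close>

lemma site_law_moment:
  assumes "\<beta> > 0" "s < 1 + 2 * \<beta>"
  shows "(\<integral>\<^sup>+z. ennreal ((1 + (cmod z)\<^sup>2) powr s) \<partial>site_law \<beta>) = ennreal ((1 + 2 * \<beta>) / (1 + 2 * \<beta> - s))"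
proof -
  have "(\<integral>\<^sup>+z. ennreal ((1 + (cmod z)\<^sup>2) powr s) \<partial>site_law \<beta>)
     = (\<integral>\<^sup>+z. ennreal ((1 + 2 * \<beta>) / pi) * ennreal ((1 + (cmod z)\<^sup>2) powr (s - (2 + 2 * \<beta>))) \<partial>lborel)"
    using assms
    by (subst nn_integral_site_law)
       (auto intro!: nn_integral_cong simp: site_density_def ennreal_mult[symmetric] powr_diff field_simps)
  also have "\<dots> = ennreal ((1 + 2 * \<beta>) / pi) * ennreal (pi / (- (s - (2 + 2 * \<beta>)) - 1))"
    using assms by (subst nn_integral_cmult, simp, subst nn_integral_japanese_complex) auto
  also have "\<dots> = ennreal ((1 + 2 * \<beta>) / (1 + 2 * \<beta> - s))"
    using assms by (subst ennreal_mult[symmetric]) (auto intro!: arg_cong[where f = ennreal] simp: divide_simps)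
  finally show ?thesis .
qed

lemma prob_space_site_law: 
  assumes "\<beta> > 0" 
  shows "prob_space (site_law \<beta>)"
proof (rule prob_spaceI)
  have "(\<integral>\<^sup>+z. ennreal ((1 + (cmod z)\<^sup>2) powr 0) \<partial>site_law \<beta>) = (\<integral>\<^sup>+z. 1 \<partial>site_law \<beta>)"
    by (intro nn_integral_cong) (smt (verit) ennreal_1 powr_zero_eq_one zero_le_power2)
  then show "emeasure (site_law \<beta>) (space (site_law \<beta>)) = 1"
    using site_law_moment[OF assms, of 0] assms by simp
qed

section \<open>One shear\<close>

definition AL_field :: "complex \<Rightarrow> complex \<Rightarrow> complex" where
  "AL_field z w = \<i> * ((1 + of_real ((cmod z)\<^sup>2)) * w - 2 * z)"

text \<open>Since \<open>Re (cnj e * v)\<close> is the Euclidean inner product of \<open>e\<close>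
  and \<open>v\<close>, this is an explicit Euler step that moves a single real coordinate. In that
  coordinate the update is a quadratic polynomial, so its derivative is affine.\<close>

definition shear :: "complex \<Rightarrow> real \<Rightarrow> complex \<Rightarrow> complex \<Rightarrow> complex" where
  "shear e h w z = z + of_real (h * Re (cnj e * AL_field z w)) * e"

text \<open>
  To first order in \<open>h\<close>, the Jacobian of the shear is \<open>1 + h * shear_div\<close>, and it multiplies
  \<open>1 + |z|\<^sup>2\<close> by \<open>1 + h * shear_log\<close>.
\<close>

definition shear_div :: "complex \<Rightarrow> complex \<Rightarrow> complex \<Rightarrow> real" where
  "shear_div e w z = 2 * Re (cnj e * z) * Re (cnj e * (\<i> * w))"

definition shear_log :: "complex \<Rightarrow> complex \<Rightarrow> complex \<Rightarrow> real" where
  "shear_log e w z = 2 * Re (cnj e * z) * Re (cnj e * AL_field z w) / (1 + (cmod z)\<^sup>2)"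

lemma AL_field_Complex:
  "Re (AL_field (Complex x y) w) = - (1 + x\<^sup>2 + y\<^sup>2) * Im w + 2 * y"
  "Im (AL_field (Complex x y) w) = (1 + x\<^sup>2 + y\<^sup>2) * Re w - 2 * x"
  by (simp_all add: AL_field_def cmod_power2 algebra_simps del: of_real_power)

lemma measurable_AL_field [measurable (raw)]:
  assumes [measurable]: "f \<in> borel_measurable M" "g \<in> borel_measurable M"
  shows "(\<lambda>x. AL_field (f x) (g x)) \<in> borel_measurable M"
  unfolding AL_field_def by measurable

lemma measurable_shear [measurable (raw)]:
  assumes [measurable]: "f \<in> borel_measurable M" "g \<in> borel_measurable M" "k \<in> borel_measurable M"
  shows "(\<lambda>x. shear e (k x) (g x) (f x)) \<in> borel_measurable M"
    and "(\<lambda>x. shear_div e (g x) (f x)) \<in> borel_measurable M"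
    and "(\<lambda>x. shear_log e (g x) (f x)) \<in> borel_measurable M"
  unfolding shear_def shear_div_def shear_log_def by measurable

lemma nn_integral_shear_real:
  fixes \<phi> :: "real \<Rightarrow> ennreal"
  assumes [measurable]: "\<phi> \<in> borel_measurable borel" and R: "R > 0" and small: "2 * \<bar>h * s\<bar> * R \<le> 1"
  shows "(\<integral>\<^sup>+x. indicator {-R..R} x * (ennreal (1 + 2 * h * s * x) * \<phi> (x + h * ((1 + x\<^sup>2 + c) * s + r))) \<partial>lborel)
    \<le> (\<integral>\<^sup>+x. \<phi> x \<partial>lborel)"
proof -
  let ?g = "\<lambda>x. x + h * ((1 + x\<^sup>2 + c) * s + r)"
  have "(\<integral>\<^sup>+x. \<phi> x * indicator {?g (-R)..?g R} x \<partial>lborel)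
      = (\<integral>\<^sup>+x. \<phi> (?g x) * ennreal (1 + 2 * h * s * x) * indicator {-R..R} x \<partial>lborel)"
  proof (rule nn_integral_substitution_aux)
    show "(?g has_real_derivative 1 + 2 * h * s * x) (at x)" for x
      by (auto intro!: derivative_eq_intros simp: field_simps)
    show "0 \<le> 1 + 2 * h * s * x" if "x \<in> {-R..R}" for x
    proof -
      have "\<bar>2 * h * s * x\<bar> = 2 * \<bar>h * s\<bar> * \<bar>x\<bar>" by (simp add: abs_mult)
      also have "\<dots> \<le> 2 * \<bar>h * s\<bar> * R" using that by (intro mult_left_mono) auto
      finally show ?thesis using small by linarith
    qed
  qed (use R in \<open>auto intro!: continuous_intros\<close>)
  moreover have "(\<integral>\<^sup>+x. \<phi> x * indicator {?g (-R)..?g R} x \<partial>lborel) \<le> (\<integral>\<^sup>+x. \<phi> x \<partial>lborel)"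
    by (intro nn_integral_mono) (auto simp: indicator_def)
  ultimately show ?thesis by (simp add: mult_ac)
qed

text \<open>Fubini with the moved coordinate inside. The ball is first enlarged to a strip, on which
  the one-dimensional substitution applies.\<close>

lemma nn_integral_shear:
  assumes [measurable]: "\<phi> \<in> borel_measurable borel" and R: "R > 0" and e: "e \<in> {1, \<i>}"
    and small: "2 * \<bar>h\<bar> * cmod w * R \<le> 1"
  shows "(\<integral>\<^sup>+z. indicator (cball 0 R) z * (ennreal (1 + h * shear_div e w z) * \<phi> (shear e h w z)) \<partial>lborel)
    \<le> (\<integral>\<^sup>+z. \<phi> z \<partial>lborel)"
proof -
  have sm: "2 * \<bar>h * s\<bar> * R \<le> 1" if "\<bar>s\<bar> \<le> cmod w" for s
  proof -
    have "2 * \<bar>h * s\<bar> * R = 2 * \<bar>h\<bar> * \<bar>s\<bar> * R" by (simp add: abs_mult)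
    also have "\<dots> \<le> 2 * \<bar>h\<bar> * cmod w * R" using that R by (intro mult_right_mono mult_left_mono) auto
    finally show ?thesis using small by linarith
  qed
  have meas_shear: "(\<lambda>z. indicator (cball 0 R) z * (ennreal (1 + h * shear_div e w z) * \<phi> (shear e h w z)))
      \<in> borel_measurable borel"
  proof -
    have [measurable]: "cball (0::complex) R \<in> sets borel" by simp
    show ?thesis by measurable
  qed
  have Re_le: "\<bar>x\<bar> \<le> R" and Im_le: "\<bar>y\<bar> \<le> R" if "Complex x y \<in> cball 0 R" for x y
    using that abs_Re_le_cmod[of "Complex x y"] abs_Im_le_cmod[of "Complex x y"] by (auto simp del: abs_Re_le_cmod)
  from e consider "e = 1" | "e = \<i>" by auto
  then show ?thesis
  proof cases
    case 1
    have "(\<integral>\<^sup>+x. indicator (cball 0 R) (Complex x y) * (ennreal (1 + h * shear_div e w (Complex x y)) *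
         \<phi> (shear e h w (Complex x y))) \<partial>lborel) \<le> (\<integral>\<^sup>+x. \<phi> (Complex x y) \<partial>lborel)" for y
    proof -
      have "(\<integral>\<^sup>+x. indicator (cball 0 R) (Complex x y) * (ennreal (1 + h * shear_div e w (Complex x y)) *
         \<phi> (shear e h w (Complex x y))) \<partial>lborel) \<le>
        (\<integral>\<^sup>+x. indicator {-R..R} x * (ennreal (1 + 2 * h * (- Im w) * x) *
           \<phi> (Complex (x + h * ((1 + x\<^sup>2 + y\<^sup>2) * (- Im w) + 2 * y)) y)) \<partial>lborel)"
      proof (rule nn_integral_mono, rule mult_mono)
        fix x
        show "indicator (cball 0 R) (Complex x y) \<le> (indicator {-R..R} x :: ennreal)"
          using Re_le[of x y] by (auto simp: indicator_def abs_le_iff)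
        have "shear e h w (Complex x y) = Complex (x + h * ((1 + x\<^sup>2 + y\<^sup>2) * (- Im w) + 2 * y)) y"
          using 1 by (simp add: shear_def AL_field_Complex complex_eq_iff algebra_simps)
        moreover have "shear_div e w (Complex x y) = 2 * x * (- Im w)"
          using 1 by (simp add: shear_div_def)
        ultimately show "ennreal (1 + h * shear_div e w (Complex x y)) * \<phi> (shear e h w (Complex x y))
          \<le> ennreal (1 + 2 * h * (- Im w) * x) * \<phi> (Complex (x + h * ((1 + x\<^sup>2 + y\<^sup>2) * (- Im w) + 2 * y)) y)"
          by (simp add: mult_ac)
      qed auto
      also have "\<dots> \<le> (\<integral>\<^sup>+x. \<phi> (Complex x y) \<partial>lborel)"
        by (rule nn_integral_shear_real[where \<phi> = "\<lambda>x. \<phi> (Complex x y)"])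
           (use R sm[of "- Im w"] abs_Im_le_cmod[of w] in auto)
      finally show ?thesis .
    qed
    then show ?thesis
      unfolding nn_integral_lborel_complex(1)[OF meas_shear] nn_integral_lborel_complex(1)[OF assms(1)]
      by (rule nn_integral_mono)
  next
    case 2
    have "(\<integral>\<^sup>+y. indicator (cball 0 R) (Complex x y) * (ennreal (1 + h * shear_div e w (Complex x y)) *
         \<phi> (shear e h w (Complex x y))) \<partial>lborel) \<le> (\<integral>\<^sup>+y. \<phi> (Complex x y) \<partial>lborel)" for x
    proof -
      have "(\<integral>\<^sup>+y. indicator (cball 0 R) (Complex x y) * (ennreal (1 + h * shear_div e w (Complex x y)) *
         \<phi> (shear e h w (Complex x y))) \<partial>lborel) \<le>
        (\<integral>\<^sup>+y. indicator {-R..R} y * (ennreal (1 + 2 * h * Re w * y) *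
           \<phi> (Complex x (y + h * ((1 + y\<^sup>2 + x\<^sup>2) * Re w + (- 2 * x))))) \<partial>lborel)"
      proof (rule nn_integral_mono, rule mult_mono)
        fix y
        show "indicator (cball 0 R) (Complex x y) \<le> (indicator {-R..R} y :: ennreal)"
          using Im_le[of x y] by (auto simp: indicator_def abs_le_iff)
        have "shear e h w (Complex x y) = Complex x (y + h * ((1 + y\<^sup>2 + x\<^sup>2) * Re w + (- 2 * x)))"
          using 2 by (simp add: shear_def AL_field_Complex complex_eq_iff add_ac)
        moreover have "shear_div e w (Complex x y) = 2 * y * Re w"
          using 2 by (simp add: shear_div_def)
        ultimately show "ennreal (1 + h * shear_div e w (Complex x y)) * \<phi> (shear e h w (Complex x y))
          \<le> ennreal (1 + 2 * h * Re w * y) * \<phi> (Complex x (y + h * ((1 + y\<^sup>2 + x\<^sup>2) * Re w + (- 2 * x))))"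
          by (simp add: mult_ac)
      qed auto
      also have "\<dots> \<le> (\<integral>\<^sup>+y. \<phi> (Complex x y) \<partial>lborel)"
        by (rule nn_integral_shear_real[where \<phi> = "\<lambda>y. \<phi> (Complex x y)"])
           (use R sm[of "Re w"] abs_Re_le_cmod[of w] in auto)
      finally show ?thesis .
    qed
    then show ?thesis
      unfolding nn_integral_lborel_complex(2)[OF meas_shear] nn_integral_lborel_complex(2)[OF assms(1)]
      by (rule nn_integral_mono)
  qed
qed

text \<open>The square expands exactly, and 1 + x \<le> exp x gives the factor a form in which the
  exponents of successive shears add. An upper bound is enough because the density decreases in
  |z|.\<close>

lemma one_plus_cmod_shear:
  assumes e: "e \<in> {1, \<i>}"
  shows "1 + (cmod (shear e h w z))\<^sup>2
    \<le> (1 + (cmod z)\<^sup>2) * exp (h * shear_log e w z + h\<^sup>2 * (cmod (AL_field z w))\<^sup>2)"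
proof -
  define V where "V = Re (cnj e * AL_field z w)"
  have pos: "1 + (cmod z)\<^sup>2 > 0" by (simp add: add_pos_nonneg)
  have "cmod (cnj e * AL_field z w) = cmod (AL_field z w)" using e by (auto simp: norm_mult)
  then have V: "V\<^sup>2 \<le> (cmod (AL_field z w))\<^sup>2"
    using abs_Re_le_cmod[of "cnj e * AL_field z w"] unfolding V_def by (simp add: abs_le_square_iff[symmetric])
  have "1 + (cmod (shear e h w z))\<^sup>2 = 1 + (cmod z)\<^sup>2 + 2 * h * Re (cnj e * z) * V + h\<^sup>2 * V\<^sup>2"
    using e unfolding shear_def V_def[symmetric]
    unfolding cmod_power2 by (auto simp: power2_eq_square algebra_simps)
  also have "\<dots> = (1 + (cmod z)\<^sup>2) * (1 + h * shear_log e w z + h\<^sup>2 * V\<^sup>2 / (1 + (cmod z)\<^sup>2))"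
  proof -
    have "m + 2 * h * x * V + h\<^sup>2 * V\<^sup>2 = m * (1 + h * (2 * x * V / m) + h\<^sup>2 * V\<^sup>2 / m)" if "m > 0" for m x
      using that by (simp add: distrib_left)
    from this[OF pos, of "Re (cnj e * z)"] show ?thesis
      unfolding shear_log_def V_def[symmetric] by simp
  qed
  also have "h\<^sup>2 * V\<^sup>2 / (1 + (cmod z)\<^sup>2) \<le> h\<^sup>2 * V\<^sup>2"
    using pos divide_left_mono[of 1 "1 + (cmod z)\<^sup>2" "h\<^sup>2 * V\<^sup>2"] by simp
  also have "\<dots> \<le> h\<^sup>2 * (cmod (AL_field z w))\<^sup>2" using V by (intro mult_left_mono) auto
  also have "1 + h * shear_log e w z + h\<^sup>2 * (cmod (AL_field z w))\<^sup>2 \<le> exp (h * shear_log e w z + h\<^sup>2 * (cmod (AL_field z w))\<^sup>2)"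
    using exp_ge_add_one_self[of "h * shear_log e w z + h\<^sup>2 * (cmod (AL_field z w))\<^sup>2"] by (simp add: add_ac)
  finally show ?thesis using pos by (simp add: mult_left_mono)
qed

text \<open>
  A lower bound for the logarithm of the Jacobian times the ratio of the densities after and before
  the shear.
\<close>

definition shear_weight :: "real \<Rightarrow> complex \<Rightarrow> real \<Rightarrow> complex \<Rightarrow> complex \<Rightarrow> real" where
  "shear_weight \<beta> e h w z = h * shear_div e w z - (2 + 2 * \<beta>) * (h * shear_log e w z)
     - 2 * (h * shear_div e w z)\<^sup>2 - (2 + 2 * \<beta>) * (h\<^sup>2 * (cmod (AL_field z w))\<^sup>2)"

text \<open>The change of variables reduces this to a pointwise bound: exp of the weight must not
  exceed the Jacobian times the ratio of the densities after and before the shear.\<close>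

lemma site_law_shear:
  assumes \<beta>: "\<beta> > 0" and [measurable]: "f \<in> borel_measurable borel" and R: "R > 0" and e: "e \<in> {1, \<i>}"
    and small: "4 * \<bar>h\<bar> * cmod w * R \<le> 1"
  shows "(\<integral>\<^sup>+z. indicator (cball 0 R) z * (ennreal (exp (shear_weight \<beta> e h w z)) * f (shear e h w z)) \<partial>site_law \<beta>)
    \<le> (\<integral>\<^sup>+z. f z \<partial>site_law \<beta>)"
proof -
  have [measurable]: "cball (0::complex) R \<in> sets borel" by simp
  have *: "exp (shear_weight \<beta> e h w z) * site_density \<beta> z
      \<le> (1 + h * shear_div e w z) * site_density \<beta> (shear e h w z)" if z: "z \<in> cball 0 R" for z
  proof -
    let ?D = "h * shear_div e w z" and ?L = "h * shear_log e w z + h\<^sup>2 * (cmod (AL_field z w))\<^sup>2"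
    let ?u = "shear e h w z"
    have "\<bar>Re (cnj e * z)\<bar> \<le> R" "\<bar>Re (cnj e * (\<i> * w))\<bar> \<le> cmod w"
      using e z abs_Re_le_cmod[of "cnj e * z"] abs_Re_le_cmod[of "cnj e * (\<i> * w)"]
      by (auto simp: norm_mult)
    then have "\<bar>?D\<bar> \<le> \<bar>h\<bar> * (2 * R * cmod w)"
      using R unfolding shear_div_def abs_mult by (intro mult_mono) auto
    \<comment> \<open>The smallness condition is twice as strict as the monotonicity of the shear
      demands. On |D| \<le> 1/2 one has ln (1 + D) \<ge> D - 2 D^2, which is the source of the
      quadratic divergence term in \<open>shear_weight\<close>.\<close>
    then have D: "\<bar>?D\<bar> \<le> 1/2" using small by (simp add: mult_ac)
    have D': "exp (?D - 2 * ?D\<^sup>2) \<le> 1 + ?D"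
    proof -
      have "?D - 2 * ?D\<^sup>2 \<le> ln (1 + ?D)"
        using abs_ln_one_plus_x_minus_x_bound[OF D] by linarith
      then show ?thesis using D by (simp add: ln_ge_iff abs_le_iff)
    qed
    have posz: "1 + (cmod z)\<^sup>2 > 0" and posu: "1 + (cmod ?u)\<^sup>2 > 0" by (simp_all add: add_pos_nonneg)
    have "(1 + (cmod ?u)\<^sup>2) powr (2 + 2 * \<beta>) \<le> ((1 + (cmod z)\<^sup>2) * exp ?L) powr (2 + 2 * \<beta>)"
      using \<beta> posu by (intro powr_mono2 one_plus_cmod_shear e) auto
    also have "\<dots> = (1 + (cmod z)\<^sup>2) powr (2 + 2 * \<beta>) * exp ((2 + 2 * \<beta>) * ?L)"
      using posz by (simp add: powr_mult exp_powr_real mult.commute)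
    finally have "1 / (1 + (cmod z)\<^sup>2) powr (2 + 2 * \<beta>) \<le> exp ((2 + 2 * \<beta>) * ?L) * (1 / (1 + (cmod ?u)\<^sup>2) powr (2 + 2 * \<beta>))"
      using posz posu by (simp add: divide_simps mult_ac)
    then have "site_density \<beta> z \<le> exp ((2 + 2 * \<beta>) * ?L) * site_density \<beta> ?u"
    proof -
      assume a: "1 / (1 + (cmod z)\<^sup>2) powr (2 + 2 * \<beta>) \<le> exp ((2 + 2 * \<beta>) * ?L) * (1 / (1 + (cmod ?u)\<^sup>2) powr (2 + 2 * \<beta>))"
      show ?thesis
        unfolding site_density_def mult.left_commute[of "exp ((2 + 2 * \<beta>) * ?L)"]
        using \<beta> by (intro mult_left_mono a) auto
    qed
    then have "exp (shear_weight \<beta> e h w z) * site_density \<beta> z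
        \<le> exp (shear_weight \<beta> e h w z) * (exp ((2 + 2 * \<beta>) * ?L) * site_density \<beta> ?u)"
      by (intro mult_left_mono) auto
    also have "\<dots> = exp (shear_weight \<beta> e h w z + (2 + 2 * \<beta>) * ?L) * site_density \<beta> ?u"
      by (simp only: exp_add mult.assoc)
    also have "\<dots> = exp (?D - 2 * ?D\<^sup>2) * site_density \<beta> ?u"
      by (simp add: shear_weight_def distrib_left)
    also have "\<dots> \<le> (1 + ?D) * site_density \<beta> ?u"
      using D' \<beta> by (intro mult_right_mono) (auto simp: site_density_def)
    finally show ?thesis .
  qed
  have "(\<integral>\<^sup>+z. indicator (cball 0 R) z * (ennreal (exp (shear_weight \<beta> e h w z)) * f (shear e h w z)) \<partial>site_law \<beta>)
     = (\<integral>\<^sup>+z. ennreal (site_density \<beta> z) * (indicator (cball 0 R) z * (ennreal (exp (shear_weight \<beta> e h w z)) * f (shear e h w z))) \<partial>lborel)"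
    unfolding shear_weight_def by (subst nn_integral_site_law) auto
  also have "\<dots> \<le> (\<integral>\<^sup>+z. indicator (cball 0 R) z * (ennreal (1 + h * shear_div e w z) *
        (ennreal (site_density \<beta> (shear e h w z)) * f (shear e h w z))) \<partial>lborel)"
  proof (intro nn_integral_mono)
    fix z
    show "ennreal (site_density \<beta> z) * (indicator (cball 0 R) z * (ennreal (exp (shear_weight \<beta> e h w z)) * f (shear e h w z)))
      \<le> indicator (cball 0 R) z * (ennreal (1 + h * shear_div e w z) * (ennreal (site_density \<beta> (shear e h w z)) * f (shear e h w z)))"
    proof (cases "z \<in> cball 0 R")
      case True
      have nonneg: "site_density \<beta> y \<ge> 0" for y using \<beta> by (simp add: site_density_def)
      have "ennreal (exp (shear_weight \<beta> e h w z)) * ennreal (site_density \<beta> z)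
         = ennreal (exp (shear_weight \<beta> e h w z) * site_density \<beta> z)"
        using nonneg by (simp add: ennreal_mult)
      also have "\<dots> \<le> ennreal ((1 + h * shear_div e w z) * site_density \<beta> (shear e h w z))"
        using *[OF True] by (rule ennreal_leI)
      also have "\<dots> = ennreal (1 + h * shear_div e w z) * ennreal (site_density \<beta> (shear e h w z))"
        using nonneg by (simp add: ennreal_mult'')
      finally show ?thesis
        using True by (simp add: mult.assoc[symmetric] mult_right_mono mult.commute[of "ennreal (site_density \<beta> z)"])
    qed simp
  qed
  also have "\<dots> \<le> (\<integral>\<^sup>+z. ennreal (site_density \<beta> z) * f z \<partial>lborel)"
    using small
    by (intro nn_integral_shear[where \<phi> = "\<lambda>z. ennreal (site_density \<beta> z) * f z"] R e) auto
  also have "\<dots> = (\<integral>\<^sup>+z. f z \<partial>site_law \<beta>)" by (subst nn_integral_site_law) auto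
  finally show ?thesis .
qed

section \<open>White noise and single-coordinate steps\<close>

lemma prob_space_white_noise: "\<beta> > 0 \<Longrightarrow> prob_space (white_noise \<beta>)"
  unfolding white_noise_eq by (intro prob_space_PiM prob_space_site_law)

lemma sets_white_noise [measurable_cong]: "sets (white_noise \<beta>) = sets (\<Pi>\<^sub>M n\<in>UNIV. borel)"
  unfolding white_noise_eq by (intro sets_PiM_cong) auto

lemma sets_white_noise_borel: "sets (white_noise \<beta>) = sets borel"
  unfolding sets_white_noise by (rule sets_PiM_equal_borel)

lemma space_white_noise [simp]: "space (white_noise \<beta>) = UNIV"
  by (simp add: white_noise_eq space_PiM)

lemma measurable_white_noise_component [measurable]: "(\<lambda>x. x n) \<in> white_noise \<beta> \<rightarrow>\<^sub>M borel"
  by (subst measurable_cong_sets[OF sets_white_noise refl]) simp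

lemma nn_integral_white_noise_component:
  assumes "\<beta> > 0" and [measurable]: "f \<in> borel_measurable borel"
  shows "(\<integral>\<^sup>+x. f (x n) \<partial>white_noise \<beta>) = (\<integral>\<^sup>+z. f z \<partial>site_law \<beta>)"
proof -
  have "distr (white_noise \<beta>) (site_law \<beta>) (\<lambda>x. x n) = site_law \<beta>"
    unfolding white_noise_eq using assms(1) by (intro distr_PiM_component prob_space_site_law) auto
  then have "(\<integral>\<^sup>+z. f z \<partial>site_law \<beta>) = (\<integral>\<^sup>+z. f z \<partial>distr (white_noise \<beta>) (site_law \<beta>) (\<lambda>x. x n))"
    by simp
  also have "\<dots> = (\<integral>\<^sup>+x. f (x n) \<partial>white_noise \<beta>)"
    by (subst nn_integral_distr) (auto simp: measurable_cong_sets[OF refl sets_site_law] measurable_cong_sets[OF sets_site_law refl])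
  finally show ?thesis by simp
qed

text \<open>The neighbour sum at a site depends only on the other sites. With site \<open>n\<close>
  as the inner variable, an update of that site is therefore a one-site problem with a constant
  parameter.\<close>

lemma nn_integral_white_noise_update:
  assumes "\<beta> > 0" and [measurable]: "f \<in> borel_measurable (white_noise \<beta>)"
  shows "(\<integral>\<^sup>+x. f x \<partial>white_noise \<beta>)
      = (\<integral>\<^sup>+X. \<integral>\<^sup>+z. f (X(n := z)) \<partial>site_law \<beta> \<partial>(\<Pi>\<^sub>M k\<in>UNIV - {n}. site_law \<beta>))"
    and "X \<in> space (\<Pi>\<^sub>M k\<in>UNIV - {n}. site_law \<beta>) \<Longrightarrow> (\<lambda>z. f (X(n := z))) \<in> borel_measurable borel"
proof -
  let ?P = "\<Pi>\<^sub>M k\<in>UNIV - {n}. site_law \<beta>"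
  interpret s: prob_space "site_law \<beta>" by (rule prob_space_site_law) fact
  interpret P: prob_space ?P by (intro prob_space_PiM prob_space_site_law assms(1))
  interpret ps: pair_sigma_finite "site_law \<beta>" ?P ..
  have ins: "insert n (UNIV - {n}) = (UNIV :: int set)" by auto
  have m [measurable]: "(\<lambda>(z, X). X(n := z)) \<in> site_law \<beta> \<Otimes>\<^sub>M ?P \<rightarrow>\<^sub>M white_noise \<beta>"
  proof -
    have "(\<lambda>p. (fst (snd p, fst p))(n := snd (snd p, fst p))) \<in> site_law \<beta> \<Otimes>\<^sub>M ?P \<rightarrow>\<^sub>M (\<Pi>\<^sub>M k\<in>insert n (UNIV - {n}). site_law \<beta>)"
      by (rule measurable_compose[OF _ measurable_add_dim[unfolded case_prod_beta]]) measurable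
    then show ?thesis by (simp add: white_noise_eq ins case_prod_beta)
  qed
  have "white_noise \<beta> = distr (site_law \<beta> \<Otimes>\<^sub>M ?P) (white_noise \<beta>) (\<lambda>(z, X). X(n := z))"
    using distr_pair_PiM_eq_PiM[of "UNIV - {n}" "\<lambda>_. site_law \<beta>" n, OF prob_space_site_law prob_space_site_law] assms(1)
    unfolding ins white_noise_eq by simp
  then have "(\<integral>\<^sup>+x. f x \<partial>white_noise \<beta>) = (\<integral>\<^sup>+x. f x \<partial>distr (site_law \<beta> \<Otimes>\<^sub>M ?P) (white_noise \<beta>) (\<lambda>(z, X). X(n := z)))"
    by simp
  also have "\<dots> = (\<integral>\<^sup>+p. f ((snd p)(n := fst p)) \<partial>(site_law \<beta> \<Otimes>\<^sub>M ?P))"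
    by (subst nn_integral_distr) (auto simp: case_prod_beta)
  also have "\<dots> = (\<integral>\<^sup>+X. \<integral>\<^sup>+z. f (X(n := z)) \<partial>site_law \<beta> \<partial>?P)"
    using m by (subst ps.nn_integral_snd[symmetric]) (auto simp: case_prod_beta)
  finally show "(\<integral>\<^sup>+x. f x \<partial>white_noise \<beta>) = (\<integral>\<^sup>+X. \<integral>\<^sup>+z. f (X(n := z)) \<partial>site_law \<beta> \<partial>?P)" .
  show "(\<lambda>z. f (X(n := z))) \<in> borel_measurable borel" if X: "X \<in> space ?P"
  proof -
    have "(\<lambda>z. (z, X)) \<in> site_law \<beta> \<rightarrow>\<^sub>M site_law \<beta> \<Otimes>\<^sub>M ?P" using X by measurable
    from measurable_compose[OF measurable_compose[OF this m] assms(2)]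
    have "(\<lambda>z. f (X(n := z))) \<in> borel_measurable (site_law \<beta>)" by simp
    then show ?thesis by (simp add: measurable_cong_sets[OF sets_site_law refl])
  qed
qed

section \<open>Truncation to a box and updates of one coordinate\<close>

definition box_sites :: "nat \<Rightarrow> int set" where
  "box_sites N = {- int N..int N}"

lemma finite_box_sites [simp]: "finite (box_sites N)"
  by (simp add: box_sites_def)

definition nbr_sum :: "nat \<Rightarrow> (int \<Rightarrow> complex) \<Rightarrow> int \<Rightarrow> complex" where
  "nbr_sum N x n = (if n + 1 \<in> box_sites N then x (n + 1) else 0)
     + (if n - 1 \<in> box_sites N then x (n - 1) else 0)"

lemma nbr_sum_upd [simp]: "nbr_sum N (x(n := z)) n = nbr_sum N x n"
  by (simp add: nbr_sum_def)

lemma nbr_sum_bound: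
  assumes "\<And>k. k \<in> box_sites N \<Longrightarrow> cmod (x k) \<le> r" "r \<ge> 0"
  shows "cmod (nbr_sum N x n) \<le> 2 * r"
proof -
  have "cmod (nbr_sum N x n) \<le> r + r"
    unfolding nbr_sum_def using assms by (intro norm_triangle_mono) auto
  then show ?thesis by simp
qed

lemma nbr_sum_diff_bound:
  assumes "\<And>k. k \<in> box_sites N \<Longrightarrow> cmod (x k - y k) \<le> r" "r \<ge> 0"
  shows "cmod (nbr_sum N x n - nbr_sum N y n) \<le> 2 * r"
proof -
  have "nbr_sum N x n - nbr_sum N y n = nbr_sum N (\<lambda>k. x k - y k) n"
    by (simp add: nbr_sum_def)
  then show ?thesis using nbr_sum_bound[of N "\<lambda>k. x k - y k" r n] assms by simp
qed

text \<open>The index \<open>(n, e)\<close> stands for the real coordinate of site \<open>n\<close> in the direction \<open>e \<in> {1, \<i>}\<close>.\<close>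

definition microstep :: "nat \<Rightarrow> real \<Rightarrow> int \<times> complex \<Rightarrow> (int \<Rightarrow> complex) \<Rightarrow> (int \<Rightarrow> complex)" where
  "microstep N h i x = x(fst i := shear (snd i) h (nbr_sum N x (fst i)) (x (fst i)))"

lemma measurable_fun_upd_int:
  assumes [measurable]: "f \<in> M \<rightarrow>\<^sub>M (\<Pi>\<^sub>M n\<in>(UNIV :: int set). borel)" "g \<in> borel_measurable M"
  shows "(\<lambda>x. (f x)(n := (g x :: complex))) \<in> M \<rightarrow>\<^sub>M (\<Pi>\<^sub>M n\<in>UNIV. borel)"
proof (rule measurable_PiM_single')
  fix k :: int
  show "(\<lambda>x. ((f x)(n := g x)) k) \<in> borel_measurable M"
    by (cases "k = n") simp_all
qed (simp add: space_PiM)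

lemma measurable_nbr_sum [measurable (raw)]:
  assumes [measurable]: "f \<in> M \<rightarrow>\<^sub>M (\<Pi>\<^sub>M n\<in>UNIV. borel)"
  shows "(\<lambda>x. nbr_sum N (f x) n) \<in> borel_measurable M"
  unfolding nbr_sum_def by measurable

lemma measurable_microstep [measurable (raw)]:
  assumes [measurable]: "f \<in> M \<rightarrow>\<^sub>M (\<Pi>\<^sub>M n\<in>UNIV. borel)" "g \<in> borel_measurable M"
  shows "(\<lambda>x. microstep N (g x) i (f x)) \<in> M \<rightarrow>\<^sub>M (\<Pi>\<^sub>M n\<in>UNIV. borel)"
  unfolding microstep_def by (intro measurable_fun_upd_int) measurable

definition safe_at :: "nat \<Rightarrow> real \<Rightarrow> int \<times> complex \<Rightarrow> (int \<Rightarrow> complex) \<Rightarrow> bool" where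
  "safe_at N R i x \<longleftrightarrow> cmod (x (fst i)) \<le> R \<and> cmod (nbr_sum N x (fst i)) \<le> 2 * R"

lemma white_noise_microstep:
  assumes \<beta>: "\<beta> > 0" and [measurable]: "f \<in> borel_measurable (white_noise \<beta>)" and R: "R > 0"
    and e: "snd i \<in> {1, \<i>}" and small: "8 * \<bar>h\<bar> * R\<^sup>2 \<le> 1"
  shows "(\<integral>\<^sup>+x. indicator {x. safe_at N R i x} x *
      (ennreal (exp (shear_weight \<beta> (snd i) h (nbr_sum N x (fst i)) (x (fst i)))) * f (microstep N h i x)) \<partial>white_noise \<beta>)
    \<le> (\<integral>\<^sup>+x. f x \<partial>white_noise \<beta>)"
proof -
  define n e where "n = fst i" and "e = snd i"
  let ?P = "\<Pi>\<^sub>M k\<in>UNIV - {n}. site_law \<beta>"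
  have id: "(\<lambda>x. x) \<in> white_noise \<beta> \<rightarrow>\<^sub>M (\<Pi>\<^sub>M n\<in>UNIV. borel)"
    by (rule measurable_ident_sets[OF sets_white_noise])
  have [measurable]: "(\<lambda>x. nbr_sum N x n) \<in> borel_measurable (white_noise \<beta>)"
    using id by (rule measurable_nbr_sum)
  have [measurable]: "microstep N h i \<in> white_noise \<beta> \<rightarrow>\<^sub>M white_noise \<beta>"
    using measurable_microstep[OF id, of "\<lambda>_. h" N i] by (simp add: measurable_cong_sets[OF refl sets_white_noise])
  have "(\<integral>\<^sup>+x. indicator {x. safe_at N R i x} x *
      (ennreal (exp (shear_weight \<beta> e h (nbr_sum N x n) (x n))) * f (microstep N h i x)) \<partial>white_noise \<beta>)
    = (\<integral>\<^sup>+X. \<integral>\<^sup>+z. indicator {x. safe_at N R i x} (X(n := z)) *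
      (ennreal (exp (shear_weight \<beta> e h (nbr_sum N (X(n := z)) n) ((X(n := z)) n))) * f (microstep N h i (X(n := z)))) \<partial>site_law \<beta> \<partial>?P)"
    unfolding shear_weight_def safe_at_def n_def[symmetric]
    by (rule nn_integral_white_noise_update(1)[OF \<beta>]) measurable
  also have "\<dots> \<le> (\<integral>\<^sup>+X. \<integral>\<^sup>+z. f (X(n := z)) \<partial>site_law \<beta> \<partial>?P)"
  proof (rule nn_integral_mono)
    fix X assume X: "X \<in> space ?P"
    let ?w = "nbr_sum N X n"
    have eq: "indicator {x. safe_at N R i x} (X(n := z)) *
      (ennreal (exp (shear_weight \<beta> e h (nbr_sum N (X(n := z)) n) ((X(n := z)) n))) * f (microstep N h i (X(n := z))))
      = (if cmod ?w \<le> 2 * R then indicator (cball 0 R) z * (ennreal (exp (shear_weight \<beta> e h ?w z)) * f (X(n := shear e h ?w z))) else 0)" for z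
      by (auto simp: safe_at_def n_def[symmetric] e_def[symmetric] microstep_def indicator_def)
    show "(\<integral>\<^sup>+z. indicator {x. safe_at N R i x} (X(n := z)) *
      (ennreal (exp (shear_weight \<beta> e h (nbr_sum N (X(n := z)) n) ((X(n := z)) n))) * f (microstep N h i (X(n := z)))) \<partial>site_law \<beta>)
      \<le> (\<integral>\<^sup>+z. f (X(n := z)) \<partial>site_law \<beta>)"
    \<comment> \<open>The condition on the neighbour sum is constant in the inner variable, and its
      bound \<open>2 * R\<close> turns the smallness required by \<open>site_law_shear\<close> into
      8 |h| R^2 \<le> 1.\<close>
    proof (cases "cmod ?w \<le> 2 * R")
      case True
      have "4 * \<bar>h\<bar> * cmod ?w * R \<le> 4 * \<bar>h\<bar> * (2 * R) * R"
        using True R by (intro mult_right_mono mult_left_mono) auto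
      then have "4 * \<bar>h\<bar> * cmod ?w * R \<le> 1" using small by (simp add: power2_eq_square mult_ac)
      then show ?thesis
        unfolding eq using True e R e_def
        by (auto intro!: site_law_shear[OF \<beta> nn_integral_white_noise_update(2)[OF \<beta> assms(2) X]])
    next
      case False
      then show ?thesis unfolding eq by simp
    qed
  qed
  also have "\<dots> = (\<integral>\<^sup>+x. f x \<partial>white_noise \<beta>)"
    by (rule nn_integral_white_noise_update(1)[OF \<beta>, symmetric]) fact
  finally show ?thesis unfolding n_def e_def .
qed

lemma measurable_microstep_white_noise: "microstep N h i \<in> white_noise \<beta> \<rightarrow>\<^sub>M white_noise \<beta>"
  using measurable_microstep[OF measurable_ident_sets[OF sets_white_noise], of "\<lambda>_. h" \<beta> N i]
  by (simp add: measurable_cong_sets[OF refl sets_white_noise])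

section \<open>Lists of updates and the quantities accumulated along them\<close>

text \<open>Each summand is evaluated at the configuration reached when its update takes place, not
  at the initial one. The function is a parameter because the logarithmic weight, the divergence,
  the energy growth and the displacement all accumulate in this way.\<close>

primrec path_sum :: "nat \<Rightarrow> real \<Rightarrow> (int \<Rightarrow> complex \<Rightarrow> complex \<Rightarrow> complex \<Rightarrow> 'a :: real_normed_vector) \<Rightarrow>
    (int \<times> complex) list \<Rightarrow> (int \<Rightarrow> complex) \<Rightarrow> 'a" where
  "path_sum N h G [] x = 0"
| "path_sum N h G (i # L) x = G (fst i) (snd i) (nbr_sum N x (fst i)) (x (fst i)) + path_sum N h G L (microstep N h i x)"

primrec path_safe :: "nat \<Rightarrow> real \<Rightarrow> real \<Rightarrow> (int \<times> complex) list \<Rightarrow> (int \<Rightarrow> complex) \<Rightarrow> bool" where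
  "path_safe N h R [] x \<longleftrightarrow> True"
| "path_safe N h R (i # L) x \<longleftrightarrow> safe_at N R i x \<and> path_safe N h R L (microstep N h i x)"

text \<open>The integrand belonging to the tail of the list is itself the test function for the
  first update. Measurability is therefore part of the claim.\<close>

lemma white_noise_path:
  assumes \<beta>: "\<beta> > 0" and R: "R > 0" and small: "8 * \<bar>h\<bar> * R\<^sup>2 \<le> 1" 
    and f: "f \<in> borel_measurable (white_noise \<beta>)"
    and L: "\<And>i. i \<in> set L \<Longrightarrow> snd i \<in> {1, \<i>}"
  shows "(\<lambda>x. indicator {x. path_safe N h R L x} x *
      (ennreal (exp (path_sum N h (\<lambda>n e w z. shear_weight \<beta> e h w z) L x)) * f (fold (microstep N h) L x)))
      \<in> borel_measurable (white_noise \<beta>) \<and>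
    (\<integral>\<^sup>+x. indicator {x. path_safe N h R L x} x *
      (ennreal (exp (path_sum N h (\<lambda>n e w z. shear_weight \<beta> e h w z) L x)) * f (fold (microstep N h) L x)) \<partial>white_noise \<beta>)
    \<le> (\<integral>\<^sup>+x. f x \<partial>white_noise \<beta>)"
  using L
proof (induction L)
  case Nil
  then show ?case using f by simp
next
  case (Cons i L)
  define F where "F = (\<lambda>x. indicator {x. path_safe N h R L x} x *
      (ennreal (exp (path_sum N h (\<lambda>n e w z. shear_weight \<beta> e h w z) L x)) * f (fold (microstep N h) L x)))"
  have F [measurable]: "F \<in> borel_measurable (white_noise \<beta>)" and IH: "(\<integral>\<^sup>+x. F x \<partial>white_noise \<beta>) \<le> (\<integral>\<^sup>+x. f x \<partial>white_noise \<beta>)"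
    using Cons unfolding F_def by auto
  note [measurable] = measurable_microstep_white_noise
  have [measurable]: "(\<lambda>x. nbr_sum N x n) \<in> borel_measurable (white_noise \<beta>)" for n
    using measurable_ident_sets[OF sets_white_noise] by (rule measurable_nbr_sum)
  have eq: "indicator {x. path_safe N h R (i # L) x} x *
      (ennreal (exp (path_sum N h (\<lambda>n e w z. shear_weight \<beta> e h w z) (i # L) x)) * f (fold (microstep N h) (i # L) x))
    = indicator {x. safe_at N R i x} x *
      (ennreal (exp (shear_weight \<beta> (snd i) h (nbr_sum N x (fst i)) (x (fst i)))) * F (microstep N h i x))" for x
    unfolding F_def by (auto simp: indicator_def exp_add ennreal_mult mult_ac)
  have "(\<lambda>x. indicator {x. safe_at N R i x} x *
      (ennreal (exp (shear_weight \<beta> (snd i) h (nbr_sum N x (fst i)) (x (fst i)))) * F (microstep N h i x)))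
     \<in> borel_measurable (white_noise \<beta>)"
    unfolding safe_at_def shear_weight_def by measurable
  moreover have "(\<integral>\<^sup>+x. indicator {x. safe_at N R i x} x *
      (ennreal (exp (shear_weight \<beta> (snd i) h (nbr_sum N x (fst i)) (x (fst i)))) * F (microstep N h i x)) \<partial>white_noise \<beta>)
      \<le> (\<integral>\<^sup>+x. F x \<partial>white_noise \<beta>)"
    by (rule white_noise_microstep[OF \<beta> F R _ small]) (use Cons.prems in auto)
  ultimately show ?case unfolding eq using IH by auto
qed

lemma fold_microstep_eq:
  "fold (microstep N h) L x k
    = x k + of_real h * path_sum N h (\<lambda>n e w z. if n = k then of_real (Re (cnj e * AL_field z w)) * e else 0) L x"
  by (induction L arbitrary: x) (auto simp: microstep_def shear_def algebra_simps)

section \<open>The log energy along updates\<close>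

text \<open>The white noise density of the box is a constant times exp of -(2 + 2 \<beta>) times
  this energy. Its rate of change along the truncated flow is the sum of \<open>shear_log\<close>,
  which vanishes; hence its role as an a priori bound.\<close>

definition log_energy :: "nat \<Rightarrow> (int \<Rightarrow> complex) \<Rightarrow> real" where
  "log_energy N x = (\<Sum>n\<in>box_sites N. ln (1 + (cmod (x n))\<^sup>2))"

lemma log_energy_microstep:
  assumes "snd i \<in> {1, \<i>}" "fst i \<in> box_sites N"
  shows "log_energy N (microstep N h i x) \<le> log_energy N x + h * shear_log (snd i) (nbr_sum N x (fst i)) (x (fst i))
     + h\<^sup>2 * (cmod (AL_field (x (fst i)) (nbr_sum N x (fst i))))\<^sup>2"
proof -
  let ?n = "fst i" let ?w = "nbr_sum N x ?n" let ?z = "x ?n"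
  let ?u = "shear (snd i) h ?w ?z"
  have p: "1 + (cmod v)\<^sup>2 > 0" for v by (simp add: add_pos_nonneg)
  have split: "log_energy N y = ln (1 + (cmod (y ?n))\<^sup>2) + (\<Sum>n\<in>box_sites N - {?n}. ln (1 + (cmod (y n))\<^sup>2))" for y
    unfolding log_energy_def using assms(2) by (intro sum.remove) auto
  have "ln (1 + (cmod ?u)\<^sup>2) \<le> ln ((1 + (cmod ?z)\<^sup>2) * exp (h * shear_log (snd i) ?w ?z + h\<^sup>2 * (cmod (AL_field ?z ?w))\<^sup>2))"
    using one_plus_cmod_shear[OF assms(1)] p by (subst ln_le_cancel_iff) (auto intro!: mult_pos_pos)
  also have "\<dots> = ln (1 + (cmod ?z)\<^sup>2) + (h * shear_log (snd i) ?w ?z + h\<^sup>2 * (cmod (AL_field ?z ?w))\<^sup>2)"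
    using p[of ?z] by (subst ln_mult) auto
  finally have "ln (1 + (cmod ?u)\<^sup>2) \<le> \<dots>" .
  then show ?thesis unfolding split by (simp add: microstep_def)
qed

lemma log_energy_path:
  assumes "\<And>i. i \<in> set L \<Longrightarrow> snd i \<in> {1, \<i>} \<and> fst i \<in> box_sites N"
  shows "log_energy N (fold (microstep N h) L x) \<le> log_energy N x + h * path_sum N h (\<lambda>n. shear_log) L x
     + h\<^sup>2 * path_sum N h (\<lambda>n e w z. (cmod (AL_field z w))\<^sup>2) L x"
  using assms
proof (induction L arbitrary: x)
  case (Cons i L)
  have "log_energy N (fold (microstep N h) (i # L) x) \<le> log_energy N (microstep N h i x) + h * path_sum N h (\<lambda>n. shear_log) L (microstep N h i x)
     + h\<^sup>2 * path_sum N h (\<lambda>n e w z. (cmod (AL_field z w))\<^sup>2) L (microstep N h i x)"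
    using Cons by auto
  moreover have "log_energy N (microstep N h i x) \<le> log_energy N x + h * shear_log (snd i) (nbr_sum N x (fst i)) (x (fst i))
     + h\<^sup>2 * (cmod (AL_field (x (fst i)) (nbr_sum N x (fst i))))\<^sup>2"
    using Cons by (intro log_energy_microstep) auto
  ultimately show ?case by (simp add: algebra_simps)
qed simp

text \<open>Turns an energy bound into confinement to a bounded region, on which the field is
  bounded and uniformly continuous.\<close>

lemma cmod_le_log_energy:
  assumes "k \<in> box_sites N"
  shows "cmod (x k) \<le> exp (log_energy N x)"
proof -
  have pos: "1 + (cmod (x k))\<^sup>2 > 0" by (simp add: add_pos_nonneg)
  have "ln (1 + (cmod (x k))\<^sup>2) \<le> log_energy N x"
    unfolding log_energy_def using assms by (intro member_le_sum) auto
  then have "1 + (cmod (x k))\<^sup>2 \<le> exp (log_energy N x)"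
    using pos by (metis exp_le_cancel_iff exp_ln)
  moreover have "cmod (x k) \<le> 1 + (cmod (x k))\<^sup>2"
    using zero_le_power2[of "cmod (x k) - 1/2"] unfolding power2_diff by (simp add: power2_eq_square)
  ultimately show ?thesis by linarith
qed

text \<open>The distance \<open>d\<close> already covered and the cost |h| B of each remaining
  update are charged to one budget \<delta> \<le> 1. The path then stays where \<open>B\<close>
  bounds the field, and every summand of a path sum can be replaced by its value at the fixed
  configuration \<open>y\<close> at the price \<epsilon>.\<close>

lemma path_close:
  fixes d \<delta> \<epsilon> h B R :: real
  assumes R: "R \<ge> 0" and y: "\<And>k. k \<in> box_sites N \<Longrightarrow> cmod (y k) \<le> R"
    and B: "\<And>e w z. e \<in> {1, \<i>} \<Longrightarrow> cmod w \<le> 2 * (R + 1) \<Longrightarrow> cmod z \<le> R + 1 \<Longrightarrow> cmod (AL_field z w) \<le> B"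
    and L: "\<And>i. i \<in> set L \<Longrightarrow> snd i \<in> {1, \<i>} \<and> fst i \<in> box_sites N"
    and x: "\<And>k. k \<in> box_sites N \<Longrightarrow> cmod (x k - y k) \<le> d"
    and \<delta>: "d + length L * (\<bar>h\<bar> * B) \<le> \<delta>" "\<delta> \<le> 1" and d: "d \<ge> 0"
  shows "path_safe N h (R + 1) L x"
    and "k \<in> box_sites N \<Longrightarrow> cmod (fold (microstep N h) L x k - y k) \<le> \<delta>"
    and "(\<And>n e w z w' z'. e \<in> {1, \<i>} \<Longrightarrow> cmod w \<le> 2 * (R + 1) \<Longrightarrow> cmod z \<le> R + 1 \<Longrightarrow> cmod w' \<le> 2 * (R + 1) \<Longrightarrow> cmod z' \<le> R + 1
       \<Longrightarrow> cmod (w - w') \<le> 2 * \<delta> \<Longrightarrow> cmod (z - z') \<le> \<delta> \<Longrightarrow> norm (G n e w z - G n e w' z') \<le> \<epsilon>) \<Longrightarrow>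
      norm (path_sum N h G L x - (\<Sum>i\<leftarrow>L. G (fst i) (snd i) (nbr_sum N y (fst i)) (y (fst i)))) \<le> length L * \<epsilon>"
  using L x \<delta>(1) d
proof (induction L arbitrary: x d)
  case Nil
  {
    case 1 then show ?case by simp
  next
    case 2 then show ?case by (auto intro: order_trans)
  next
    case 3 then show ?case by simp
  }
next
  case (Cons i L)
  let ?n = "fst i" and ?e = "snd i"
  \<comment> \<open>One update, stated for all \<open>x\<close> and \<open>d\<close> because the
    three conclusions share it in the induction step.\<close>
  have *: "safe_at N (R + 1) i x \<and> cmod (nbr_sum N y ?n) \<le> 2 * (R + 1) \<and> cmod (y ?n) \<le> R + 1 \<and>
      cmod (nbr_sum N x ?n - nbr_sum N y ?n) \<le> 2 * \<delta> \<and> cmod (x ?n - y ?n) \<le> \<delta> \<and>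
      (\<forall>k\<in>box_sites N. cmod (microstep N h i x k - y k) \<le> d + \<bar>h\<bar> * B) \<and> 0 \<le> B"
    if i: "?e \<in> {1, \<i>}" "?n \<in> box_sites N" and x: "\<And>k. k \<in> box_sites N \<Longrightarrow> cmod (x k - y k) \<le> d"
      and le: "d + length (i # L) * (\<bar>h\<bar> * B) \<le> \<delta>" and d: "d \<ge> 0"
    for x d
  proof -
    let ?w = "nbr_sum N x ?n" let ?z = "x ?n"
    have "cmod (AL_field 0 0) \<le> B" using B[of 1 0 0] R by simp
    then have B0: "B \<ge> 0" using norm_ge_zero order_trans by blast
    have dd: "d \<le> \<delta>" using le B0 by (smt (verit) abs_ge_zero mult_nonneg_nonneg of_nat_0_le_iff)
    have xb: "cmod (x k) \<le> R + 1" if "k \<in> box_sites N" for k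
      using x[OF that] y[OF that] dd \<delta>(2) norm_triangle_sub[of "x k" "y k"] by linarith
    have yb: "cmod (y k) \<le> R + 1" if "k \<in> box_sites N" for k
      using y[OF that] by simp
    have w: "cmod ?w \<le> 2 * (R + 1)" using xb R by (intro nbr_sum_bound) auto
    have F: "cmod (AL_field ?z ?w) \<le> B" using B[of 1] w xb i by auto
    have "\<bar>Re (cnj ?e * AL_field ?z ?w)\<bar> \<le> cmod (AL_field ?z ?w)"
      using i abs_Re_le_cmod[of "cnj ?e * AL_field ?z ?w"] by (auto simp: norm_mult)
    then have "\<bar>h * Re (cnj ?e * AL_field ?z ?w)\<bar> \<le> \<bar>h\<bar> * B"
      using F by (auto simp: abs_mult intro!: mult_left_mono)
    then have "cmod (of_real (h * Re (cnj ?e * AL_field ?z ?w)) * ?e) \<le> \<bar>h\<bar> * B"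
      using i by (auto simp: norm_mult)
    then have "cmod (microstep N h i x k - x k) \<le> \<bar>h\<bar> * B" for k
      using B0 by (simp add: microstep_def shear_def)
    then have "cmod (microstep N h i x k - y k) \<le> d + \<bar>h\<bar> * B" if "k \<in> box_sites N" for k
      using x[OF that] norm_triangle_ineq[of "microstep N h i x k - x k" "x k - y k"]
      by (smt (verit, best) diff_add_cancel add_diff_eq)
    moreover have "cmod (nbr_sum N y ?n) \<le> 2 * (R + 1)" using yb R by (intro nbr_sum_bound) auto
    moreover have "cmod (?w - nbr_sum N y ?n) \<le> 2 * \<delta>"
      using x dd d by (intro nbr_sum_diff_bound) (auto intro: order_trans)
    ultimately show ?thesis
      using xb w x[OF i(2)] yb i dd B0 unfolding safe_at_def by (auto intro: order_trans)
  qed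
  have le': "(d + \<bar>h\<bar> * B) + length L * (\<bar>h\<bar> * B) \<le> \<delta>" if "d + length (i # L) * (\<bar>h\<bar> * B) \<le> \<delta>" for d
    using that by (simp add: algebra_simps)
  {
    case 1
    then have i: "?e \<in> {1, \<i>}" "?n \<in> box_sites N" by auto
    note * = *[OF i 1(2-4)]
    show ?case using Cons.IH(1)[of "microstep N h i x" "d + \<bar>h\<bar> * B"] * 1 le' by auto
  next
    case 2
    then have i: "?e \<in> {1, \<i>}" "?n \<in> box_sites N" by auto
    note * = *[OF i 2(3-5)]
    show ?case using Cons.IH(2)[of "microstep N h i x" "d + \<bar>h\<bar> * B"] * 2 le' by auto
  next
    case 3
    then have i: "?e \<in> {1, \<i>}" "?n \<in> box_sites N" by auto
    note * = *[OF i 3(3-5)]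
    let ?S = "\<lambda>L. (\<Sum>i\<leftarrow>L. G (fst i) (snd i) (nbr_sum N y (fst i)) (y (fst i)))"
    let ?w = "nbr_sum N x ?n" let ?z = "x ?n"
    have "norm (path_sum N h G L (microstep N h i x) - ?S L) \<le> length L * \<epsilon>"
      using * 3(2) le'[OF 3(4)] 3(5) by (intro Cons.IH(3)[of "microstep N h i x" "d + \<bar>h\<bar> * B"] 3(1)) auto
    moreover have "norm (G ?n ?e ?w ?z - G ?n ?e (nbr_sum N y ?n) (y ?n)) \<le> \<epsilon>"
      using * i by (intro 3(1)) (auto simp: safe_at_def)
    ultimately show ?case
      using norm_triangle_ineq[of "G ?n ?e ?w ?z - G ?n ?e (nbr_sum N y ?n) (y ?n)" "path_sum N h G L (microstep N h i x) - ?S L"]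
      by (simp add: algebra_simps)
  }
qed

section \<open>Sweeps\<close>

definition sweep_list :: "nat \<Rightarrow> (int \<times> complex) list" where
  "sweep_list N = concat (map (\<lambda>n. [(n, 1), (n, \<i>)]) [- int N..int N])"

definition sweep :: "nat \<Rightarrow> real \<Rightarrow> (int \<Rightarrow> complex) \<Rightarrow> (int \<Rightarrow> complex)" where
  "sweep N h = fold (microstep N h) (sweep_list N)"

lemma set_sweep_list: "i \<in> set (sweep_list N) \<Longrightarrow> snd i \<in> {1, \<i>} \<and> fst i \<in> box_sites N"
  by (auto simp: sweep_list_def box_sites_def)

lemma sum_sweep_list:
  fixes f :: "int \<times> complex \<Rightarrow> 'a :: comm_monoid_add"
  shows "(\<Sum>i\<leftarrow>sweep_list N. f i) = (\<Sum>n\<in>box_sites N. f (n, 1) + f (n, \<i>))"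
proof -
  have "(\<Sum>i\<leftarrow>concat (map (\<lambda>n. [(n, 1), (n, \<i>)]) ns). f i) = (\<Sum>n\<leftarrow>ns. f (n, 1) + f (n, \<i>))" for ns
    by (induction ns) (auto simp: add_ac)
  then show ?thesis
    by (simp add: sweep_list_def box_sites_def sum_list_distinct_conv_sum_set)
qed

text \<open>The summand is a difference of the current Im (cnj z_n * z_(n+1)) of the zero extension
  at consecutive bonds, and this current vanishes on the bonds that leave the box.\<close>

lemma sum_antisymmetric_nbr:
  "(\<Sum>n\<in>box_sites N. Im (cnj (x n) * nbr_sum N x n)) = 0"
proof -
  define z where "z = (\<lambda>n. if n \<in> box_sites N then x n else 0)"
  define c where "c = (\<lambda>n. Im (cnj (z n) * z (n + 1)))"
  have "(\<Sum>n\<in>box_sites N. Im (cnj (x n) * nbr_sum N x n)) = (\<Sum>n\<in>box_sites N. c n - c (n - 1))"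
    by (intro sum.cong) (auto simp: nbr_sum_def z_def c_def algebra_simps)
  also have "\<dots> = (\<Sum>n\<in>box_sites N. c n) - (\<Sum>n\<in>box_sites N. c (n - 1))"
    by (rule sum_subtractf)
  also have "(\<Sum>n\<in>box_sites N. c n) = (\<Sum>n\<in>{- int N - 1..int N}. c n)"
    by (intro sum.mono_neutral_left) (auto simp: c_def z_def box_sites_def)
  also have "(\<Sum>n\<in>box_sites N. c (n - 1)) = (\<Sum>n\<in>{- int N - 1..int N - 1}. c n)"
    by (rule sum.reindex_bij_witness[where i = "\<lambda>n. n + 1" and j = "\<lambda>n. n - 1"]) (auto simp: box_sites_def)
  also have "\<dots> = (\<Sum>n\<in>{- int N - 1..int N}. c n)"
    by (intro sum.mono_neutral_left) (auto simp: c_def z_def box_sites_def)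
  finally show ?thesis by simp
qed

text \<open>The two directions at one site together give the divergence of the planar field, -2 Im
  (cnj z * w), so the telescoping current appears.\<close>

lemma sum_shear_div: "(\<Sum>i\<leftarrow>sweep_list N. shear_div (snd i) (nbr_sum N x (fst i)) (x (fst i))) = 0"
proof -
  have "(\<Sum>i\<leftarrow>sweep_list N. shear_div (snd i) (nbr_sum N x (fst i)) (x (fst i)))
      = (\<Sum>n\<in>box_sites N. (-2) * Im (cnj (x n) * nbr_sum N x n))"
    unfolding sum_sweep_list by (intro sum.cong) (auto simp: shear_div_def algebra_simps)
  then show ?thesis by (simp only: sum_distrib_left[symmetric] sum_antisymmetric_nbr)
qed

text \<open>The linear term of the field is a rotation and does not change |z|, and the factor 1 +
  |z|^2 cancels the denominator: the same current remains as for the divergence. Since both sums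
  vanish separately, the cancellation works for every exponent of the density.\<close>

lemma sum_shear_log: "(\<Sum>i\<leftarrow>sweep_list N. shear_log (snd i) (nbr_sum N x (fst i)) (x (fst i))) = 0"
proof -
  have "shear_log 1 w z + shear_log \<i> w z = (-2) * Im (cnj z * w)" for w z
  proof -
    have pos: "1 + (cmod z)\<^sup>2 \<noteq> 0" using zero_le_power2[of "cmod z"] by linarith
    define m where "m = 1 + (cmod z)\<^sup>2"
    have "shear_log 1 w z + shear_log \<i> w z
        = 2 * (Re z * Re (AL_field z w) + Im z * Im (AL_field z w)) / m"
      unfolding shear_log_def m_def by (simp add: add_divide_distrib algebra_simps)
    also have "Re z * Re (AL_field z w) + Im z * Im (AL_field z w) = - (m * Im (cnj z * w))"
    proof -
      have a: "Re (AL_field z w) = - (m * Im w) + 2 * Im z" and b: "Im (AL_field z w) = m * Re w - 2 * Re z"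
        using AL_field_Complex[of "Re z" "Im z" w] unfolding m_def cmod_power2 by (simp_all add: algebra_simps)
      show ?thesis unfolding a b by (simp add: algebra_simps)
    qed
    finally show ?thesis using pos unfolding m_def by simp
  qed
  then have "(\<Sum>i\<leftarrow>sweep_list N. shear_log (snd i) (nbr_sum N x (fst i)) (x (fst i)))
      = (\<Sum>n\<in>box_sites N. (-2) * Im (cnj (x n) * nbr_sum N x n))"
    unfolding sum_sweep_list by (intro sum.cong) auto
  then show ?thesis by (simp only: sum_distrib_left[symmetric] sum_antisymmetric_nbr)
qed

lemma sum_shear_field:
  assumes "k \<in> box_sites N"
  shows "(\<Sum>i\<leftarrow>sweep_list N. if fst i = k then of_real (Re (cnj (snd i) * AL_field (x (fst i)) (nbr_sum N x (fst i)))) * snd i else 0)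
    = AL_field (x k) (nbr_sum N x k)"
proof -
  have *: "of_real (Re F) + of_real (Re (cnj \<i> * F)) * \<i> = F" for F
    by (simp add: complex_eq_iff)
  have "(\<Sum>i\<leftarrow>sweep_list N. if fst i = k then of_real (Re (cnj (snd i) * AL_field (x (fst i)) (nbr_sum N x (fst i)))) * snd i else 0)
    = (\<Sum>n\<in>box_sites N. if n = k then AL_field (x n) (nbr_sum N x n) else 0)"
    unfolding sum_sweep_list using *[of "AL_field (x k) (nbr_sum N x k)"] by (intro sum.cong) auto
  then show ?thesis using assms by simp
qed

section \<open>First-order behaviour of a sweep\<close>

lemma continuous_on_AL_field [continuous_intros]:
  "continuous_on S f \<Longrightarrow> continuous_on S g \<Longrightarrow> continuous_on S (\<lambda>x. AL_field (f x) (g x))"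
  unfolding AL_field_def by (intro continuous_intros)

lemma continuous_on_shear_div: "continuous_on S (\<lambda>p. shear_div e (fst p) (snd p))"
  unfolding shear_div_def by (intro continuous_intros)

lemma continuous_on_shear_log: "continuous_on S (\<lambda>p. shear_log e (fst p) (snd p))"
proof -
  have "1 + (cmod z)\<^sup>2 \<noteq> 0" for z using zero_le_power2[of "cmod z"] by linarith
  then show ?thesis
    unfolding shear_log_def by (intro continuous_intros) auto
qed

text \<open>The doubled tolerance for \<open>w\<close> is the one that a sum of two neighbours
  inherits from its terms.\<close>

lemma eventually_uniformly_close:
  fixes f :: "complex \<times> complex \<Rightarrow> 'a :: real_normed_vector"
  assumes f: "continuous_on UNIV f" and \<epsilon>: "\<epsilon> > 0"
  shows "\<forall>\<^sub>F \<delta> in at_right 0. \<forall>w z w' z'. cmod w \<le> r \<longrightarrow> cmod z \<le> s \<longrightarrow> cmod w' \<le> r \<longrightarrow> cmod z' \<le> s \<longrightarrow>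
     cmod (w - w') \<le> 2 * \<delta> \<longrightarrow> cmod (z - z') \<le> \<delta> \<longrightarrow> norm (f (w, z) - f (w', z')) \<le> \<epsilon>"
proof -
  have "uniformly_continuous_on (cball 0 r \<times> cball 0 s) f"
    using f by (intro compact_uniformly_continuous compact_Times compact_cball) (auto intro: continuous_on_subset)
  then obtain d where d: "d > 0"
    "\<And>p p'. p \<in> cball 0 r \<times> cball 0 s \<Longrightarrow> p' \<in> cball 0 r \<times> cball 0 s \<Longrightarrow> dist p' p < d \<Longrightarrow> dist (f p') (f p) < \<epsilon>"
    using \<epsilon> unfolding uniformly_continuous_on_def by metis
  show ?thesis
    unfolding eventually_at_right_field
  proof (intro exI[of _ "d / 3"] conjI allI impI)
    fix \<delta> w z w' z'
    assume a: "0 < \<delta>" "\<delta> < d / 3" "cmod w \<le> r" "cmod z \<le> s" "cmod w' \<le> r" "cmod z' \<le> s"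
      "cmod (w - w') \<le> 2 * \<delta>" "cmod (z - z') \<le> \<delta>"
    have "dist (w, z) (w', z') \<le> dist w w' + dist z z'"
      using sqrt_sum_squares_le_sum_abs[of "dist w w'" "dist z z'"] by (simp add: dist_Pair_Pair)
    also have "\<dots> < d" using a by (simp add: dist_norm)
    finally show "norm (f (w, z) - f (w', z')) \<le> \<epsilon>"
      using d(2)[of "(w', z')" "(w, z)"] a by (simp add: dist_norm)
  qed (use d in auto)
qed

lemma path_sum_shear_weight:
  "path_sum N h (\<lambda>n e w z. shear_weight \<beta> e h w z) L x
    = h * path_sum N h (\<lambda>n. shear_div) L x - (2 + 2 * \<beta>) * (h * path_sum N h (\<lambda>n. shear_log) L x)
      - h\<^sup>2 * path_sum N h (\<lambda>n e w z. 2 * (shear_div e w z)\<^sup>2 + (2 + 2 * \<beta>) * (cmod (AL_field z w))\<^sup>2) L x"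
  by (induction L arbitrary: x) (auto simp: shear_weight_def algebra_simps power_mult_distrib)

lemma path_sum_bound:
  fixes b :: real
  assumes "path_safe N h R L x" "\<And>i. i \<in> set L \<Longrightarrow> snd i \<in> {1, \<i>}"
    and "\<And>n e w z. e \<in> {1, \<i>} \<Longrightarrow> cmod w \<le> 2 * R \<Longrightarrow> cmod z \<le> R \<Longrightarrow> norm (G n e w z) \<le> b"
  shows "norm (path_sum N h G L x) \<le> length L * b"
  using assms(1,2)
proof (induction L arbitrary: x)
  case (Cons i L)
  have "norm (G (fst i) (snd i) (nbr_sum N x (fst i)) (x (fst i))) \<le> b"
    using Cons.prems by (intro assms(3)) (auto simp: safe_at_def)
  moreover have "norm (path_sum N h G L (microstep N h i x)) \<le> length L * b"
    using Cons by auto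
  ultimately show ?case
    using norm_triangle_ineq[of "G (fst i) (snd i) (nbr_sum N x (fst i)) (x (fst i))" "path_sum N h G L (microstep N h i x)"]
    by (simp add: algebra_simps)
qed simp

lemma sweep_step:
  fixes R \<eta> \<beta> :: real
  assumes R: "R \<ge> 0" and \<eta>: "\<eta> > 0" and \<beta>: "\<beta> > 0"
  obtains h0 where "h0 > 0" "8 * h0 * (R + 1)\<^sup>2 \<le> 1"
    "\<And>h x. \<bar>h\<bar> \<le> h0 \<Longrightarrow> (\<And>k. k \<in> box_sites N \<Longrightarrow> cmod (x k) \<le> R) \<Longrightarrow>
      path_safe N h (R + 1) (sweep_list N) x \<and>
      - \<eta> * \<bar>h\<bar> \<le> path_sum N h (\<lambda>n e w z. shear_weight \<beta> e h w z) (sweep_list N) x \<and>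
      log_energy N (sweep N h x) \<le> log_energy N x + \<eta> * \<bar>h\<bar> \<and>
      (\<forall>k\<in>box_sites N. cmod (sweep N h x k - x k) \<le> \<eta> \<and>
        cmod (sweep N h x k - x k - of_real h * AL_field (x k) (nbr_sum N x k)) \<le> \<eta> * \<bar>h\<bar>)"
proof -
  define L where "L = sweep_list N"
  define l where "l = real (length L)"
  define c where "c = 2 + 2 * \<beta>"
  \<comment> \<open>Half of \<eta> |h| is reserved for the first-order defects, which total at most
    l * \<epsilon> * (1 + c) * |h|, and the other half for the terms quadratic in
    \<open>h\<close>.\<close>
  define \<epsilon> where "\<epsilon> = \<eta> / (2 * (1 + c) * (l + 1))"
  have l: "l \<ge> 0" and c: "c > 0" using \<beta> by (auto simp: l_def c_def)
  then have \<epsilon>: "\<epsilon> > 0" using \<eta> by (simp add: \<epsilon>_def)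
  have l\<epsilon>: "l * \<epsilon> * (1 + c) \<le> \<eta> / 2"
  proof -
    have "l * \<epsilon> * (1 + c) \<le> (l + 1) * \<epsilon> * (1 + c)"
      using c \<epsilon> by (intro mult_right_mono) auto
    also have "\<dots> = \<eta> / 2" using l c by (simp add: \<epsilon>_def divide_simps)
    finally show ?thesis .
  qed
  define close where "close = (\<lambda>(f :: complex \<times> complex \<Rightarrow> complex) \<delta>. \<forall>w z w' z'. cmod w \<le> 2 * (R + 1) \<longrightarrow> cmod z \<le> R + 1 \<longrightarrow>
      cmod w' \<le> 2 * (R + 1) \<longrightarrow> cmod z' \<le> R + 1 \<longrightarrow>
     cmod (w - w') \<le> 2 * \<delta> \<longrightarrow> cmod (z - z') \<le> \<delta> \<longrightarrow> norm (f (w, z) - f (w', z')) \<le> \<epsilon>)"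
  have ev: "\<forall>\<^sub>F \<delta> in at_right 0. close f \<delta>" if "continuous_on UNIV f" for f
    unfolding close_def by (rule eventually_uniformly_close[OF that \<epsilon>])
  \<comment> \<open>The real-valued functions are embedded into the complex numbers so that the
    single predicate \<open>close\<close> covers all of them.\<close>
  let ?F = "\<lambda>p. AL_field (snd p) (fst p)" and ?D = "\<lambda>e p. of_real (shear_div e (fst p) (snd p)) :: complex"
    and ?G = "\<lambda>e p. of_real (shear_log e (fst p) (snd p)) :: complex"
  have "\<forall>\<^sub>F \<delta> in at_right 0. close ?F \<delta> \<and> (close (?D 1) \<delta> \<and> close (?D \<i>) \<delta>) \<and> (close (?G 1) \<delta> \<and> close (?G \<i>) \<delta>) \<and> \<delta> < 1 \<and> \<delta> < \<eta> \<and> \<delta> > 0"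
    using eventually_at_right_real[of 0 1] eventually_at_right_real[OF \<eta>]
    by (intro eventually_conj ev continuous_intros continuous_on_shear_div continuous_on_shear_log eventually_at_right_less)
       (auto elim: eventually_mono)
  then obtain \<delta> where \<delta>: "0 < \<delta>" "\<delta> < 1" "\<delta> < \<eta>" and clF: "close ?F \<delta>"
    and clD: "\<And>e. e \<in> {1, \<i>} \<Longrightarrow> close (?D e) \<delta>" and clG: "\<And>e. e \<in> {1, \<i>} \<Longrightarrow> close (?G e) \<delta>"
    by (drule_tac eventually_happens) auto
  have bd: "\<exists>B. \<forall>w z. cmod w \<le> 2 * (R + 1) \<longrightarrow> cmod z \<le> R + 1 \<longrightarrow> cmod (f (w, z)) \<le> B"
    if "continuous_on UNIV f" for f :: "complex \<times> complex \<Rightarrow> complex"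
  proof -
    have "compact (cball (0::complex) (2 * (R + 1)) \<times> cball (0::complex) (R + 1))"
      by (intro compact_Times compact_cball)
    from this continuous_on_subset[OF that subset_UNIV]
    obtain B where "\<forall>p\<in>cball 0 (2 * (R + 1)) \<times> cball 0 (R + 1). cmod (f p) \<le> B"
      by (rule continuous_on_compact_bound) blast
    then show ?thesis by (intro exI[of _ B]) auto
  qed
  have cF: "continuous_on UNIV ?F" and cD: "continuous_on UNIV (?D e)" for e
    by (intro continuous_intros continuous_on_shear_div)+
  obtain B1 where B1: "\<And>w z. cmod w \<le> 2 * (R + 1) \<Longrightarrow> cmod z \<le> R + 1 \<Longrightarrow> cmod (?F (w, z)) \<le> B1"
    using bd[OF cF] by blast
  obtain B2 where B2: "\<And>w z. cmod w \<le> 2 * (R + 1) \<Longrightarrow> cmod z \<le> R + 1 \<Longrightarrow> cmod (?D 1 (w, z)) \<le> B2"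
    using bd[OF cD] by blast
  obtain B3 where B3: "\<And>w z. cmod w \<le> 2 * (R + 1) \<Longrightarrow> cmod z \<le> R + 1 \<Longrightarrow> cmod (?D \<i> (w, z)) \<le> B3"
    using bd[OF cD] by blast
  define B where "B = max 0 (max B1 (max B2 B3))"
  have BF: "cmod (AL_field z w) \<le> B" and BD: "e \<in> {1, \<i>} \<Longrightarrow> \<bar>shear_div e w z\<bar> \<le> B"
    if "cmod w \<le> 2 * (R + 1)" "cmod z \<le> R + 1" for w z e
    using B1[OF that] B2[OF that] B3[OF that] by (auto simp: B_def)
  have B: "B \<ge> 0" by (simp add: B_def)
  \<comment> \<open>The three bounds keep the sweep within \<delta> of its start, make the quadratic
    terms at most \<eta> |h| / 2, and meet the smallness condition of the change of variables for
    radius R + 1.\<close>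
  define h0 where "h0 = min (\<delta> / (l * B + 1)) (min (\<eta> / (2 * (l * ((2 + c) * B\<^sup>2) + 1))) (1 / (8 * (R + 1)\<^sup>2)))"
  have nn: "l * B \<ge> 0" "l * ((2 + c) * B\<^sup>2) \<ge> 0" using l B c by auto
  show ?thesis
  proof (rule that[of h0])
    show "h0 > 0" using \<delta> \<eta> nn R by (auto simp: h0_def)
    have "h0 \<le> 1 / (8 * (R + 1)\<^sup>2)" by (simp add: h0_def)
    then show "8 * h0 * (R + 1)\<^sup>2 \<le> 1" using R by (simp add: field_simps)
    fix h x assume h: "\<bar>h\<bar> \<le> h0" and x: "\<And>k. k \<in> box_sites N \<Longrightarrow> cmod (x k) \<le> R"
    have h1: "l * (\<bar>h\<bar> * B) \<le> \<delta>"
    proof -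
      have "\<bar>h\<bar> \<le> \<delta> / (l * B + 1)" using h by (simp add: h0_def)
      then have "\<bar>h\<bar> * (l * B + 1) \<le> \<delta>" using nn by (simp add: pos_le_divide_eq)
      then show ?thesis by (simp add: algebra_simps)
    qed
    have h2: "\<bar>h\<bar> * (l * ((2 + c) * B\<^sup>2)) \<le> \<eta> / 2"
    proof -
      have "\<bar>h\<bar> \<le> \<eta> / (2 * (l * ((2 + c) * B\<^sup>2) + 1))" using h by (simp add: h0_def)
      then have "\<bar>h\<bar> * (2 * (l * ((2 + c) * B\<^sup>2) + 1)) \<le> \<eta>"
        using nn by (subst (asm) pos_le_divide_eq) auto
      then show ?thesis by (simp add: algebra_simps)
    qed
    have Lset: "\<And>i. i \<in> set L \<Longrightarrow> snd i \<in> {1, \<i>} \<and> fst i \<in> box_sites N"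
      unfolding L_def by (rule set_sweep_list)
    have safe: "path_safe N h (R + 1) L x"
      apply (rule path_close(1)[where R = R and y = x and d = 0 and B = B and \<delta> = \<delta>])
      subgoal by (rule R)
      subgoal by (rule x)
      subgoal by (rule BF)
      subgoal by (rule Lset)
      subgoal by simp
      subgoal using h1 by (simp add: l_def)
      subgoal using \<delta> by simp
      subgoal by simp
      done
    have disp: "cmod (fold (microstep N h) L x k - x k) \<le> \<delta>" if "k \<in> box_sites N" for k
      apply (rule path_close(2)[where R = R and y = x and d = 0 and B = B])
      subgoal by (rule R)
      subgoal by (rule x)
      subgoal by (rule BF)
      subgoal by (rule Lset)
      subgoal by simp
      subgoal using h1 by (simp add: l_def)
      subgoal using \<delta> by simp
      subgoal by simp
      subgoal by (rule that)
      done
    have pc: "norm (path_sum N h G L x - (\<Sum>i\<leftarrow>L. G (fst i) (snd i) (nbr_sum N x (fst i)) (x (fst i)))) \<le> length L * \<epsilon>"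
      if "\<And>n e w z w' z'. e \<in> {1, \<i>} \<Longrightarrow> cmod w \<le> 2 * (R + 1) \<Longrightarrow> cmod z \<le> R + 1 \<Longrightarrow> cmod w' \<le> 2 * (R + 1) \<Longrightarrow> cmod z' \<le> R + 1
       \<Longrightarrow> cmod (w - w') \<le> 2 * \<delta> \<Longrightarrow> cmod (z - z') \<le> \<delta> \<Longrightarrow> norm (G n e w z - G n e w' z') \<le> \<epsilon>"
      for G :: "int \<Rightarrow> complex \<Rightarrow> complex \<Rightarrow> complex \<Rightarrow> 'b :: real_normed_vector"
      apply (rule path_close(3)[where R = R and y = x and d = 0 and B = B and \<delta> = \<delta>])
      subgoal by (rule R)
      subgoal by (rule x)
      subgoal by (rule BF)
      subgoal by (rule Lset)
      subgoal by simp
      subgoal using h1 by (simp add: l_def)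
      subgoal using \<delta> by simp
      subgoal by simp
      subgoal by (rule that)
      done
    have D: "\<bar>path_sum N h (\<lambda>n. shear_div) L x\<bar> \<le> l * \<epsilon>"
    proof -
      have "norm (path_sum N h (\<lambda>n. shear_div) L x - (\<Sum>i\<leftarrow>L. shear_div (snd i) (nbr_sum N x (fst i)) (x (fst i)))) \<le> length L * \<epsilon>"
      proof (rule pc)
        fix e w z w' z'
        assume e: "e \<in> {1, \<i>}" and a: "cmod w \<le> 2 * (R + 1)" "cmod z \<le> R + 1" "cmod w' \<le> 2 * (R + 1)" "cmod z' \<le> R + 1"
          "cmod (w - w') \<le> 2 * \<delta>" "cmod (z - z') \<le> \<delta>"
        have "cmod (of_real (shear_div e w z) - of_real (shear_div e w' z')) \<le> \<epsilon>"
          using clD[OF e, unfolded close_def, rule_format, OF a] by simp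
        then show "norm (shear_div e w z - shear_div e w' z') \<le> \<epsilon>"
          by (simp only: of_real_diff[symmetric] norm_of_real real_norm_def)
      qed
      then show ?thesis by (simp add: L_def l_def sum_shear_div)
    qed
    have G: "\<bar>path_sum N h (\<lambda>n. shear_log) L x\<bar> \<le> l * \<epsilon>"
    proof -
      have "norm (path_sum N h (\<lambda>n. shear_log) L x - (\<Sum>i\<leftarrow>L. shear_log (snd i) (nbr_sum N x (fst i)) (x (fst i)))) \<le> length L * \<epsilon>"
      proof (rule pc)
        fix e w z w' z'
        assume e: "e \<in> {1, \<i>}" and a: "cmod w \<le> 2 * (R + 1)" "cmod z \<le> R + 1" "cmod w' \<le> 2 * (R + 1)" "cmod z' \<le> R + 1"
          "cmod (w - w') \<le> 2 * \<delta>" "cmod (z - z') \<le> \<delta>"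
        have "cmod (of_real (shear_log e w z) - of_real (shear_log e w' z')) \<le> \<epsilon>"
          using clG[OF e, unfolded close_def, rule_format, OF a] by simp
        then show "norm (shear_log e w z - shear_log e w' z') \<le> \<epsilon>"
          by (simp only: of_real_diff[symmetric] norm_of_real real_norm_def)
      qed
      then show ?thesis by (simp add: L_def l_def sum_shear_log)
    qed
    have Fk: "cmod (fold (microstep N h) L x k - x k - of_real h * AL_field (x k) (nbr_sum N x k)) \<le> \<bar>h\<bar> * (l * \<epsilon>)"
      if k: "k \<in> box_sites N" for k
    proof -
      let ?Gk = "\<lambda>n e w z. if n = k then of_real (Re (cnj e * AL_field z w)) * e else 0"
      have "norm (path_sum N h ?Gk L x - (\<Sum>i\<leftarrow>L. ?Gk (fst i) (snd i) (nbr_sum N x (fst i)) (x (fst i)))) \<le> length L * \<epsilon>"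
      proof (rule pc)
        fix n e w z w' z'
        assume e: "e \<in> {1, \<i>}" and a: "cmod w \<le> 2 * (R + 1)" "cmod z \<le> R + 1" "cmod w' \<le> 2 * (R + 1)" "cmod z' \<le> R + 1"
          "cmod (w - w') \<le> 2 * \<delta>" "cmod (z - z') \<le> \<delta>"
        have "cmod (of_real (Re (cnj e * F)) * e - of_real (Re (cnj e * F')) * e) \<le> cmod (F - F')" for F F'
        proof -
          have "of_real (Re (cnj e * F)) * e - of_real (Re (cnj e * F')) * e = of_real (Re (cnj e * (F - F'))) * e"
            by (simp add: algebra_simps)
          then have "cmod (of_real (Re (cnj e * F)) * e - of_real (Re (cnj e * F')) * e) = \<bar>Re (cnj e * (F - F'))\<bar> * cmod e"
            by (simp only: norm_mult norm_of_real)
          also have "\<dots> \<le> cmod (cnj e * (F - F')) * cmod e"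
            by (intro mult_right_mono abs_Re_le_cmod) auto
          also have "\<dots> = cmod (F - F')" using e by (auto simp: norm_mult)
          finally show ?thesis .
        qed
        moreover have "cmod (AL_field z w - AL_field z' w') \<le> \<epsilon>"
          using clF[unfolded close_def, rule_format, OF a] by simp
        ultimately show "cmod (?Gk n e w z - ?Gk n e w' z') \<le> \<epsilon>"
          using \<epsilon> by (auto intro: order_trans)
      qed
      then have "cmod (path_sum N h ?Gk L x - AL_field (x k) (nbr_sum N x k)) \<le> l * \<epsilon>"
        using sum_shear_field[OF k] by (simp add: L_def l_def)
      moreover have "fold (microstep N h) L x k - x k - of_real h * AL_field (x k) (nbr_sum N x k)
         = of_real h * (path_sum N h ?Gk L x - AL_field (x k) (nbr_sum N x k))"
        by (simp add: fold_microstep_eq[of N h L x k] algebra_simps)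
      ultimately show ?thesis
        by (simp add: norm_mult mult_left_mono)
    qed
    have Lset': "\<And>i. i \<in> set L \<Longrightarrow> snd i \<in> {1, \<i>}" using Lset by auto
    have Fb: "\<bar>path_sum N h (\<lambda>n e w z. (cmod (AL_field z w))\<^sup>2) L x\<bar> \<le> l * B\<^sup>2"
      using path_sum_bound[OF safe Lset', where G = "\<lambda>n e w z. (cmod (AL_field z w))\<^sup>2" and b = "B\<^sup>2"] BF
      by (auto simp: l_def power_mono)
    have "\<bar>path_sum N h (\<lambda>n e w z. 2 * (shear_div e w z)\<^sup>2 + c * (cmod (AL_field z w))\<^sup>2) L x\<bar> \<le> l * ((2 + c) * B\<^sup>2)"
    proof -
      have "norm (2 * (shear_div e w z)\<^sup>2 + c * (cmod (AL_field z w))\<^sup>2) \<le> (2 + c) * B\<^sup>2"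
        if "e \<in> {1, \<i>}" "cmod w \<le> 2 * (R + 1)" "cmod z \<le> R + 1" for e w z
      proof -
        have "(shear_div e w z)\<^sup>2 \<le> B\<^sup>2" using BD[OF that(2,3,1)] B by (simp add: abs_le_square_iff[symmetric])
        moreover have "c * (cmod (AL_field z w))\<^sup>2 \<le> c * B\<^sup>2" using BF[OF that(2,3)] c by (simp add: power_mono)
        moreover have "0 \<le> 2 * (shear_div e w z)\<^sup>2 + c * (cmod (AL_field z w))\<^sup>2" using c by simp
        ultimately show ?thesis unfolding real_norm_def distrib_right by linarith
      qed
      then show ?thesis
        using path_sum_bound[OF safe Lset', where b = "(2 + c) * B\<^sup>2" and G = "\<lambda>n e w z. 2 * (shear_div e w z)\<^sup>2 + c * (cmod (AL_field z w))\<^sup>2"]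
        by (simp add: l_def)
    qed
    then have S: "h\<^sup>2 * path_sum N h (\<lambda>n e w z. 2 * (shear_div e w z)\<^sup>2 + c * (cmod (AL_field z w))\<^sup>2) L x \<le> \<bar>h\<bar> * (\<eta> / 2)"
    proof -
      assume "\<bar>path_sum N h (\<lambda>n e w z. 2 * (shear_div e w z)\<^sup>2 + c * (cmod (AL_field z w))\<^sup>2) L x\<bar> \<le> l * ((2 + c) * B\<^sup>2)"
      then have "h\<^sup>2 * path_sum N h (\<lambda>n e w z. 2 * (shear_div e w z)\<^sup>2 + c * (cmod (AL_field z w))\<^sup>2) L x \<le> h\<^sup>2 * (l * ((2 + c) * B\<^sup>2))"
        by (intro mult_left_mono) auto
      also have "\<dots> = \<bar>h\<bar> * (\<bar>h\<bar> * (l * ((2 + c) * B\<^sup>2)))" by (simp add: power2_eq_square mult.assoc[symmetric])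
      also have "\<dots> \<le> \<bar>h\<bar> * (\<eta> / 2)" using h2 by (intro mult_left_mono) auto
      finally show ?thesis .
    qed
    have hD: "- (\<bar>h\<bar> * (l * \<epsilon>)) \<le> h * path_sum N h (\<lambda>n. shear_div) L x"
      using mult_left_mono[OF D, of "\<bar>h\<bar>"] by (simp add: abs_mult[symmetric])
    have hG: "h * path_sum N h (\<lambda>n. shear_log) L x \<le> \<bar>h\<bar> * (l * \<epsilon>)"
      using mult_left_mono[OF G, of "\<bar>h\<bar>"] by (simp add: abs_mult[symmetric])
    have weight: "- \<eta> * \<bar>h\<bar> \<le> path_sum N h (\<lambda>n e w z. shear_weight \<beta> e h w z) L x"
    proof -
      have "c * (h * path_sum N h (\<lambda>n. shear_log) L x) \<le> c * (\<bar>h\<bar> * (l * \<epsilon>))"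
        using hG c by (intro mult_left_mono) auto
      moreover have "\<bar>h\<bar> * (l * \<epsilon>) + c * (\<bar>h\<bar> * (l * \<epsilon>)) = \<bar>h\<bar> * (l * \<epsilon> * (1 + c))"
        by (simp add: algebra_simps)
      moreover have "\<bar>h\<bar> * (l * \<epsilon> * (1 + c)) \<le> \<bar>h\<bar> * (\<eta> / 2)"
        using l\<epsilon> by (intro mult_left_mono) auto
      ultimately show ?thesis
        using S hD unfolding path_sum_shear_weight c_def[symmetric] by (simp add: algebra_simps)
    qed
    have "l * \<epsilon> * 1 \<le> l * \<epsilon> * (1 + c)" using l \<epsilon> c by (intro mult_left_mono) auto
    then have le1: "l * \<epsilon> \<le> \<eta> / 2" using l\<epsilon> by simp
    have energy: "log_energy N (fold (microstep N h) L x) \<le> log_energy N x + \<eta> * \<bar>h\<bar>"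
    proof -
      have "h\<^sup>2 * path_sum N h (\<lambda>n e w z. (cmod (AL_field z w))\<^sup>2) L x \<le> h\<^sup>2 * (l * ((2 + c) * B\<^sup>2))"
      proof (intro mult_left_mono)
        have "B\<^sup>2 \<le> (2 + c) * B\<^sup>2" using c mult_right_mono[of 1 "2 + c" "B\<^sup>2"] by simp
        from mult_left_mono[OF this l]
        show "path_sum N h (\<lambda>n e w z. (cmod (AL_field z w))\<^sup>2) L x \<le> l * ((2 + c) * B\<^sup>2)"
          using Fb by linarith
      qed simp
      also have "\<dots> = \<bar>h\<bar> * (\<bar>h\<bar> * (l * ((2 + c) * B\<^sup>2)))" by (simp add: power2_eq_square mult.assoc[symmetric])
      also have "\<dots> \<le> \<bar>h\<bar> * (\<eta> / 2)" using h2 by (intro mult_left_mono) auto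
      finally have "h\<^sup>2 * path_sum N h (\<lambda>n e w z. (cmod (AL_field z w))\<^sup>2) L x \<le> \<bar>h\<bar> * (\<eta> / 2)" .
      moreover have "\<bar>h\<bar> * (l * \<epsilon>) \<le> \<bar>h\<bar> * (\<eta> / 2)" using le1 by (intro mult_left_mono) auto
      ultimately show ?thesis
        using log_energy_path[OF Lset, of L h x] hG by (simp add: algebra_simps)
    qed
    have "\<bar>h\<bar> * (l * \<epsilon>) \<le> \<bar>h\<bar> * \<eta>"
      using le1 \<eta> by (intro mult_left_mono) auto
    then have Fk': "cmod (fold (microstep N h) L x k - x k - of_real h * AL_field (x k) (nbr_sum N x k)) \<le> \<eta> * \<bar>h\<bar>"
      if "k \<in> box_sites N" for k
      using Fk[OF that] by (simp add: mult.commute)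
    have disp': "cmod (fold (microstep N h) L x k - x k) \<le> \<eta>" if "k \<in> box_sites N" for k
      using disp[OF that] \<delta>(3) by linarith
    show "path_safe N h (R + 1) (sweep_list N) x \<and>
      - \<eta> * \<bar>h\<bar> \<le> path_sum N h (\<lambda>n e w z. shear_weight \<beta> e h w z) (sweep_list N) x \<and>
      log_energy N (sweep N h x) \<le> log_energy N x + \<eta> * \<bar>h\<bar> \<and>
      (\<forall>k\<in>box_sites N. cmod (sweep N h x k - x k) \<le> \<eta> \<and>
        cmod (sweep N h x k - x k - of_real h * AL_field (x k) (nbr_sum N x k)) \<le> \<eta> * \<bar>h\<bar>)"
      using safe weight energy disp' Fk' unfolding sweep_def L_def by blast
  qed
qed

section \<open>Approximate trajectories\<close>

lemma measurable_fold_microstep: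
  assumes "f \<in> M \<rightarrow>\<^sub>M (\<Pi>\<^sub>M n\<in>UNIV. borel)" and [measurable]: "g \<in> borel_measurable M"
  shows "(\<lambda>x. fold (microstep N (g x)) L (f x)) \<in> M \<rightarrow>\<^sub>M (\<Pi>\<^sub>M n\<in>UNIV. borel)"
  using assms(1)
proof (induction L arbitrary: f)
  case (Cons i L)
  note [measurable] = Cons.prems
  have "(\<lambda>x. microstep N (g x) i (f x)) \<in> M \<rightarrow>\<^sub>M (\<Pi>\<^sub>M n\<in>UNIV. borel)" by measurable
  from Cons.IH[OF this] show ?case by simp
qed simp

lemma measurable_sweep [measurable (raw)]:
  assumes "f \<in> M \<rightarrow>\<^sub>M (\<Pi>\<^sub>M n\<in>UNIV. borel)" "g \<in> borel_measurable M"
  shows "(\<lambda>x. sweep N (g x) (f x)) \<in> M \<rightarrow>\<^sub>M (\<Pi>\<^sub>M n\<in>UNIV. borel)"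
  unfolding sweep_def by (rule measurable_fold_microstep[OF assms])

lemma measurable_sweep_power [measurable (raw)]:
  assumes "f \<in> M \<rightarrow>\<^sub>M (\<Pi>\<^sub>M n\<in>UNIV. borel)" and [measurable]: "g \<in> borel_measurable M"
  shows "(\<lambda>x. (sweep N (g x) ^^ k) (f x)) \<in> M \<rightarrow>\<^sub>M (\<Pi>\<^sub>M n\<in>UNIV. borel)"
proof (induction k)
  case (Suc k)
  note [measurable] = Suc
  show ?case by simp
qed (use assms(1) in simp)

lemma microstep_0 [simp]: "microstep N 0 i x = x"
  by (simp add: microstep_def shear_def)

lemma sweep_0 [simp]: "sweep N 0 x = x"
proof -
  have "fold (microstep N 0) L x = x" for L by (induction L) auto
  then show ?thesis by (simp add: sweep_def)
qed

lemma continuous_on_nbr_sum: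
  assumes "\<And>k. continuous_on S (\<lambda>t. X t k)"
  shows "continuous_on S (\<lambda>t. nbr_sum N (X t) n)"
  unfolding nbr_sum_def using assms
  by (cases "n + 1 \<in> box_sites N"; cases "n - 1 \<in> box_sites N") (auto intro!: continuous_intros)

lemma continuous_on_sweep:
  assumes h: "continuous_on S h"
  shows "continuous_on S (\<lambda>t. sweep N (h t) x n)"
proof -
  have "continuous_on S (\<lambda>t. fold (microstep N (h t)) L (X t) n)"
    if "\<And>k. continuous_on S (\<lambda>t. X t k)" for L X n
    using that
  proof (induction L arbitrary: X)
    case (Cons i L)
    have "continuous_on S (\<lambda>t. microstep N (h t) i (X t) k)" for k
    proof (cases "k = fst i")
      case True
      have "continuous_on S (\<lambda>t. nbr_sum N (X t) (fst i))"
        using Cons.prems by (rule continuous_on_nbr_sum)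
      then show ?thesis
        using True Cons.prems h by (auto simp: microstep_def shear_def intro!: continuous_intros)
    next
      case False
      then show ?thesis using Cons.prems by (simp add: microstep_def)
    qed
    from Cons.IH[OF this] show ?case by simp
  qed simp
  then show ?thesis unfolding sweep_def by simp
qed

text \<open>
  Whole sweeps of step \<open>h\<close> followed by one shorter sweep: this interpolates continuously in time and
  still consists of shears only.
\<close>

definition traj :: "nat \<Rightarrow> real \<Rightarrow> real \<Rightarrow> (int \<Rightarrow> complex) \<Rightarrow> (int \<Rightarrow> complex)" where
  "traj N h t x = (let k = nat \<lfloor>\<bar>t\<bar> / h\<rfloor> in sweep N (t - sgn t * (real k * h)) ((sweep N (sgn t * h) ^^ k) x))"

lemma traj_0 [simp]: "traj N h 0 x = x"
  by (simp add: traj_def)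

text \<open>Admitting \<tau> = h provides two formulas at each grid point: a full sweep after k
  sweeps is an empty one after k + 1. Continuity across the grid rests on this overlap.\<close>

lemma traj_eq:
  assumes \<sigma>: "\<sigma> \<in> {1, -1 :: real}" and h: "h > 0" and \<tau>: "0 \<le> \<tau>" "\<tau> \<le> h"
  shows "traj N h (\<sigma> * (real k * h + \<tau>)) x = sweep N (\<sigma> * \<tau>) ((sweep N (\<sigma> * h) ^^ k) x)"
proof -
  have main: "traj N h (\<sigma> * (real k * h + \<tau>)) x = sweep N (\<sigma> * \<tau>) ((sweep N (\<sigma> * h) ^^ k) x)"
    if \<tau>: "0 \<le> \<tau>" "\<tau> < h" for k \<tau>
  proof (cases "real k * h + \<tau> = 0")
    case True
    then have "k = 0 \<and> \<tau> = 0" using h \<tau> by (smt (verit) mult_nonneg_nonneg mult_eq_0_iff of_nat_0_le_iff of_nat_eq_0_iff)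
    then show ?thesis by simp
  next
    case False
    then have pos: "real k * h + \<tau> > 0" using h \<tau> by (smt (verit) mult_nonneg_nonneg of_nat_0_le_iff)
    have s: "sgn (\<sigma> * (real k * h + \<tau>)) = \<sigma>" "\<bar>\<sigma> * (real k * h + \<tau>)\<bar> = real k * h + \<tau>"
      using \<sigma> pos by (auto simp: sgn_if abs_mult)
    have "(real k * h + \<tau>) / h = real k + \<tau> / h" using h by (simp add: field_simps)
    moreover have "\<tau> / h < 1" "0 \<le> \<tau> / h" using h \<tau> by (simp_all add: divide_less_eq)
    ultimately have "\<lfloor>(real k * h + \<tau>) / h\<rfloor> = int k" by (simp add: floor_eq_iff)
    then show ?thesis unfolding traj_def s Let_def by (simp add: algebra_simps)
  qed
  show ?thesis
  proof (cases "\<tau> < h")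
    case False
    then have "\<tau> = h" using \<tau> by simp
    then show ?thesis
      using main[of 0 "Suc k"] h by (simp add: algebra_simps)
  qed (use main \<tau> in auto)
qed

text \<open>Letting time be a measurable function gives the joint measurability in time and
  configuration that Tonelli's theorem requires later. The number of whole sweeps takes countably
  many values and can be fixed.\<close>

lemma measurable_traj [measurable (raw)]:
  assumes [measurable]: "f \<in> M \<rightarrow>\<^sub>M (\<Pi>\<^sub>M n\<in>UNIV. borel)" "g \<in> borel_measurable M"
  shows "(\<lambda>x. traj N h (g x) (f x)) \<in> M \<rightarrow>\<^sub>M (\<Pi>\<^sub>M n\<in>UNIV. borel)"
  unfolding traj_def Let_def
proof (rule measurable_compose_countable[where g = "\<lambda>x. nat \<lfloor>\<bar>g x\<bar> / h\<rfloor>"])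
  fix k
  have [measurable]: "(\<lambda>x. sgn (g x)) \<in> borel_measurable M"
    unfolding sgn_if by measurable
  show "(\<lambda>x. sweep N (g x - sgn (g x) * (real k * h)) ((sweep N (sgn (g x) * h) ^^ k) (f x))) \<in> M \<rightarrow>\<^sub>M (\<Pi>\<^sub>M n\<in>UNIV. borel)"
    by measurable
qed measurable

section \<open>Maps with controlled growth of energy and density\<close>

text \<open>One budget \<open>c\<close> pays both for the growth of the log energy and for the
  factor in expectations. The start is kept \<open>c\<close> below the threshold, which is what
  makes budgets add under composition.\<close>

definition tame :: "real \<Rightarrow> nat \<Rightarrow> real \<Rightarrow> real \<Rightarrow> ((int \<Rightarrow> complex) \<Rightarrow> (int \<Rightarrow> complex)) \<Rightarrow> bool" where
  "tame \<beta> N K c S \<longleftrightarrow> c \<ge> 0 \<and> S \<in> white_noise \<beta> \<rightarrow>\<^sub>M white_noise \<beta> \<and>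
     (\<forall>x. log_energy N x \<le> K - c \<longrightarrow> log_energy N (S x) \<le> log_energy N x + c) \<and>
     (\<forall>f\<in>borel_measurable (white_noise \<beta>).
        (\<integral>\<^sup>+x. indicator {x. log_energy N x \<le> K - c} x * f (S x) \<partial>white_noise \<beta>) \<le> ennreal (exp c) * (\<integral>\<^sup>+x. f x \<partial>white_noise \<beta>))"

lemma measurable_log_energy [measurable]: "log_energy N \<in> borel_measurable (white_noise \<beta>)"
  unfolding log_energy_def by measurable

lemma tame_id: "tame \<beta> N K 0 (\<lambda>x. x)"
  unfolding tame_def by (auto intro!: nn_integral_mono simp: indicator_def)

lemma tame_comp:
  assumes 1: "tame \<beta> N K c S" and 2: "tame \<beta> N K c' S'"
  shows "tame \<beta> N K (c + c') (\<lambda>x. S' (S x))"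
proof -
  have [measurable]: "S \<in> white_noise \<beta> \<rightarrow>\<^sub>M white_noise \<beta>" "S' \<in> white_noise \<beta> \<rightarrow>\<^sub>M white_noise \<beta>" and c: "c \<ge> 0" "c' \<ge> 0"
    using assms by (auto simp: tame_def)
  have e: "log_energy N (S x) \<le> log_energy N x + c" if "log_energy N x \<le> K - c" for x
    using 1 that by (simp add: tame_def)
  have e': "log_energy N (S' x) \<le> log_energy N x + c'" if "log_energy N x \<le> K - c'" for x
    using 2 that by (simp add: tame_def)
  have "(\<integral>\<^sup>+x. indicator {x. log_energy N x \<le> K - (c + c')} x * f (S' (S x)) \<partial>white_noise \<beta>)
      \<le> ennreal (exp (c + c')) * (\<integral>\<^sup>+x. f x \<partial>white_noise \<beta>)" if [measurable]: "f \<in> borel_measurable (white_noise \<beta>)" for f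
  proof -
    \<comment> \<open>The second map together with its energy cutoff becomes a test function for the
      first. The cutoff holds at \<open>S x\<close> because the first map raises the energy by at
      most \<open>c\<close>.\<close>
    define g where "g = (\<lambda>x. indicator {x. log_energy N x \<le> K - c'} x * f (S' x))"
    have [measurable]: "g \<in> borel_measurable (white_noise \<beta>)"
      unfolding g_def by measurable
    have "(\<integral>\<^sup>+x. indicator {x. log_energy N x \<le> K - (c + c')} x * f (S' (S x)) \<partial>white_noise \<beta>)
      \<le> (\<integral>\<^sup>+x. indicator {x. log_energy N x \<le> K - c} x * g (S x) \<partial>white_noise \<beta>)"
    proof (rule nn_integral_mono)
      fix x
      show "indicator {x. log_energy N x \<le> K - (c + c')} x * f (S' (S x)) \<le> indicator {x. log_energy N x \<le> K - c} x * g (S x)"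
        using e[of x] c by (auto simp: g_def indicator_def)
    qed
    also have "\<dots> \<le> ennreal (exp c) * (\<integral>\<^sup>+x. g x \<partial>white_noise \<beta>)"
      using 1 by (simp add: tame_def)
    also have "\<dots> \<le> ennreal (exp c) * (ennreal (exp c') * (\<integral>\<^sup>+x. f x \<partial>white_noise \<beta>))"
      using 2 unfolding g_def by (intro mult_left_mono) (auto simp: tame_def)
    finally show ?thesis by (simp add: exp_add ennreal_mult mult_ac)
  qed
  moreover have "log_energy N (S' (S x)) \<le> log_energy N x + (c + c')" if "log_energy N x \<le> K - (c + c')" for x
    using e[of x] e'[of "S x"] that c by auto
  ultimately show ?thesis using c unfolding tame_def by auto
qed

lemma tame_power:
  assumes "tame \<beta> N K c S"
  shows "tame \<beta> N K (real k * c) (S ^^ k)"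
proof (induction k)
  case 0
  then show ?case using tame_id by (simp add: id_def)
next
  case (Suc k)
  from tame_comp[OF this assms] show ?case by (simp add: algebra_simps o_def)
qed

lemma tame_sweep:
  assumes \<beta>: "\<beta> > 0" and R: "R \<ge> 0" and h: "8 * \<bar>h\<bar> * (R + 1)\<^sup>2 \<le> 1" and \<eta>: "\<eta> \<ge> 0"
    and step: "\<And>x. log_energy N x \<le> K \<Longrightarrow> path_safe N h (R + 1) (sweep_list N) x \<and>
      - \<eta> * \<bar>h\<bar> \<le> path_sum N h (\<lambda>n e w z. shear_weight \<beta> e h w z) (sweep_list N) x \<and>
      log_energy N (sweep N h x) \<le> log_energy N x + \<eta> * \<bar>h\<bar>"
  shows "tame \<beta> N K (\<eta> * \<bar>h\<bar>) (sweep N h)"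
proof -
  let ?c = "\<eta> * \<bar>h\<bar>"
  have c: "?c \<ge> 0" using \<eta> by simp
  have [measurable]: "sweep N h \<in> white_noise \<beta> \<rightarrow>\<^sub>M white_noise \<beta>"
    using measurable_sweep[OF measurable_ident_sets[OF sets_white_noise], of "\<lambda>_. h" \<beta> N]
    by (simp add: measurable_cong_sets[OF refl sets_white_noise])
  have "(\<integral>\<^sup>+x. indicator {x. log_energy N x \<le> K - ?c} x * f (sweep N h x) \<partial>white_noise \<beta>)
      \<le> ennreal (exp ?c) * (\<integral>\<^sup>+x. f x \<partial>white_noise \<beta>)" if f [measurable]: "f \<in> borel_measurable (white_noise \<beta>)" for f
  proof -
    define g where "g = (\<lambda>x. indicator {x. path_safe N h (R + 1) (sweep_list N) x} x *
      (ennreal (exp (path_sum N h (\<lambda>n e w z. shear_weight \<beta> e h w z) (sweep_list N) x)) * f (sweep N h x)))"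
    have L: "\<And>i. i \<in> set (sweep_list N) \<Longrightarrow> snd i \<in> {1, \<i>}" using set_sweep_list by blast
    have "R + 1 > 0" using R by simp
    from white_noise_path[where N = N, OF \<beta> this h f L]
    have g: "g \<in> borel_measurable (white_noise \<beta>)" "(\<integral>\<^sup>+x. g x \<partial>white_noise \<beta>) \<le> (\<integral>\<^sup>+x. f x \<partial>white_noise \<beta>)"
      unfolding g_def sweep_def by auto
    have "(\<integral>\<^sup>+x. indicator {x. log_energy N x \<le> K - ?c} x * f (sweep N h x) \<partial>white_noise \<beta>)
        \<le> (\<integral>\<^sup>+x. ennreal (exp ?c) * g x \<partial>white_noise \<beta>)"
    proof (rule nn_integral_mono)
      fix x
      show "indicator {x. log_energy N x \<le> K - ?c} x * f (sweep N h x) \<le> ennreal (exp ?c) * g x"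
      proof (cases "log_energy N x \<le> K - ?c")
        case True
        then have s: "path_safe N h (R + 1) (sweep_list N) x"
          and p: "- \<eta> * \<bar>h\<bar> \<le> path_sum N h (\<lambda>n e w z. shear_weight \<beta> e h w z) (sweep_list N) x"
          using step[of x] c by auto
        \<comment> \<open>The accumulated weight is at least -?c, so the factor exp ?c compensates
          it.\<close>
        have "1 * f (sweep N h x) \<le> ennreal (exp ?c * exp (path_sum N h (\<lambda>n e w z. shear_weight \<beta> e h w z) (sweep_list N) x)) * f (sweep N h x)"
          using p by (intro mult_right_mono) (auto simp: exp_add[symmetric])
        then show ?thesis using s True by (simp add: g_def ennreal_mult mult.assoc)
      qed simp
    qed
    also have "\<dots> = ennreal (exp ?c) * (\<integral>\<^sup>+x. g x \<partial>white_noise \<beta>)"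
      using g(1) by (rule nn_integral_cmult)
    also have "\<dots> \<le> ennreal (exp ?c) * (\<integral>\<^sup>+x. f x \<partial>white_noise \<beta>)"
      using g(2) by (intro mult_left_mono) auto
    finally show ?thesis .
  qed
  then show ?thesis using c step unfolding tame_def by auto
qed

text \<open>
  Sites outside the box are frozen, so the discrete trajectories act on the whole configuration
  space and their laws can be compared with white noise itself.
\<close>

definition faithful :: "real \<Rightarrow> nat \<Rightarrow> real \<Rightarrow> real \<Rightarrow> real \<Rightarrow> real \<Rightarrow> bool" where
  "faithful \<beta> N K T \<eta> h \<longleftrightarrow>
    (\<forall>\<sigma>\<in>{1, -1}. \<forall>x n. log_energy N x \<le> K \<longrightarrow> continuous_on {0..T} (\<lambda>t. traj N h (\<sigma> * t) x n)) \<and>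
    (\<forall>\<sigma>\<in>{1, -1}. \<forall>x. \<forall>n\<in>box_sites N. \<forall>t\<in>{0..T}. log_energy N x \<le> K \<longrightarrow>
       cmod (traj N h (\<sigma> * t) x n - x n -
         of_real \<sigma> * integral {0..t} (\<lambda>s. AL_field (traj N h (\<sigma> * s) x n) (nbr_sum N (traj N h (\<sigma> * s) x) n))) \<le> \<eta>) \<and>
    (\<forall>x t. \<bar>t\<bar> \<le> T \<longrightarrow> log_energy N x \<le> K \<longrightarrow> log_energy N (traj N h t x) \<le> K + 1) \<and>
    (\<forall>t. \<forall>f\<in>borel_measurable (white_noise \<beta>). \<bar>t\<bar> \<le> T \<longrightarrow>
       (\<integral>\<^sup>+x. indicator {x. log_energy N x \<le> K} x * f (traj N h t x) \<partial>white_noise \<beta>)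
         \<le> ennreal (exp \<eta>) * (\<integral>\<^sup>+x. f x \<partial>white_noise \<beta>))"

lemma approximation:
  fixes \<beta> K T \<eta> :: real
  assumes \<beta>: "\<beta> > 0" and T: "T > 0" and \<eta>: "\<eta> > 0"
  shows "\<exists>h. faithful \<beta> N K T \<eta> h"
proof -
  define R where "R = exp (K + 1)"
  have R: "R \<ge> 0" by (simp add: R_def)
  have Rb: "cmod (x k) \<le> R" if "log_energy N x \<le> K + 1" "k \<in> box_sites N" for x k
    using cmod_le_log_energy[OF that(2), of x] that(1) unfolding R_def by (meson exp_le_cancel_iff order_trans)
  \<comment> \<open>The factor 2 counts two errors per step: sweep against Euler step, and Euler
    step against the integral. The time T + 1 leaves room for the last whole step beyond
    \<open>T\<close>, and min 1 \<eta> serves the energy bound K + 1 as well as the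
    tolerance.\<close>
  define \<epsilon> where "\<epsilon> = min 1 \<eta> / (2 * (T + 1))"
  have \<epsilon>: "\<epsilon> > 0" using T \<eta> by (simp add: \<epsilon>_def)
  have \<epsilon>T: "2 * \<epsilon> * (T + 1) = min 1 \<eta>" using T by (simp add: \<epsilon>_def field_simps)
  have "\<forall>\<^sub>F \<delta> in at_right 0. \<forall>w z w' z'. cmod w \<le> 2 * (R + 1) \<longrightarrow> cmod z \<le> R + 1 \<longrightarrow> cmod w' \<le> 2 * (R + 1) \<longrightarrow> cmod z' \<le> R + 1 \<longrightarrow>
     cmod (w - w') \<le> 2 * \<delta> \<longrightarrow> cmod (z - z') \<le> \<delta> \<longrightarrow> norm ((\<lambda>p. AL_field (snd p) (fst p)) (w, z) - (\<lambda>p. AL_field (snd p) (fst p)) (w', z')) \<le> \<epsilon>"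
    using \<epsilon> by (intro eventually_uniformly_close continuous_intros)
  then have "\<forall>\<^sub>F \<delta> in at_right 0. (\<forall>w z w' z'. cmod w \<le> 2 * (R + 1) \<longrightarrow> cmod z \<le> R + 1 \<longrightarrow> cmod w' \<le> 2 * (R + 1) \<longrightarrow> cmod z' \<le> R + 1 \<longrightarrow>
     cmod (w - w') \<le> 2 * \<delta> \<longrightarrow> cmod (z - z') \<le> \<delta> \<longrightarrow> cmod (AL_field z w - AL_field z' w') \<le> \<epsilon>) \<and> \<delta> \<in> {0<..<1}"
    by (intro eventually_conj eventually_at_right_real) simp_all
  then obtain \<delta> where \<delta>: "0 < \<delta>" "\<delta> < 1" and close: "\<And>w z w' z'. cmod w \<le> 2 * (R + 1) \<Longrightarrow> cmod z \<le> R + 1 \<Longrightarrow>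
      cmod w' \<le> 2 * (R + 1) \<Longrightarrow> cmod z' \<le> R + 1 \<Longrightarrow>
     cmod (w - w') \<le> 2 * \<delta> \<Longrightarrow> cmod (z - z') \<le> \<delta> \<Longrightarrow> cmod (AL_field z w - AL_field z' w') \<le> \<epsilon>"
    by (drule_tac eventually_happens) auto
  \<comment> \<open>Sweeps that move each site by at most \<delta> keep the variation of the field
    within one step below \<epsilon>.\<close>
  define \<epsilon>' where "\<epsilon>' = min \<epsilon> \<delta>"
  have \<epsilon>': "\<epsilon>' > 0" "\<epsilon>' \<le> \<epsilon>" "\<epsilon>' \<le> \<delta>" using \<epsilon> \<delta> by (auto simp: \<epsilon>'_def)
  obtain h0 where h0: "h0 > 0" "8 * h0 * (R + 1)\<^sup>2 \<le> 1"
    and step: "\<And>h x. \<bar>h\<bar> \<le> h0 \<Longrightarrow> (\<And>k. k \<in> box_sites N \<Longrightarrow> cmod (x k) \<le> R) \<Longrightarrow>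
      path_safe N h (R + 1) (sweep_list N) x \<and>
      - \<epsilon>' * \<bar>h\<bar> \<le> path_sum N h (\<lambda>n e w z. shear_weight \<beta> e h w z) (sweep_list N) x \<and>
      log_energy N (sweep N h x) \<le> log_energy N x + \<epsilon>' * \<bar>h\<bar> \<and>
      (\<forall>k\<in>box_sites N. cmod (sweep N h x k - x k) \<le> \<epsilon>' \<and>
        cmod (sweep N h x k - x k - of_real h * AL_field (x k) (nbr_sum N x k)) \<le> \<epsilon>' * \<bar>h\<bar>)"
    using sweep_step[OF R \<epsilon>'(1) \<beta>, of N] by metis
  define h where "h = min h0 1"
  have h: "h > 0" "h \<le> h0" "h \<le> 1" using h0 by (auto simp: h_def)
  have tame1: "tame \<beta> N (K + 1) (\<epsilon>' * \<bar>\<tau>\<bar>) (sweep N \<tau>)" if \<tau>: "\<bar>\<tau>\<bar> \<le> h" for \<tau>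
  proof (rule tame_sweep[OF \<beta> R])
    have "8 * \<bar>\<tau>\<bar> * (R + 1)\<^sup>2 \<le> 8 * h0 * (R + 1)\<^sup>2" using \<tau> h by (intro mult_right_mono) auto
    then show "8 * \<bar>\<tau>\<bar> * (R + 1)\<^sup>2 \<le> 1" using h0 by linarith
    fix x assume "log_energy N x \<le> K + 1"
    then show "path_safe N \<tau> (R + 1) (sweep_list N) x \<and>
      - \<epsilon>' * \<bar>\<tau>\<bar> \<le> path_sum N \<tau> (\<lambda>n e w z. shear_weight \<beta> e \<tau> w z) (sweep_list N) x \<and>
      log_energy N (sweep N \<tau> x) \<le> log_energy N x + \<epsilon>' * \<bar>\<tau>\<bar>"
      using step[of \<tau> x] \<tau> h Rb by auto
  qed (use \<epsilon>' in auto)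
  have tameP: "tame \<beta> N (K + 1) (real k * (\<epsilon>' * h)) (sweep N (\<sigma> * h) ^^ k)" if "\<sigma> \<in> {1, -1}" for \<sigma> k
    using tame_power[OF tame1[of "\<sigma> * h"], of k] that h by (auto simp: abs_mult)
  have split: "\<exists>\<sigma>\<in>{1,-1}. \<exists>k \<tau>. t = \<sigma> * (real k * h + \<tau>) \<and> 0 \<le> \<tau> \<and> \<tau> < h \<and> \<bar>t\<bar> = real k * h + \<tau>" for t
  proof -
    define k where "k = nat \<lfloor>\<bar>t\<bar> / h\<rfloor>"
    have "real k \<le> \<bar>t\<bar> / h" "\<bar>t\<bar> / h < real k + 1"
    proof -
      have "\<bar>t\<bar> / h \<ge> 0" using h by simp
      then show "real k \<le> \<bar>t\<bar> / h" "\<bar>t\<bar> / h < real k + 1" unfolding k_def by linarith+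
    qed
    then have "real k * h \<le> \<bar>t\<bar>" "\<bar>t\<bar> < real k * h + h"
      using h by (simp_all add: field_simps)
    then show ?thesis
      by (intro bexI[of _ "if t \<ge> 0 then 1 else -1"] exI[of _ k] exI[of _ "\<bar>t\<bar> - real k * h"]) auto
  qed
  have tameT: "tame \<beta> N (K + 1) (\<epsilon>' * \<bar>t\<bar>) (traj N h t)" for t
  proof -
    obtain \<sigma> k \<tau> where s: "\<sigma> \<in> {1,-1}" "t = \<sigma> * (real k * h + \<tau>)" "0 \<le> \<tau>" "\<tau> < h" "\<bar>t\<bar> = real k * h + \<tau>"
      using split by blast
    have "traj N h t = (\<lambda>x. sweep N (\<sigma> * \<tau>) ((sweep N (\<sigma> * h) ^^ k) x))"
      unfolding s(2) using s h by (intro ext traj_eq) auto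
    moreover have "\<bar>\<sigma> * \<tau>\<bar> = \<tau>" using s by (auto simp: abs_mult)
    ultimately show ?thesis
      using tame_comp[OF tameP[OF s(1), of k] tame1[of "\<sigma> * \<tau>"]] s by (simp add: algebra_simps)
  qed
  have small: "\<epsilon>' * \<bar>t\<bar> \<le> min 1 \<eta>" if "\<bar>t\<bar> \<le> T + 1" for t
  proof -
    have "\<epsilon>' * \<bar>t\<bar> \<le> \<epsilon> * (T + 1)" using \<epsilon>' that \<epsilon> by (intro mult_mono) auto
    also have "\<dots> \<le> 2 * \<epsilon> * (T + 1)" using \<epsilon> T by simp
    finally show ?thesis using \<epsilon>T by simp
  qed
  have energy: "log_energy N (traj N h t x) \<le> K + 1" if "\<bar>t\<bar> \<le> T + 1" "log_energy N x \<le> K" for t x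
  proof -
    have c: "\<epsilon>' * \<bar>t\<bar> \<le> 1" using small[OF that(1)] by simp
    then have "log_energy N (traj N h t x) \<le> log_energy N x + \<epsilon>' * \<bar>t\<bar>"
      using tameT[of t] that(2) by (simp add: tame_def)
    then show ?thesis using c that(2) by linarith
  qed
  \<comment> \<open>Induction over whole steps. A step of length \<tau> adds 2 * \<epsilon> * \<tau>
    to the error, so the bound is linear in time.\<close>
  have main: "continuous_on {0..real m * h} (\<lambda>t. traj N h (\<sigma> * t) x n) \<and>
      (n \<in> box_sites N \<longrightarrow> (\<forall>t\<in>{0..real m * h}. cmod (traj N h (\<sigma> * t) x n - x n -
         of_real \<sigma> * integral {0..t} (\<lambda>s. AL_field (traj N h (\<sigma> * s) x n) (nbr_sum N (traj N h (\<sigma> * s) x) n))) \<le> 2 * \<epsilon> * t))"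
    if \<sigma>: "\<sigma> \<in> {1, -1}" and x: "log_energy N x \<le> K" and m: "real m * h \<le> T + 1" for \<sigma> x m n
    using m
  proof (induction m arbitrary: n)
    case 0
    then show ?case by simp
  next
    case (Suc m)
    define y where "y = (\<lambda>t. traj N h (\<sigma> * t) x)"
    define F where "F = (\<lambda>n s. AL_field (y s n) (nbr_sum N (y s) n))"
    define a where "a = real m * h"
    have a: "a \<ge> 0" "a + h \<le> T + 1" "real (Suc m) * h = a + h" using h Suc.prems by (auto simp: a_def algebra_simps)
    define X where "X = (sweep N (\<sigma> * h) ^^ m) x"
    have yX: "y (a + \<tau>) = sweep N (\<sigma> * \<tau>) X" if "0 \<le> \<tau>" "\<tau> \<le> h" for \<tau>
      unfolding y_def a_def X_def using traj_eq[OF \<sigma> h(1) that, of N m] by simp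
    have X: "X = y a" using yX[of 0] h by simp
    have IHc: "continuous_on {0..a} (\<lambda>t. y t n)" for n
      using Suc.IH[of n] Suc.prems h by (simp add: y_def a_def algebra_simps)
    have IHb: "cmod (y t n - x n - of_real \<sigma> * integral {0..t} (F n)) \<le> 2 * \<epsilon> * t"
      if "n \<in> box_sites N" "t \<in> {0..a}" for n t
    proof -
      have "real m * h \<le> T + 1" using a h by (simp add: a_def)
      then show ?thesis using Suc.IH[of n] that unfolding y_def F_def a_def by blast
    qed
    have "continuous_on {a..a + h} (\<lambda>t. y t n)" for n
    proof -
      have "continuous_on {a..a + h} (\<lambda>t. sweep N (\<sigma> * (t - a)) X n)"
        by (intro continuous_on_sweep continuous_intros)
      then show ?thesis
        by (rule continuous_on_eq) (use yX[of "_ - a"] in auto)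
    qed
    from continuous_on_closed_Un[OF _ _ IHc this]
    have cont: "continuous_on {0..a + h} (\<lambda>t. y t n)" for n
      using a h by (simp add: ivl_disj_un_two_touch)
    have contF: "continuous_on {0..a + h} (F n)" for n
    proof -
      have "continuous_on {0..a + h} (\<lambda>s. nbr_sum N (y s) n)"
        using cont by (rule continuous_on_nbr_sum)
      then show ?thesis unfolding F_def using cont by (intro continuous_intros)
    qed
    have int: "F n integrable_on {b..c}" if "0 \<le> b" "c \<le> a + h" for n b c
      using that by (intro integrable_continuous_real continuous_on_subset[OF contF]) auto
    have eX: "log_energy N X \<le> K + 1"
      unfolding X y_def using \<sigma> a h x by (intro energy) (auto simp: abs_mult)
    have RX: "cmod (X k) \<le> R" if "k \<in> box_sites N" for k using Rb[OF eX that] .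
    have st: "cmod (sweep N (\<sigma> * \<tau>) X k - X k) \<le> \<epsilon>' \<and>
        cmod (sweep N (\<sigma> * \<tau>) X k - X k - of_real (\<sigma> * \<tau>) * AL_field (X k) (nbr_sum N X k)) \<le> \<epsilon>' * \<tau>"
      if "0 \<le> \<tau>" "\<tau> \<le> h" "k \<in> box_sites N" for \<tau> k
    proof -
      have "\<bar>\<sigma> * \<tau>\<bar> = \<tau>" using \<sigma> that by (auto simp: abs_mult)
      then show ?thesis using step[of "\<sigma> * \<tau>" X] RX that h by auto
    qed
    have bound: "cmod (y t n - x n - of_real \<sigma> * integral {0..t} (F n)) \<le> 2 * \<epsilon> * t"
      if n: "n \<in> box_sites N" and t: "t \<in> {0..a + h}" for t
    proof (cases "t \<le> a")
      case True
      then show ?thesis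
        using IHb[OF n, of t] t by simp
    next
      case False
      define \<tau> where "\<tau> = t - a"
      have \<tau>: "0 \<le> \<tau>" "\<tau> \<le> h" "t = a + \<tau>" using False t by (auto simp: \<tau>_def)
      let ?FX = "AL_field (X n) (nbr_sum N X n)"
      have FX: "cmod (F n s - ?FX) \<le> \<epsilon>" if s: "s \<in> {a..t}" for s
      proof -
        have ys: "y s = sweep N (\<sigma> * (s - a)) X" using yX[of "s - a"] s \<tau> by simp
        have d: "cmod (y s k - X k) \<le> \<delta>" if "k \<in> box_sites N" for k
          using st[of "s - a" k] s \<tau> that \<epsilon>' unfolding ys by auto
        have b: "cmod (y s k) \<le> R + 1" if "k \<in> box_sites N" for k
          using d[OF that] RX[OF that] norm_triangle_sub[of "y s k" "X k"] \<delta> by linarith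
        have b': "cmod (X k) \<le> R + 1" if "k \<in> box_sites N" for k
          using RX[OF that] by simp
        show ?thesis
          unfolding F_def using R b b' d n \<delta>
          by (intro close nbr_sum_bound nbr_sum_diff_bound) auto
      qed
      have "integral {a..t} (F n) - of_real \<tau> * ?FX = integral {a..t} (\<lambda>s. F n s - ?FX)"
        using int[of a t n] a \<tau> by (subst integral_diff) (auto simp: scaleR_conv_of_real)
      moreover have "cmod (integral {a..t} (\<lambda>s. F n s - ?FX)) \<le> \<epsilon> * (t - a)"
        using \<tau> int[of a t n] a FX
        by (intro integral_bound continuous_intros continuous_on_subset[OF contF]) auto
      ultimately have 1: "cmod (integral {a..t} (F n) - of_real \<tau> * ?FX) \<le> \<epsilon> * \<tau>" using \<tau> by simp
      have 2: "cmod (y t n - X n - of_real (\<sigma> * \<tau>) * ?FX) \<le> \<epsilon> * \<tau>"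
        using st[OF \<tau>(1,2) n] yX[OF \<tau>(1,2)] \<tau> \<epsilon>'(2) mult_right_mono[of \<epsilon>' \<epsilon> \<tau>] by auto
      have 3: "cmod (X n - x n - of_real \<sigma> * integral {0..a} (F n)) \<le> 2 * \<epsilon> * a"
        unfolding X using IHb[OF n, of a] a by simp
      have I: "integral {0..t} (F n) = integral {0..a} (F n) + integral {a..t} (F n)"
        using int[of 0 t n] a \<tau> by (intro Henstock_Kurzweil_Integration.integral_combine[symmetric]) auto
      have eq: "y t n - x n - of_real \<sigma> * integral {0..t} (F n)
         = (X n - x n - of_real \<sigma> * integral {0..a} (F n)) + (y t n - X n - of_real (\<sigma> * \<tau>) * ?FX)
           - of_real \<sigma> * (integral {a..t} (F n) - of_real \<tau> * ?FX)"
        unfolding I by (simp add: algebra_simps)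
      have "cmod (of_real \<sigma> * (integral {a..t} (F n) - of_real \<tau> * ?FX)) \<le> \<epsilon> * \<tau>"
        using 1 \<sigma> by (auto simp: norm_mult)
      moreover have "cmod (A + B - C) \<le> cmod A + cmod B + cmod C" for A B C :: complex
        using norm_triangle_ineq4[of "A + B" C] norm_triangle_ineq[of A B] by linarith
      ultimately have "cmod (y t n - x n - of_real \<sigma> * integral {0..t} (F n)) \<le> 2 * \<epsilon> * a + \<epsilon> * \<tau> + \<epsilon> * \<tau>"
        unfolding eq using 2 3 by (meson add_mono order_trans)
      then show ?thesis using \<tau> by (simp add: algebra_simps)
    qed
    show ?case unfolding a(3) using cont bound unfolding y_def F_def by auto
  qed
  define m where "m = nat \<lceil>T / h\<rceil>"
  have m: "T \<le> real m * h" "real m * h \<le> T + 1"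
  proof -
    have "T / h \<le> real m" unfolding m_def by linarith
    then show "T \<le> real m * h" using h by (simp add: field_simps)
    have "T / h \<ge> 0" using T h by simp
    then have "real m \<le> T / h + 1" unfolding m_def by linarith
    then have "real m * h \<le> T + h" using h by (simp add: field_simps)
    then show "real m * h \<le> T + 1" using h by linarith
  qed
  show ?thesis
    unfolding faithful_def
  proof (intro exI[of _ h] conjI ballI allI impI)
    fix \<sigma> x n assume \<sigma>: "\<sigma> \<in> {1, -1 :: real}" and x: "log_energy N x \<le> K"
    show "continuous_on {0..T} (\<lambda>t. traj N h (\<sigma> * t) x n)"
      using main[OF \<sigma> x m(2), of n] m(1) by (auto intro: continuous_on_subset)
  next
    fix \<sigma> x n t assume \<sigma>: "\<sigma> \<in> {1, -1 :: real}" and n: "n \<in> box_sites N" and t: "t \<in> {0..T}" and x: "log_energy N x \<le> K"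
    have "2 * \<epsilon> * t \<le> 2 * \<epsilon> * (T + 1)" using t \<epsilon> by (intro mult_left_mono) auto
    then have le: "2 * \<epsilon> * t \<le> \<eta>" using \<epsilon>T by simp
    have t': "t \<in> {0..real m * h}" using t m(1) by simp
    show "cmod (traj N h (\<sigma> * t) x n - x n -
         of_real \<sigma> * integral {0..t} (\<lambda>s. AL_field (traj N h (\<sigma> * s) x n) (nbr_sum N (traj N h (\<sigma> * s) x) n))) \<le> \<eta>"
      by (rule order_trans[OF main[OF \<sigma> x m(2), of n, THEN conjunct2, rule_format, OF n t'] le])
  next
    fix x t assume "\<bar>t\<bar> \<le> T" "log_energy N x \<le> K"
    then show "log_energy N (traj N h t x) \<le> K + 1" by (intro energy) auto
  next
    fix t and f :: "(int \<Rightarrow> complex) \<Rightarrow> ennreal" assume f: "f \<in> borel_measurable (white_noise \<beta>)" and t: "\<bar>t\<bar> \<le> T"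
    have "\<epsilon>' * \<bar>t\<bar> \<le> 1" "\<epsilon>' * \<bar>t\<bar> \<le> \<eta>" using small[of t] t by auto
    then have "(\<integral>\<^sup>+x. indicator {x. log_energy N x \<le> K} x * f (traj N h t x) \<partial>white_noise \<beta>)
      \<le> (\<integral>\<^sup>+x. indicator {x. log_energy N x \<le> K + 1 - \<epsilon>' * \<bar>t\<bar>} x * f (traj N h t x) \<partial>white_noise \<beta>)"
      by (intro nn_integral_mono) (auto simp: indicator_def)
    also have "\<dots> \<le> ennreal (exp (\<epsilon>' * \<bar>t\<bar>)) * (\<integral>\<^sup>+x. f x \<partial>white_noise \<beta>)"
      using tameT[of t] f by (simp add: tame_def)
    also have "\<dots> \<le> ennreal (exp \<eta>) * (\<integral>\<^sup>+x. f x \<partial>white_noise \<beta>)"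
      using \<open>\<epsilon>' * \<bar>t\<bar> \<le> \<eta>\<close> by (intro mult_right_mono) auto
    finally show "(\<integral>\<^sup>+x. indicator {x. log_energy N x \<le> K} x * f (traj N h t x) \<partial>white_noise \<beta>) \<le> ennreal (exp \<eta>) * (\<integral>\<^sup>+x. f x \<partial>white_noise \<beta>)" .
  qed
qed

section \<open>Propagation of errors\<close>

text \<open>With the integral of \<kappa> as the new time, each use of the integral inequality
  raises the power in the second term by one and costs one site at the edge. The inequality is
  assumed for arbitrary continuous majorants \<open>u\<close>, so no regularity of a supremum over
  neighbours enters.\<close>

lemma gronwall_iteration:
  fixes d :: "int \<Rightarrow> real \<Rightarrow> real" and \<kappa> :: "real \<Rightarrow> real" and D \<eta> T :: real and m M :: nat
  assumes \<kappa>: "continuous_on {0..T} \<kappa>" "\<And>t. t \<in> {0..T} \<Longrightarrow> \<kappa> t \<ge> 0" and \<eta>: "\<eta> \<ge> 0"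
    and D: "\<And>n t. \<bar>n\<bar> \<le> int M \<Longrightarrow> t \<in> {0..T} \<Longrightarrow> d n t \<le> D"
    and step: "\<And>n t u. \<bar>n\<bar> < int M \<Longrightarrow> t \<in> {0..T} \<Longrightarrow> continuous_on {0..t} u \<Longrightarrow>
      (\<And>s k. s \<in> {0..t} \<Longrightarrow> \<bar>k - n\<bar> \<le> 1 \<Longrightarrow> d k s \<le> u s) \<Longrightarrow> d n t \<le> \<eta> + integral {0..t} (\<lambda>s. \<kappa> s * u s)"
    and n: "\<bar>n\<bar> + int m \<le> int M" and t: "t \<in> {0..T}"
  shows "d n t \<le> \<eta> * exp (integral {0..t} \<kappa>) + integral {0..t} \<kappa> ^ m / fact m * D"
  using n t
proof (induction m arbitrary: n t)
  case 0
  have "d n t \<le> D" using D 0 by simp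
  then show ?case using \<eta> by (simp add: add_increasing)
next
  case (Suc m)
  define I where "I = (\<lambda>t. integral {0..t} \<kappa>)"
  define u where "u = (\<lambda>s. \<eta> * exp (I s) + I s ^ m / fact m * D)"
  \<comment> \<open>An antiderivative of \<kappa> * u with value \<eta> at 0: the bound of order m
    integrates exactly to the bound of order m + 1.\<close>
  define U where "U = (\<lambda>s. \<eta> * exp (I s) + I s ^ Suc m / fact (Suc m) * D)"
  have \<kappa>t: "continuous_on {0..t} \<kappa>" using \<kappa>(1) Suc.prems(2) by (auto intro: continuous_on_subset)
  have dI: "(I has_real_derivative \<kappa> s) (at s within {0..t})" if "s \<in> {0..t}" for s
    unfolding I_def using integral_has_real_derivative[OF \<kappa>t that] .
  have contI: "continuous_on {0..t} I"
    using dI by (meson DERIV_continuous_on)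
  have dU: "(U has_real_derivative \<kappa> s * u s) (at s within {0..t})" if "s \<in> {0..t}" for s
  proof -
    have f: "real (Suc m) * I s ^ m * \<kappa> s / fact (Suc m) * D = I s ^ m * \<kappa> s / fact m * D"
      by (simp del: of_nat_Suc)
    have "(U has_real_derivative (\<eta> * (exp (I s) * \<kappa> s) + real (Suc m) * I s ^ m * \<kappa> s / fact (Suc m) * D)) (at s within {0..t})"
      unfolding U_def
      by (rule derivative_eq_intros dI[OF that] refl | simp)+
    moreover have "\<eta> * (exp (I s) * \<kappa> s) + real (Suc m) * I s ^ m * \<kappa> s / fact (Suc m) * D = \<kappa> s * u s"
      unfolding u_def f by (simp add: field_simps)
    ultimately show ?thesis by simp
  qed
  have "d n t \<le> \<eta> + integral {0..t} (\<lambda>s. \<kappa> s * u s)"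
  proof (rule step)
    show "continuous_on {0..t} u" unfolding u_def by (intro continuous_intros contI) auto
    show "d k s \<le> u s" if "s \<in> {0..t}" "\<bar>k - n\<bar> \<le> 1" for s k
      using Suc.IH[of k s] Suc.prems that unfolding u_def I_def by auto
  qed (use Suc.prems in auto)
  also have "integral {0..t} (\<lambda>s. \<kappa> s * u s) = U t - U 0"
  proof (rule integral_unique, rule fundamental_theorem_of_calculus)
    show "0 \<le> t" using Suc.prems by simp
    show "(U has_vector_derivative \<kappa> s * u s) (at s within {0..t})" if "s \<in> {0..t}" for s
      using dU[OF that] by (simp add: has_real_derivative_iff_has_vector_derivative)
  qed
  also have "U 0 = \<eta>" by (simp add: U_def I_def)
  finally show ?case unfolding U_def I_def by simp
qed

text \<open>The changes of \<open>w\<close>, of |z|^2 and of the linear term contribute at most 2 (1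
  + a) u, 4 a u and 2 u.\<close>

lemma AL_field_lipschitz:
  assumes "(cmod z)\<^sup>2 \<le> a" "(cmod z')\<^sup>2 \<le> a" "cmod w' \<le> 2 * sqrt a" "cmod (w - w') \<le> 2 * u" "cmod (z - z') \<le> u"
  shows "cmod (AL_field z w - AL_field z' w') \<le> (4 + 6 * a) * u"
proof -
  have a: "a \<ge> 0" using assms(1) zero_le_power2[of "cmod z"] by linarith
  have u: "u \<ge> 0" using assms(5) norm_ge_zero order_trans by blast
  have za: "cmod z \<le> sqrt a" "cmod z' \<le> sqrt a"
    using assms(1,2) by (simp_all add: real_le_rsqrt)
  have eq: "AL_field z w - AL_field z' w' = \<i> * (of_real (1 + (cmod z)\<^sup>2) * (w - w')
      + of_real ((cmod z)\<^sup>2 - (cmod z')\<^sup>2) * w' - 2 * (z - z'))"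
    by (simp add: AL_field_def algebra_simps)
  have 1: "cmod (of_real (1 + (cmod z)\<^sup>2) * (w - w')) \<le> (1 + a) * (2 * u)"
    unfolding norm_mult norm_of_real using assms a by (intro mult_mono) auto
  have "\<bar>(cmod z)\<^sup>2 - (cmod z')\<^sup>2\<bar> = \<bar>cmod z - cmod z'\<bar> * (cmod z + cmod z')"
    by (simp add: power2_eq_square square_diff_square_factored abs_mult)
  also have "\<dots> \<le> u * (2 * sqrt a)"
    using za u assms(5) norm_triangle_ineq3[of z z'] by (intro mult_mono) auto
  finally have "cmod (of_real ((cmod z)\<^sup>2 - (cmod z')\<^sup>2) * w') \<le> u * (2 * sqrt a) * (2 * sqrt a)"
    unfolding norm_mult norm_of_real using assms a u by (intro mult_mono) auto
  then have 2: "cmod (of_real ((cmod z)\<^sup>2 - (cmod z')\<^sup>2) * w') \<le> 4 * a * u"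
  proof -
    have "u * (2 * sqrt a) * (2 * sqrt a) = 4 * (sqrt a * sqrt a) * u" by (simp add: mult_ac)
    also have "sqrt a * sqrt a = a" using a by simp
    finally have e: "u * (2 * sqrt a) * (2 * sqrt a) = 4 * a * u" .
    show ?thesis
      using \<open>cmod (of_real ((cmod z)\<^sup>2 - (cmod z')\<^sup>2) * w') \<le> u * (2 * sqrt a) * (2 * sqrt a)\<close> unfolding e .
  qed
  have 3: "cmod (2 * (z - z')) \<le> 2 * u" unfolding norm_mult using assms(5) by simp
  have "cmod (A + B - C) \<le> cmod A + cmod B + cmod C" for A B C :: complex
    using norm_triangle_ineq4[of "A + B" C] norm_triangle_ineq[of A B] by linarith
  then have "cmod (AL_field z w - AL_field z' w') \<le> (1 + a) * (2 * u) + 4 * a * u + 2 * u"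
    unfolding eq norm_mult[of \<i>] using 1 2 3 by (smt (verit, best) norm_ii mult_cancel_right1 mult_1)
  then show ?thesis by (simp add: algebra_simps)
qed

section \<open>Approximate solutions and their comparison on boxes\<close>

text \<open>The integral form asks for no derivative, so it fits the discrete trajectories as well
  as exact solutions. Sites with |n| = M enter only as neighbours, without an equation of their own,
  and \<sigma> = 1 or -1 selects the direction of time.\<close>

definition approx_solution :: "real \<Rightarrow> real \<Rightarrow> nat \<Rightarrow> real \<Rightarrow> (int \<Rightarrow> complex) \<Rightarrow> (int \<Rightarrow> real \<Rightarrow> complex) \<Rightarrow> bool" where
  "approx_solution \<sigma> T M \<eta> a y \<longleftrightarrow>
     (\<forall>n. \<bar>n\<bar> \<le> int M \<longrightarrow> continuous_on {0..T} (y n)) \<and>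
     (\<forall>n t. \<bar>n\<bar> < int M \<longrightarrow> t \<in> {0..T} \<longrightarrow>
        cmod (y n t - a n - of_real \<sigma> * integral {0..t} (\<lambda>s. AL_field (y n s) (y (n + 1) s + y (n - 1) s))) \<le> \<eta>)"

text \<open>The Lipschitz bound supplies the rate 4 + 6 b, and each of the two approximate solutions
  contributes one defect \<eta>.\<close>

lemma approx_solution_comparison:
  fixes T \<eta> D \<sigma> J :: real and M m :: nat
  assumes y: "approx_solution \<sigma> T M \<eta> a y" and z: "approx_solution \<sigma> T M \<eta> a z" and \<sigma>: "\<bar>\<sigma>\<bar> = 1" and \<eta>: "\<eta> \<ge> 0"
    and b: "continuous_on {0..T} b" "\<And>n t. \<bar>n\<bar> \<le> int M \<Longrightarrow> t \<in> {0..T} \<Longrightarrow> (cmod (y n t))\<^sup>2 \<le> b t"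
      "\<And>n t. \<bar>n\<bar> \<le> int M \<Longrightarrow> t \<in> {0..T} \<Longrightarrow> (cmod (z n t))\<^sup>2 \<le> b t"
    and J: "integral {0..T} b \<le> J"
    and D: "\<And>n t. \<bar>n\<bar> \<le> int M \<Longrightarrow> t \<in> {0..T} \<Longrightarrow> cmod (y n t - z n t) \<le> D"
    and n: "\<bar>n\<bar> + int m \<le> int M" and t: "t \<in> {0..T}"
  shows "cmod (y n t - z n t) \<le> 2 * \<eta> * exp (4 * T + 6 * J) + (4 * T + 6 * J) ^ m / fact m * D"
proof -
  define \<kappa> where "\<kappa> = (\<lambda>s. 4 + 6 * b s)"
  have b0: "b s \<ge> 0" if "s \<in> {0..T}" for s
    using b(2)[of 0 s] that zero_le_power2[of "cmod (y 0 s)"] by (smt (verit) abs_zero of_nat_0_le_iff)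
  have D0: "D \<ge> 0" using D[of 0 t] t norm_ge_zero[of "y 0 t - z 0 t"] by (smt (verit) abs_zero of_nat_0_le_iff)
  have cont: "continuous_on {0..T} (y k)" "continuous_on {0..T} (z k)" if "\<bar>k\<bar> \<le> int M" for k
    using y z that by (auto simp: approx_solution_def)
  have \<kappa>c: "continuous_on {0..T} \<kappa>" unfolding \<kappa>_def by (intro continuous_intros b)
  have main: "cmod (y n t - z n t) \<le> 2 * \<eta> * exp (integral {0..t} \<kappa>) + integral {0..t} \<kappa> ^ m / fact m * D"
  proof (rule gronwall_iteration[where d = "\<lambda>n t. cmod (y n t - z n t)" and T = T and M = M, OF \<kappa>c _ _ D _ n t])
    show "\<kappa> s \<ge> 0" if "s \<in> {0..T}" for s using b0[OF that] by (simp add: \<kappa>_def)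
    show "2 * \<eta> \<ge> 0" using \<eta> by simp
    fix n t u
    assume n: "\<bar>n\<bar> < int M" and t: "t \<in> {0..T}" and u: "continuous_on {0..t} u"
      and le: "\<And>s k. s \<in> {0..t} \<Longrightarrow> \<bar>k - n\<bar> \<le> 1 \<Longrightarrow> cmod (y k s - z k s) \<le> u s"
    let ?F = "\<lambda>y s. AL_field (y n s) (y (n + 1) s + y (n - 1) s)"
    have nb: "\<bar>n\<bar> \<le> int M" "\<bar>n + 1\<bar> \<le> int M" "\<bar>n - 1\<bar> \<le> int M" using n by auto
    have sub: "{0..t} \<subseteq> {0..T}" using t by auto
    have cF: "continuous_on {0..t} (?F y)" "continuous_on {0..t} (?F z)"
      using nb by (auto intro!: continuous_intros continuous_on_subset[OF _ sub] cont)
    have Fb: "cmod (?F y s - ?F z s) \<le> \<kappa> s * u s" if s: "s \<in> {0..t}" for s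
    proof -
      have sT: "s \<in> {0..T}" using s sub by auto
      have r: "cmod (z k s) \<le> sqrt (b s)" if "\<bar>k\<bar> \<le> int M" for k
        using b(3)[OF that sT] by (simp add: real_le_rsqrt)
      show ?thesis unfolding \<kappa>_def
      proof (rule AL_field_lipschitz)
        show "cmod (z (n + 1) s + z (n - 1) s) \<le> 2 * sqrt (b s)"
          using norm_triangle_ineq[of "z (n + 1) s" "z (n - 1) s"] r[OF nb(2)] r[OF nb(3)] by linarith
        have eq: "y (n + 1) s + y (n - 1) s - (z (n + 1) s + z (n - 1) s) = (y (n + 1) s - z (n + 1) s) + (y (n - 1) s - z (n - 1) s)"
          by simp
        show "cmod (y (n + 1) s + y (n - 1) s - (z (n + 1) s + z (n - 1) s)) \<le> 2 * u s"
          unfolding eq using norm_triangle_ineq[of "y (n + 1) s - z (n + 1) s" "y (n - 1) s - z (n - 1) s"] le[OF s, of "n + 1"] le[OF s, of "n - 1"] by simp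
      qed (use b(2)[OF nb(1) sT] b(3)[OF nb(1) sT] le[OF s, of n] in auto)
    qed
    have ints: "?F y integrable_on {0..t}" "?F z integrable_on {0..t}" using cF by (auto intro: integrable_continuous_real)
    have "cmod (integral {0..t} (?F y) - integral {0..t} (?F z)) = cmod (integral {0..t} (\<lambda>s. ?F y s - ?F z s))"
      using ints by (subst integral_diff) auto
    also have "\<dots> \<le> integral {0..t} (\<lambda>s. \<kappa> s * u s)"
    proof (rule integral_norm_bound_integral)
      show "(\<lambda>s. ?F y s - ?F z s) integrable_on {0..t}" using ints by (rule integrable_diff)
      show "(\<lambda>s. \<kappa> s * u s) integrable_on {0..t}"
        by (intro integrable_continuous_real continuous_intros u continuous_on_subset[OF \<kappa>c sub])
    qed (rule Fb)
    finally have 1: "cmod (integral {0..t} (?F y) - integral {0..t} (?F z)) \<le> integral {0..t} (\<lambda>s. \<kappa> s * u s)" .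
    have 2: "cmod (y n t - a n - of_real \<sigma> * integral {0..t} (?F y)) \<le> \<eta>"
      "cmod (z n t - a n - of_real \<sigma> * integral {0..t} (?F z)) \<le> \<eta>"
      using y z n t by (auto simp: approx_solution_def)
    have eq: "y n t - z n t = (y n t - a n - of_real \<sigma> * integral {0..t} (?F y)) - (z n t - a n - of_real \<sigma> * integral {0..t} (?F z))
        + of_real \<sigma> * (integral {0..t} (?F y) - integral {0..t} (?F z))"
      by (simp add: algebra_simps)
    have "cmod (of_real \<sigma> * (integral {0..t} (?F y) - integral {0..t} (?F z))) \<le> integral {0..t} (\<lambda>s. \<kappa> s * u s)"
      using 1 \<sigma> by (simp add: norm_mult)
    moreover have "cmod (A - B + C) \<le> cmod A + cmod B + cmod C" for A B C :: complex
      using norm_triangle_ineq[of "A - B" C] norm_triangle_ineq4[of A B] by linarith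
    ultimately have "cmod (y n t - z n t) \<le> \<eta> + \<eta> + integral {0..t} (\<lambda>s. \<kappa> s * u s)"
      using 2 unfolding eq by (meson add_mono order_trans)
    then show "cmod (y n t - z n t) \<le> 2 * \<eta> + integral {0..t} (\<lambda>s. \<kappa> s * u s)" by simp
  qed
  have \<kappa>int: "\<kappa> integrable_on {c..d}" if "0 \<le> c" "d \<le> T" for c d
    using that by (intro integrable_continuous_real continuous_on_subset[OF \<kappa>c]) auto
  have I0: "0 \<le> integral {0..t} \<kappa>"
    using t b0 by (intro Henstock_Kurzweil_Integration.integral_nonneg \<kappa>int) (auto simp: \<kappa>_def)
  have "integral {0..t} \<kappa> \<le> integral {0..T} \<kappa>"
    using t b0 by (intro integral_subset_le \<kappa>int) (auto simp: \<kappa>_def)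
  also have "\<dots> = 4 * T + 6 * integral {0..T} b"
    using t b(1) unfolding \<kappa>_def by (subst integral_add) (auto intro!: integrable_continuous_real continuous_intros)
  also have "\<dots> \<le> 4 * T + 6 * J" using J by simp
  finally have I1: "integral {0..t} \<kappa> \<le> 4 * T + 6 * J" .
  show ?thesis
    using I0 I1 \<eta> D0
    by (intro order_trans[OF main] add_mono mult_mono divide_right_mono power_mono) auto
qed

definition mass :: "real \<Rightarrow> real \<Rightarrow> nat \<Rightarrow> (int \<Rightarrow> complex) \<Rightarrow> real" where
  "mass p q M x = (\<Sum>n\<in>box_sites M. japanese_bracket n powr (- q) * cmod (x n) powr (2 * p))"

lemma japanese_bracket_ge_1: "japanese_bracket n \<ge> 1"
  by (simp add: japanese_bracket_def)

lemma japanese_bracket_mono: "\<bar>k\<bar> \<le> \<bar>n\<bar> \<Longrightarrow> japanese_bracket k \<le> japanese_bracket n"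
  unfolding japanese_bracket_def
  by (intro real_sqrt_le_mono add_left_mono) (simp add: abs_le_square_iff[symmetric] flip: of_int_abs)

text \<open>Young's inequality \<open>u\<^bsup>1/p\<^esup> \<le> A\<^bsup>1/p\<^esup> (1 + u / A)\<close> replaces Hoelder's inequality in time.\<close>

lemma mass_controls_sup:
  fixes p q H T :: real
  assumes p: "p > 1" and q: "q > 0" and H: "H > 0" and T: "T \<ge> 0"
    and y: "\<And>n. \<bar>n\<bar> \<le> int M \<Longrightarrow> continuous_on {0..T} (y n)"
    and mass: "integral {0..T} (\<lambda>t. mass p q M (\<lambda>n. y n t)) \<le> H"
  obtains b where "continuous_on {0..T} b" "\<And>t. b t \<ge> 0" "\<And>n t. \<bar>n\<bar> \<le> int M \<Longrightarrow> (cmod (y n t))\<^sup>2 \<le> b t"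
    "integral {0..T} b \<le> (japanese_bracket (int M) powr q * H) powr (1 / p) * (T + 1)"
proof -
  \<comment> \<open>The largest |y_n|^(2p) in the box that is compatible with a mass of
    \<open>H\<close>. At this scale v / A \<le> S / H, and the time integral of S / H is at most 1,
    whence the factor T + 1.\<close>
  define A where "A = japanese_bracket (int M) powr q * H"
  have jp: "japanese_bracket n > 0" for n using japanese_bracket_ge_1[of n] by linarith
  have A: "A > 0" using H jp[of "int M"] by (simp add: A_def)
  define S where "S = (\<lambda>t. mass p q M (\<lambda>n. y n t))"
  have S0: "S t \<ge> 0" for t unfolding S_def mass_def by (intro sum_nonneg) auto
  have Sc: "continuous_on {0..T} S"
    unfolding S_def mass_def using p y
    by (intro continuous_on_sum continuous_on_mult continuous_on_const continuous_on_powr' continuous_on_norm)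
       (auto simp: box_sites_def)
  define b where "b = (\<lambda>t. A powr (1 / p) * (1 + S t / H))"
  show ?thesis
  proof (rule that[of b])
    show "continuous_on {0..T} b" unfolding b_def by (intro continuous_intros Sc) (use H in auto)
    show "b t \<ge> 0" for t using S0[of t] H by (simp add: b_def)
    show "(cmod (y n t))\<^sup>2 \<le> b t" if n: "\<bar>n\<bar> \<le> int M" for n t
    proof -
      define v where "v = cmod (y n t) powr (2 * p)"
      have "japanese_bracket n powr (- q) * v \<le> S t"
        unfolding S_def mass_def v_def using n by (intro member_le_sum) (auto simp: box_sites_def)
      moreover have "japanese_bracket (int M) powr (- q) \<le> japanese_bracket n powr (- q)"
        using q n jp by (intro powr_mono2') (auto intro: japanese_bracket_mono)
      ultimately have "japanese_bracket (int M) powr (- q) * v \<le> S t"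
        by (smt (verit) mult_right_mono powr_ge_zero v_def)
      then have "v \<le> japanese_bracket (int M) powr q * S t"
        using jp[of "int M"] by (simp add: powr_minus field_simps)
      then have vA: "v / A \<le> S t / H"
        using jp[of "int M"] H by (simp add: A_def field_simps)
      have v0: "v \<ge> 0" by (simp add: v_def)
      have "(v / A) powr (1 / p) \<le> 1 + v / A"
      proof (cases "v / A \<le> 1")
        case True
        then have "(v / A) powr (1 / p) \<le> 1 powr (1 / p)" using v0 A p by (intro powr_mono2) auto
        then show ?thesis using v0 A by (simp add: add_increasing2)
      next
        case False
        then have "(v / A) powr (1 / p) \<le> (v / A) powr 1" using p by (intro powr_mono) auto
        then show ?thesis using False by simp
      qed
      then have "A powr (1 / p) * (v / A) powr (1 / p) \<le> A powr (1 / p) * (1 + S t / H)"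
        using vA by (intro mult_left_mono) auto
      moreover have "A powr (1 / p) * (v / A) powr (1 / p) = v powr (1 / p)"
        using A v0 by (simp add: powr_mult[symmetric])
      moreover have "v powr (1 / p) = (cmod (y n t))\<^sup>2"
        using p by (cases "y n t = 0") (auto simp: v_def powr_powr powr_numeral)
      ultimately show ?thesis by (simp add: b_def)
    qed
    have Si: "S integrable_on {0..T}" using Sc by (rule integrable_continuous_real)
    have i: "integral {0..T} (\<lambda>t. 1 + S t / H) = T + integral {0..T} S / H"
      using Si T H by (subst integral_add) (auto intro!: integrable_continuous_real continuous_intros Sc)
    have "integral {0..T} b = A powr (1 / p) * (T + integral {0..T} S / H)"
      unfolding b_def i[symmetric] by simp
    also have "\<dots> \<le> A powr (1 / p) * (T + 1)" using mass H by (intro mult_left_mono) (auto simp: S_def)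
    finally show "integral {0..T} b \<le> (japanese_bracket (int M) powr q * H) powr (1 / p) * (T + 1)"
      by (simp add: A_def)
  qed
qed

lemma power_div_fact_le_exp:
  fixes x :: real
  assumes "x \<ge> 0"
  shows "x ^ n / fact n \<le> exp x"
proof -
  have "(\<Sum>k\<in>{n}. x ^ k /\<^sub>R fact k) \<le> (\<Sum>k. x ^ k /\<^sub>R fact k)"
    using assms by (intro sum_le_suminf summable_exp_generic) auto
  then show ?thesis by (simp add: exp_def divide_inverse mult.commute)
qed

text \<open>Here m iterations lead from the box of size 2 m to the one of size m. Since m^m / m!
  \<le> e^m, the smallness hypothesis bounds the factor I^m / m! by (exp (-c) / 2)^m, which cancels
  the a priori bound exp (c m) and leaves 2^(-m).\<close>

lemma box_comparison:
  fixes T \<eta> c \<sigma> p q p' q' H H' :: real and m :: nat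
  assumes y: "approx_solution \<sigma> T (2 * m) \<eta> a y" and z: "approx_solution \<sigma> T (2 * m) \<eta> a z" and \<sigma>: "\<bar>\<sigma>\<bar> = 1" and \<eta>: "\<eta> \<ge> 0"
    and pq: "p > 1" "q > 0" "p' > 1" "q' > 0" and H: "H > 0" "H' > 0"
    and my: "integral {0..T} (\<lambda>t. mass p q (2 * m) (\<lambda>n. y n t)) \<le> H"
    and mz: "integral {0..T} (\<lambda>t. mass p' q' (2 * m) (\<lambda>n. z n t)) \<le> H'"
    and D: "\<And>n t. \<bar>n\<bar> \<le> int (2 * m) \<Longrightarrow> t \<in> {0..T} \<Longrightarrow> cmod (y n t) \<le> exp (c * m) \<and> cmod (z n t) \<le> exp (c * m)"
    and c: "c \<ge> 0" and m: "m > 0"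
    and small: "4 * T + 6 * ((japanese_bracket (int (2 * m)) powr q * H) powr (1 / p) * (T + 1)
        + (japanese_bracket (int (2 * m)) powr q' * H') powr (1 / p') * (T + 1)) \<le> m * exp (- 1 - c) / 2"
    and n: "\<bar>n\<bar> \<le> int m" and t: "t \<in> {0..T}"
  shows "cmod (y n t - z n t) \<le> 2 * \<eta> * exp m + 2 * (1 / 2) ^ m"
proof -
  have T: "T \<ge> 0" using t by simp
  obtain b where b: "continuous_on {0..T} b" "\<And>t. b t \<ge> 0" "\<And>n t. \<bar>n\<bar> \<le> int (2 * m) \<Longrightarrow> (cmod (y n t))\<^sup>2 \<le> b t"
    "integral {0..T} b \<le> (japanese_bracket (int (2 * m)) powr q * H) powr (1 / p) * (T + 1)"
    using mass_controls_sup[OF pq(1,2) H(1) T _ my] y unfolding approx_solution_def by blast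
  obtain b' where b': "continuous_on {0..T} b'" "\<And>t. b' t \<ge> 0" "\<And>n t. \<bar>n\<bar> \<le> int (2 * m) \<Longrightarrow> (cmod (z n t))\<^sup>2 \<le> b' t"
    "integral {0..T} b' \<le> (japanese_bracket (int (2 * m)) powr q' * H') powr (1 / p') * (T + 1)"
    using mass_controls_sup[OF pq(3,4) H(2) T _ mz] z unfolding approx_solution_def by blast
  \<comment> \<open>The sum of the two majorants serves for both functions, although their exponents
    may differ.\<close>
  define J where "J = integral {0..T} (\<lambda>t. b t + b' t)"
  define I where "I = 4 * T + 6 * J"
  have Jeq: "J = integral {0..T} b + integral {0..T} b'"
    unfolding J_def using b(1) b'(1) by (intro integral_add integrable_continuous_real)
  have J0: "J \<ge> 0"
    unfolding J_def using b b'
    by (intro Henstock_Kurzweil_Integration.integral_nonneg integrable_continuous_real continuous_intros) auto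
  have I0: "I \<ge> 0" using J0 T by (simp add: I_def)
  have I: "I \<le> m * exp (- 1 - c) / 2" using small b(4) b'(4) Jeq unfolding I_def by argo
  have main: "cmod (y n t - z n t) \<le> 2 * \<eta> * exp I + I ^ m / fact m * (2 * exp (c * m))"
    unfolding I_def
  proof (rule approx_solution_comparison[OF y z \<sigma> \<eta> _ _ _ _ _ _ t, where b = "\<lambda>t. b t + b' t"])
    show "continuous_on {0..T} (\<lambda>t. b t + b' t)" by (intro continuous_intros b b')
    show "integral {0..T} (\<lambda>t. b t + b' t) \<le> J" by (simp add: J_def)
    show "(cmod (y n t))\<^sup>2 \<le> b t + b' t" if "\<bar>n\<bar> \<le> int (2 * m)" for n t
      using b(3)[OF that] b'(2)[of t] by (simp add: add_increasing2)
    show "(cmod (z n t))\<^sup>2 \<le> b t + b' t" if "\<bar>n\<bar> \<le> int (2 * m)" for n t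
      using b'(3)[OF that] b(2)[of t] by (simp add: add_increasing)
    show "cmod (y n t - z n t) \<le> 2 * exp (c * m)" if "\<bar>n\<bar> \<le> int (2 * m)" "t \<in> {0..T}" for n t
      using D[OF that] norm_triangle_ineq4[of "y n t" "z n t"] by linarith
  qed (use n in auto)
  have "exp (- 1 - c) \<le> exp 0" using c by (subst exp_le_cancel_iff) simp
  then have "real m * exp (- 1 - c) \<le> real m * 1" by (intro mult_left_mono) auto
  then have "m * exp (- 1 - c) / 2 \<le> m" by simp
  then have 1: "exp I \<le> exp m" using I by simp
  have "real m ^ m / fact m \<le> exp m" by (rule power_div_fact_le_exp) simp
  then have f: "1 / fact m \<le> exp m / real m ^ m"
    using m by (simp add: field_simps)
  have "I ^ m / fact m * exp (c * m) \<le> (m * exp (- 1 - c) / 2) ^ m * (exp m / real m ^ m) * exp (c * m)"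
    using f I I0 power_mono[OF I I0, of m] mult_mono[of "I ^ m" "(m * exp (- 1 - c) / 2) ^ m" "1 / fact m" "exp m / real m ^ m"]
    by (intro mult_right_mono) auto
  also have "\<dots> = (1 / 2) ^ m"
  proof -
    have e: "exp (real m) = exp 1 ^ m" "exp (c * m) = exp c ^ m"
      by (simp_all add: exp_of_nat_mult[symmetric] mult.commute)
    have "(m * exp (- 1 - c) / 2) ^ m * (exp m / real m ^ m) * exp (c * m)
       = ((m * exp (- 1 - c) / 2) * (exp 1 / m) * exp c) ^ m"
      unfolding e using m by (simp add: power_mult_distrib power_divide)
    also have "(m * exp (- 1 - c) / 2) * (exp 1 / m) * exp c = (exp (- 1 - c) * exp 1 * exp c) / 2"
      using m by simp
    also have "exp (- 1 - c) * exp 1 * exp c = 1" by (simp add: exp_add[symmetric])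
    finally show ?thesis .
  qed
  finally have 2: "I ^ m / fact m * exp (c * m) \<le> (1 / 2) ^ m" .
  have 3: "2 * \<eta> * exp I \<le> 2 * \<eta> * exp m" using 1 \<eta> by (intro mult_left_mono) auto
  have 4: "I ^ m / fact m * (2 * exp (c * m)) \<le> 2 * (1 / 2) ^ m"
    using mult_left_mono[OF 2, of 2] by (simp only: mult_ac)
  show ?thesis by (rule order_trans[OF main add_mono[OF 3 4]])
qed

section \<open>Uniqueness of good solutions\<close>

lemma AL_solution_iff:
  "AL_solution \<alpha> \<longleftrightarrow> (\<forall>n t. (\<alpha> n has_vector_derivative AL_field (\<alpha> n t) (\<alpha> (n + 1) t + \<alpha> (n - 1) t)) (at t))"
proof -
  have *: "\<i> * v = - (1 + of_real ((cmod z)\<^sup>2)) * w + 2 * z \<longleftrightarrow> v = AL_field z w" for v z w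
  proof -
    have "\<i> * v = - X \<longleftrightarrow> v = \<i> * X" for X by (auto simp: complex_eq_iff)
    from this[of "(1 + of_real ((cmod z)\<^sup>2)) * w - 2 * z"] show ?thesis
      by (simp add: AL_field_def algebra_simps)
  qed
  show ?thesis
    unfolding AL_solution_def *
    by (metis differentiableI_vector vector_derivative_at vector_derivative_works)
qed

lemma AL_solution_continuous: "AL_solution \<alpha> \<Longrightarrow> continuous_on S (\<alpha> n)"
  unfolding AL_solution_iff by (meson has_vector_derivative_continuous continuous_at_imp_continuous_on)

text \<open>An exact solution has defect 0 on every box and in both time directions, so uniqueness
  and convergence rest on the same comparison.\<close>

lemma AL_solution_approx:
  assumes "AL_solution \<alpha>"
  shows "approx_solution \<sigma> T M 0 (\<lambda>n. \<alpha> n 0) (\<lambda>n t. \<alpha> n (\<sigma> * t))"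
proof -
  let ?F = "\<lambda>n t. AL_field (\<alpha> n t) (\<alpha> (n + 1) t + \<alpha> (n - 1) t)"
  have d: "(\<alpha> n has_vector_derivative ?F n t) (at t)" for n t
    using assms by (auto simp: AL_solution_iff)
  have "\<alpha> n (\<sigma> * t) - \<alpha> n 0 - of_real \<sigma> * integral {0..t} (\<lambda>s. ?F n (\<sigma> * s)) = 0" if "t \<in> {0..T}" for n t
  proof -
    have "((\<lambda>s. of_real \<sigma> * ?F n (\<sigma> * s)) has_integral (\<alpha> n (\<sigma> * t) - \<alpha> n (\<sigma> * 0))) {0..t}"
    proof (rule fundamental_theorem_of_calculus)
      fix s
      have "((\<lambda>s. \<sigma> * s) has_vector_derivative \<sigma>) (at s within {0..t})"
        by (auto intro!: derivative_eq_intros)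
      from vector_diff_chain_within[OF this has_vector_derivative_at_within[OF d[of n "\<sigma> * s"]]]
      show "((\<lambda>s. \<alpha> n (\<sigma> * s)) has_vector_derivative of_real \<sigma> * ?F n (\<sigma> * s)) (at s within {0..t})"
        by (simp add: o_def scaleR_conv_of_real)
    qed (use that in auto)
    from integral_unique[OF this] show ?thesis by simp
  qed
  moreover have "continuous_on {0..T} (\<lambda>t. \<alpha> n (\<sigma> * t))" for n
    by (intro continuous_on_compose2[OF AL_solution_continuous[OF assms, of UNIV n]] continuous_intros) auto
  ultimately show ?thesis by (auto simp: approx_solution_def)
qed

lemma set_nn_integral_continuous:
  fixes f :: "real \<Rightarrow> real"
  assumes f: "continuous_on {a..b} f" "\<And>t. t \<in> {a..b} \<Longrightarrow> f t \<ge> 0"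
  shows "(\<integral>\<^sup>+t\<in>{a..b}. ennreal (f t) \<partial>lborel) = ennreal (integral {a..b} f)"
proof -
  let ?g = "\<lambda>t. if t \<in> {a..b} then f t else 0"
  have "(f has_integral integral {a..b} f) {a..b}"
    using f(1) by (intro integrable_integral integrable_continuous_real)
  then have "(?g has_integral integral {a..b} f) UNIV" by (simp only: has_integral_restrict_UNIV)
  moreover have "?g \<in> borel_measurable borel"
    using f(1) by (intro borel_measurable_continuous_on_if) auto
  ultimately have "(\<integral>\<^sup>+t. ennreal (?g t) \<partial>lborel) = ennreal (integral {a..b} f)"
    using f(2) by (intro nn_integral_has_integral_lborel) auto
  moreover have "(\<integral>\<^sup>+t\<in>{a..b}. ennreal (f t) \<partial>lborel) = (\<integral>\<^sup>+t. ennreal (?g t) \<partial>lborel)"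
    by (intro nn_integral_cong) (auto simp: indicator_def)
  ultimately show ?thesis by simp
qed

text \<open>Exhausting the lattice by boxes connects the infinite sums in good solutions with the
  finite sums \<open>mass\<close> and opens the way to monotone convergence.\<close>

lemma infsum_ennreal_box:
  fixes f :: "int \<Rightarrow> ennreal"
  shows "infsum f UNIV = (SUP N. \<Sum>n\<in>box_sites N. f n)"
proof -
  have "infsum f UNIV = (SUP F\<in>{F. finite F \<and> F \<subseteq> UNIV}. sum f F)"
    by (rule nonneg_infsum_complete) auto
  also have "\<dots> = (SUP N. \<Sum>n\<in>box_sites N. f n)"
  proof (rule antisym)
    show "(SUP F\<in>{F. finite F \<and> F \<subseteq> UNIV}. sum f F) \<le> (SUP N. \<Sum>n\<in>box_sites N. f n)"
    proof (rule SUP_least)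
      fix F :: "int set" assume "F \<in> {F. finite F \<and> F \<subseteq> UNIV}"
      then have F: "finite F" by simp
      obtain N where N: "F \<subseteq> box_sites N"
      proof
        show "F \<subseteq> box_sites (nat (Max (abs ` F)))"
        proof
          fix n assume "n \<in> F"
          then have "\<bar>n\<bar> \<le> Max (abs ` F)" using F by simp
          then show "n \<in> box_sites (nat (Max (abs ` F)))" by (auto simp: box_sites_def)
        qed
      qed
      then have "sum f F \<le> (\<Sum>n\<in>box_sites N. f n)" by (intro sum_mono2) auto
      also have "\<dots> \<le> (SUP N. \<Sum>n\<in>box_sites N. f n)" by (rule SUP_upper) simp
      finally show "sum f F \<le> (SUP N. \<Sum>n\<in>box_sites N. f n)" .
    qed
    show "(SUP N. \<Sum>n\<in>box_sites N. f n) \<le> (SUP F\<in>{F. finite F \<and> F \<subseteq> UNIV}. sum f F)"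
      by (intro SUP_least SUP_upper) auto
  qed
  finally show ?thesis .
qed

lemma mass_nonneg: "mass p q M x \<ge> 0"
  unfolding mass_def by (intro sum_nonneg) auto

lemma continuous_on_mass:
  assumes "p > 0" "\<And>n. \<bar>n\<bar> \<le> int M \<Longrightarrow> continuous_on S (y n)"
  shows "continuous_on S (\<lambda>t. mass p q M (\<lambda>n. y n t))"
  unfolding mass_def using assms
  by (intro continuous_on_sum continuous_on_mult continuous_on_const continuous_on_powr' continuous_on_norm)
     (auto simp: box_sites_def)

lemma mass_le_infsum:
  "ennreal (mass p q M x) \<le> (\<Sum>\<^sub>\<infinity>n. ennreal (japanese_bracket n powr (- q) * cmod (x n) powr (2 * p)))"
proof -
  have "ennreal (mass p q M x) = (\<Sum>n\<in>box_sites M. ennreal (japanese_bracket n powr (- q) * cmod (x n) powr (2 * p)))"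
    unfolding mass_def by (rule sum_ennreal[symmetric]) auto
  also have "\<dots> \<le> (\<Sum>\<^sub>\<infinity>n. ennreal (japanese_bracket n powr (- q) * cmod (x n) powr (2 * p)))"
    unfolding infsum_ennreal_box by (rule SUP_upper) simp
  finally show ?thesis .
qed

lemma set_nn_integral_reflect:
  fixes f :: "real \<Rightarrow> ennreal"
  assumes [measurable]: "f \<in> borel_measurable borel"
  shows "(\<integral>\<^sup>+t\<in>{0..T}. f (- t) \<partial>lborel) = (\<integral>\<^sup>+t\<in>{-T..0}. f t \<partial>lborel)"
proof -
  have "(\<integral>\<^sup>+t\<in>{-T..0}. f t \<partial>lborel) = (\<integral>\<^sup>+t. f (0 + (- 1) * t) * indicator {-T..0} (0 + (- 1) * t) \<partial>lborel)"
    by (subst nn_integral_real_affine[where c = "-1" and t = 0]) auto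
  also have "\<dots> = (\<integral>\<^sup>+t\<in>{0..T}. f (- t) \<partial>lborel)"
    by (intro nn_integral_cong) (auto simp: indicator_def)
  finally show ?thesis by simp
qed

lemma good_solution_mass:
  assumes sol: "AL_solution \<alpha>" and pq: "p > 0" and T: "T > 0"
    and fin: "(\<integral>\<^sup>+t\<in>{-T..T}. (\<Sum>\<^sub>\<infinity>n. ennreal (japanese_bracket n powr (- q) * cmod (\<alpha> n t) powr (2 * p))) \<partial>lborel) < \<infinity>"
  obtains H where "H > 0" "\<And>M \<sigma>. \<sigma> \<in> {1, -1} \<Longrightarrow> integral {0..T} (\<lambda>t. mass p q M (\<lambda>n. \<alpha> n (\<sigma> * t))) \<le> H"
proof -
  define I where "I = (\<integral>\<^sup>+t\<in>{-T..T}. (\<Sum>\<^sub>\<infinity>n. ennreal (japanese_bracket n powr (- q) * cmod (\<alpha> n t) powr (2 * p))) \<partial>lborel)"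
  have c: "continuous_on S (\<lambda>t. mass p q M (\<lambda>n. \<alpha> n t))" for S M
    by (intro continuous_on_mass pq AL_solution_continuous[OF sol])
  have [measurable]: "(\<lambda>t. mass p q M (\<lambda>n. \<alpha> n t)) \<in> borel_measurable borel" for M
    by (intro borel_measurable_continuous_onI c)
  show ?thesis
  \<comment> \<open>Adding 1 keeps the bound strictly positive even when the integral
    vanishes.\<close>
  proof (rule that[of "enn2real I + 1"])
    show "enn2real I + 1 > 0" by (simp add: add_nonneg_pos)
    fix M \<sigma> assume \<sigma>: "\<sigma> \<in> {1, -1 :: real}"
    have "ennreal (integral {0..T} (\<lambda>t. mass p q M (\<lambda>n. \<alpha> n (\<sigma> * t)))) = (\<integral>\<^sup>+t\<in>{0..T}. ennreal (mass p q M (\<lambda>n. \<alpha> n (\<sigma> * t))) \<partial>lborel)"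
    proof (rule set_nn_integral_continuous[symmetric])
      show "continuous_on {0..T} (\<lambda>t. mass p q M (\<lambda>n. \<alpha> n (\<sigma> * t)))"
        by (rule continuous_on_compose2[OF c[of UNIV]]) (auto intro!: continuous_intros)
    qed (rule mass_nonneg)
    also have "\<dots> \<le> I"
    proof -
      have "(\<integral>\<^sup>+t\<in>{0..T}. ennreal (mass p q M (\<lambda>n. \<alpha> n (\<sigma> * t))) \<partial>lborel) \<le> (\<integral>\<^sup>+t\<in>{-T..T}. ennreal (mass p q M (\<lambda>n. \<alpha> n t)) \<partial>lborel)"
      proof (cases "\<sigma> = 1")
        case True
        then show ?thesis by (auto intro!: nn_integral_mono simp: indicator_def)
      next
        case False
        then have "\<sigma> = -1" using \<sigma> by auto
        then have "(\<integral>\<^sup>+t\<in>{0..T}. ennreal (mass p q M (\<lambda>n. \<alpha> n (\<sigma> * t))) \<partial>lborel) = (\<integral>\<^sup>+t\<in>{-T..0}. ennreal (mass p q M (\<lambda>n. \<alpha> n t)) \<partial>lborel)"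
          using set_nn_integral_reflect[of "\<lambda>t. ennreal (mass p q M (\<lambda>n. \<alpha> n t))" T] by simp
        also have "\<dots> \<le> (\<integral>\<^sup>+t\<in>{-T..T}. ennreal (mass p q M (\<lambda>n. \<alpha> n t)) \<partial>lborel)"
          using T by (auto intro!: nn_integral_mono simp: indicator_def)
        finally show ?thesis .
      qed
      also have "\<dots> \<le> I"
        unfolding I_def by (intro nn_integral_mono mult_right_mono mass_le_infsum) auto
      finally show ?thesis .
    qed
    also have "I = ennreal (enn2real I)" using fin by (simp add: I_def)
    finally show "integral {0..T} (\<lambda>t. mass p q M (\<lambda>n. \<alpha> n (\<sigma> * t))) \<le> enn2real I + 1"
      by (simp add: ennreal_le_iff)
  qed
qed

lemma good_solution_growth:
  fixes \<alpha> :: "int \<Rightarrow> real \<Rightarrow> complex"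
  assumes c: "c > 0"
    and fin: "(SUP t\<in>{-T..T}. (\<Sum>\<^sub>\<infinity>n. ennreal (exp (- c * japanese_bracket n) * (cmod (\<alpha> n t))\<^sup>2))) < \<infinity>"
  obtains C where "C > 0" "\<And>n t. \<bar>t\<bar> \<le> T \<Longrightarrow> (cmod (\<alpha> n t))\<^sup>2 \<le> C * exp (c * japanese_bracket n)"
proof -
  define I where "I = (SUP t\<in>{-T..T}. (\<Sum>\<^sub>\<infinity>n. ennreal (exp (- c * japanese_bracket n) * (cmod (\<alpha> n t))\<^sup>2)))"
  show ?thesis
  proof (rule that[of "enn2real I + 1"])
    show "enn2real I + 1 > 0" by (simp add: add_nonneg_pos)
    fix n t assume t: "\<bar>t\<bar> \<le> T"
    have "ennreal (exp (- c * japanese_bracket n) * (cmod (\<alpha> n t))\<^sup>2)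
      \<le> (\<Sum>k\<in>box_sites (nat \<bar>n\<bar>). ennreal (exp (- c * japanese_bracket k) * (cmod (\<alpha> k t))\<^sup>2))"
      by (rule member_le_sum) (auto simp: box_sites_def)
    also have "\<dots> \<le> (\<Sum>\<^sub>\<infinity>n. ennreal (exp (- c * japanese_bracket n) * (cmod (\<alpha> n t))\<^sup>2))"
      unfolding infsum_ennreal_box by (rule SUP_upper) simp
    also have "\<dots> \<le> I" unfolding I_def using t by (intro SUP_upper) auto
    also have "I = ennreal (enn2real I)" using fin by (simp add: I_def)
    finally have "exp (- c * japanese_bracket n) * (cmod (\<alpha> n t))\<^sup>2 \<le> enn2real I" by (simp add: ennreal_le_iff)
    then have "exp (- c * japanese_bracket n) * (cmod (\<alpha> n t))\<^sup>2 \<le> enn2real I + 1" by simp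
    then show "(cmod (\<alpha> n t))\<^sup>2 \<le> (enn2real I + 1) * exp (c * japanese_bracket n)"
      by (simp add: exp_minus field_simps)
  qed
qed

lemma japanese_bracket_le: "japanese_bracket n \<le> 1 + real_of_int \<bar>n\<bar>"
proof -
  have "japanese_bracket n \<le> sqrt ((1 + real_of_int \<bar>n\<bar>)\<^sup>2)"
    unfolding japanese_bracket_def by (intro real_sqrt_le_mono) (auto simp: power2_eq_square algebra_simps)
  then show ?thesis by simp
qed

text \<open>As the bracket at 2 m is at most 3 m, the left side is of order m^((q + r) / p + s) with
  an exponent below 1. The parameter \<open>r\<close> allows a mass bound that grows with the box
  and \<open>s\<close> a growing time horizon; uniqueness takes both to be 0.\<close>

lemma eventually_sublinear:
  fixes p q r s C \<delta> :: real
  assumes p: "p > 0" and q: "q > 0" and r: "r \<ge> 0" and lt: "(q + r) / p + s < 1" and C: "C > 0" and \<delta>: "\<delta> > 0"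
  shows "\<forall>\<^sub>F m :: nat in sequentially. (japanese_bracket (int (2 * m)) powr q * (C * m powr r)) powr (1 / p) * m powr s \<le> \<delta> * m"
proof -
  define a where "a = 1 - ((q + r) / p + s)"
  define B where "B = (3 powr q * C) powr (1 / p)"
  have "((\<lambda>m::nat. B * real m powr (- a)) \<longlonglongrightarrow> B * 0)"
    using lt by (intro tendsto_mult tendsto_const tendsto_neg_powr filterlim_real_sequentially) (simp add: a_def)
  then have "\<forall>\<^sub>F m :: nat in sequentially. B * real m powr (- a) < \<delta>"
    using \<delta> by (intro order_tendstoD(2)) auto
  then show ?thesis
    using eventually_gt_at_top[of 0]
  proof eventually_elim
    case (elim m)
    have jb: "japanese_bracket (int (2 * m)) \<le> 3 * real m" "japanese_bracket (int (2 * m)) > 0"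
      using japanese_bracket_le[of "int (2 * m)"] japanese_bracket_ge_1[of "int (2 * m)"] elim(2) by auto
    have "(japanese_bracket (int (2 * m)) powr q * (C * m powr r)) powr (1 / p) * m powr s
       \<le> ((3 * real m) powr q * (C * m powr r)) powr (1 / p) * m powr s"
      using jb C p q by (intro mult_right_mono powr_mono2) auto
    also have "(3 * real m) powr q * (C * m powr r) = (3 powr q * C) * m powr (q + r)"
      using elim(2) by (simp add: powr_mult powr_add mult_ac)
    also have "((3 powr q * C) * m powr (q + r)) powr (1 / p) * m powr s = B * (m powr ((q + r) / p) * m powr s)"
      using C by (simp add: powr_mult powr_powr B_def)
    also have "m powr ((q + r) / p) * m powr s = m powr (- a) * m"
    proof -
      have "m powr (- a) * real m = m powr (- a) * m powr 1" using elim(2) by simp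
      also have "\<dots> = m powr (- a + 1)" by (simp only: powr_add)
      also have "- a + 1 = (q + r) / p + s" by (simp add: a_def)
      finally show ?thesis by (simp add: powr_add)
    qed
    also have "B * (m powr (- a) * m) \<le> \<delta> * m"
      using elim(1) mult_right_mono[of "B * m powr (- a)" \<delta> "real m"] by simp
    finally show ?case .
  qed
qed

text \<open>On every box both are approximate solutions with defect 0, so their difference at a
  fixed site and time is at most 2 * 2^(-m) for all large m. Their exponents and growth rates may be
  different.\<close>

lemma good_solution_unique:
  assumes \<alpha>: "good_solution_from a \<alpha>" and \<gamma>: "good_solution_from a \<gamma>"
  shows "\<alpha> = \<gamma>"
proof (intro ext)
  fix n t
  have sol: "AL_solution \<alpha>" "AL_solution \<gamma>" and init: "\<And>n. \<alpha> n 0 = a n" "\<And>n. \<gamma> n 0 = a n"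
    using assms by (auto simp: good_solution_from_def good_solution_def)
  obtain \<sigma> where \<sigma>: "\<sigma> \<in> {1, -1 :: real}" "t = \<sigma> * \<bar>t\<bar>"
    by (cases "t \<ge> 0") (use that[of 1] that[of "-1"] in auto)
  define T where "T = \<bar>t\<bar> + 1"
  have T: "T > 0" by (simp add: T_def)
  obtain p q where pq: "p > q" "q > 1"
    "(\<integral>\<^sup>+t\<in>{-T..T}. (\<Sum>\<^sub>\<infinity>n. ennreal (japanese_bracket n powr (- q) * cmod (\<alpha> n t) powr (2 * p))) \<partial>lborel) < \<infinity>"
    using \<alpha> T unfolding good_solution_from_def good_solution_def by blast
  obtain p' q' where pq': "p' > q'" "q' > 1"
    "(\<integral>\<^sup>+t\<in>{-T..T}. (\<Sum>\<^sub>\<infinity>n. ennreal (japanese_bracket n powr (- q') * cmod (\<gamma> n t) powr (2 * p'))) \<partial>lborel) < \<infinity>"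
    using \<gamma> T unfolding good_solution_from_def good_solution_def by blast
  obtain c1 where c1: "c1 > 0" "(SUP t\<in>{-T..T}. (\<Sum>\<^sub>\<infinity>n. ennreal (exp (- c1 * japanese_bracket n) * (cmod (\<alpha> n t))\<^sup>2))) < \<infinity>"
    using \<alpha> T unfolding good_solution_from_def good_solution_def by blast
  obtain c2 where c2: "c2 > 0" "(SUP t\<in>{-T..T}. (\<Sum>\<^sub>\<infinity>n. ennreal (exp (- c2 * japanese_bracket n) * (cmod (\<gamma> n t))\<^sup>2))) < \<infinity>"
    using \<gamma> T unfolding good_solution_from_def good_solution_def by blast
  have p0: "p > 0" "p' > 0" using pq pq' by auto
  obtain H where H: "H > 0" "\<And>M \<sigma>. \<sigma> \<in> {1, -1} \<Longrightarrow> integral {0..T} (\<lambda>t. mass p q M (\<lambda>n. \<alpha> n (\<sigma> * t))) \<le> H"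
    by (rule good_solution_mass[OF sol(1) p0(1) T pq(3)]) blast
  obtain H' where H': "H' > 0" "\<And>M \<sigma>. \<sigma> \<in> {1, -1} \<Longrightarrow> integral {0..T} (\<lambda>t. mass p' q' M (\<lambda>n. \<gamma> n (\<sigma> * t))) \<le> H'"
    by (rule good_solution_mass[OF sol(2) p0(2) T pq'(3)]) blast
  obtain C1 where C1: "C1 > 0" "\<And>n t. \<bar>t\<bar> \<le> T \<Longrightarrow> (cmod (\<alpha> n t))\<^sup>2 \<le> C1 * exp (c1 * japanese_bracket n)"
    by (rule good_solution_growth[OF c1]) blast
  obtain C2 where C2: "C2 > 0" "\<And>n t. \<bar>t\<bar> \<le> T \<Longrightarrow> (cmod (\<gamma> n t))\<^sup>2 \<le> C2 * exp (c2 * japanese_bracket n)"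
    by (rule good_solution_growth[OF c2]) blast
  \<comment> \<open>The additional 1 lets exp (c m) absorb the constants \<open>C1\<close> and
    \<open>C2\<close> once m is large.\<close>
  define c where "c = max c1 c2 + 1"
  \<comment> \<open>For large m the quantity to be bounded is at most 16 \<delta> m (T + 1), that is
    16/40 of m exp (-1 - c), which is less than half of it.\<close>
  define \<delta> where "\<delta> = exp (- 1 - c) / (40 * (T + 1))"
  have \<delta>: "\<delta> > 0" using T by (simp add: \<delta>_def)
  have ev1: "\<forall>\<^sub>F m :: nat in sequentially. (japanese_bracket (int (2 * m)) powr q * (H * m powr 0)) powr (1 / p) * m powr 0 \<le> \<delta> * m"
    using pq p0 H \<delta> by (intro eventually_sublinear) auto
  have ev2: "\<forall>\<^sub>F m :: nat in sequentially. (japanese_bracket (int (2 * m)) powr q' * (H' * m powr 0)) powr (1 / p') * m powr 0 \<le> \<delta> * m"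
    using pq' p0 H' \<delta> by (intro eventually_sublinear) auto
  have ev3: "\<forall>\<^sub>F m :: nat in sequentially. X \<le> real m" for X
    using filterlim_real_sequentially by (simp add: filterlim_at_top)
  have "\<forall>\<^sub>F m :: nat in sequentially. cmod (\<alpha> n t - \<gamma> n t) \<le> 2 * (1 / 2) ^ m"
    using ev1 ev2 ev3[of "1 / \<delta>"] ev3[of "\<bar>n\<bar>"] ev3[of "ln C1 + c1"] ev3[of "ln C2 + c2"] eventually_gt_at_top[of 0]
  proof eventually_elim
    case (elim m)
    have growth: "cmod z \<le> exp (c * m)" if "(cmod z)\<^sup>2 \<le> C * exp (c' * japanese_bracket k)" "\<bar>k\<bar> \<le> int (2 * m)"
      "C > 0" "c' > 0" "c' \<le> c - 1" "ln C + c' \<le> m" for z C c' k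
    proof -
      have "c' * japanese_bracket k \<le> c' * (1 + 2 * m)"
        using that japanese_bracket_le[of k] by (intro mult_left_mono) auto
      then have "C * exp (c' * japanese_bracket k) \<le> C * exp (c' * (1 + 2 * m))"
        using that by (intro mult_left_mono) auto
      also have "\<dots> = exp (ln C + c' + 2 * (c' * m))" using that by (simp add: exp_add algebra_simps)
      also have "\<dots> \<le> exp (2 * (c * m))"
      proof -
        have "c' * m \<le> (c - 1) * m" using that by (intro mult_right_mono) auto
        then show ?thesis using that by (simp add: algebra_simps)
      qed
      also have "\<dots> = (exp (c * m))\<^sup>2" by (simp add: power2_eq_square exp_add[symmetric])
      finally have "C * exp (c' * japanese_bracket k) \<le> (exp (c * m))\<^sup>2" .
      from order_trans[OF that(1) this] show ?thesis by (rule power2_le_imp_le) simp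
    qed
    have app: "approx_solution \<sigma> T (2 * m) 0 a (\<lambda>n t. \<alpha> n (\<sigma> * t))" "approx_solution \<sigma> T (2 * m) 0 a (\<lambda>n t. \<gamma> n (\<sigma> * t))"
      using AL_solution_approx[OF sol(1), of \<sigma> T "2 * m"] AL_solution_approx[OF sol(2), of \<sigma> T "2 * m"] init by simp_all
    have "cmod (\<alpha> n (\<sigma> * \<bar>t\<bar>) - \<gamma> n (\<sigma> * \<bar>t\<bar>)) \<le> 2 * 0 * exp m + 2 * (1 / 2) ^ m"
    proof (rule box_comparison[OF app, where c = c and H = H and H' = H' and p = p and q = q and p' = p' and q' = q'])
      fix k s assume k: "\<bar>k\<bar> \<le> int (2 * m)" and s: "s \<in> {0..T}"
      have "\<bar>\<sigma> * s\<bar> \<le> T" using \<sigma>(1) s by (auto simp: abs_mult)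
      note st = this
      have "c1 \<le> c - 1" "c2 \<le> c - 1" by (simp_all add: c_def)
      then show "cmod (\<alpha> k (\<sigma> * s)) \<le> exp (c * m) \<and> cmod (\<gamma> k (\<sigma> * s)) \<le> exp (c * m)"
        using growth[OF C1(2)[OF st] k C1(1) c1(1) _ elim(5)] growth[OF C2(2)[OF st] k C2(1) c2(1) _ elim(6)] by blast
    next
      let ?E = "exp (- 1 - c)"
      have A: "(japanese_bracket (int (2 * m)) powr q * H) powr (1 / p) \<le> \<delta> * m"
        "(japanese_bracket (int (2 * m)) powr q' * H') powr (1 / p') \<le> \<delta> * m"
        using elim by simp_all
      have B: "(japanese_bracket (int (2 * m)) powr q * H) powr (1 / p) * (T + 1) \<le> \<delta> * m * (T + 1)"
        "(japanese_bracket (int (2 * m)) powr q' * H') powr (1 / p') * (T + 1) \<le> \<delta> * m * (T + 1)"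
        using A T by (auto intro!: mult_right_mono)
      have "1 \<le> \<delta> * m" using elim(3) \<delta> by (simp add: field_simps)
      then have "T + 1 \<le> \<delta> * m * (T + 1)" using T mult_right_mono[of 1 "\<delta> * m" "T + 1"] by simp
      moreover have "\<delta> * m * (T + 1) = m * ?E / 40" using T by (simp add: \<delta>_def field_simps)
      moreover have "0 \<le> m * ?E" by simp
      ultimately show "4 * T + 6 * ((japanese_bracket (int (2 * m)) powr q * H) powr (1 / p) * (T + 1)
        + (japanese_bracket (int (2 * m)) powr q' * H') powr (1 / p') * (T + 1)) \<le> m * ?E / 2"
        using B by argo
    next
      show "integral {0..T} (\<lambda>t. mass p q (2 * m) (\<lambda>n. \<alpha> n (\<sigma> * t))) \<le> H" by (rule H(2)[OF \<sigma>(1)])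
      show "integral {0..T} (\<lambda>t. mass p' q' (2 * m) (\<lambda>n. \<gamma> n (\<sigma> * t))) \<le> H'" by (rule H'(2)[OF \<sigma>(1)])
      show "\<bar>\<sigma>\<bar> = 1" using \<sigma>(1) by auto
      show "\<bar>n\<bar> \<le> int m" using elim(4) by linarith
      show "0 \<le> c" using c1(1) by (simp add: c_def)
    qed (use pq(1,2) pq'(1,2) H(1) H'(1) elim(7) in \<open>auto simp: T_def\<close>)
    then show ?case using \<sigma>(2) by simp
  qed
  moreover have "(\<lambda>m::nat. 2 * (1 / 2) ^ m) \<longlonglongrightarrow> (2 * 0 :: real)"
    by (intro tendsto_intros LIMSEQ_realpow_zero) auto
  ultimately have "cmod (\<alpha> n t - \<gamma> n t) \<le> 0"
    by (intro tendsto_le[OF _ _ tendsto_const[of "cmod (\<alpha> n t - \<gamma> n t)"]]) auto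
  then show "\<alpha> n t = \<gamma> n t" by simp
qed

section \<open>Moment estimates for white noise\<close>

lemma sum_box_sites:
  fixes f :: "int \<Rightarrow> 'a :: comm_monoid_add"
  shows "(\<Sum>n\<in>box_sites M. f n) = f 0 + (\<Sum>k<M. f (int (Suc k)) + f (- int (Suc k)))"
proof (induction M)
  case 0
  have "box_sites 0 = {0}" by (auto simp: box_sites_def)
  then show ?case by simp
next
  case (Suc M)
  have "box_sites (Suc M) = insert (int (Suc M)) (insert (- int (Suc M)) (box_sites M))"
    by (auto simp: box_sites_def)
  moreover have "int (Suc M) \<notin> insert (- int (Suc M)) (box_sites M)" "- int (Suc M) \<notin> box_sites M"
    by (auto simp: box_sites_def)
  ultimately have "(\<Sum>n\<in>box_sites (Suc M). f n) = f (int (Suc M)) + (f (- int (Suc M)) + (\<Sum>n\<in>box_sites M. f n))"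
    by (simp del: of_nat_Suc)
  then show ?case using Suc by (simp add: add_ac del: of_nat_Suc)
qed

lemma sum_box_sites_bounded:
  fixes g :: "nat \<Rightarrow> real"
  assumes "summable g" "\<And>k. 0 \<le> g k" "\<And>n. f n \<le> g (nat \<bar>n\<bar>)"
  shows "(\<Sum>n\<in>box_sites M. f n) \<le> g 0 + 2 * suminf g"
proof -
  have "(\<Sum>n\<in>box_sites M. f n) \<le> (\<Sum>n\<in>box_sites M. g (nat \<bar>n\<bar>))"
    by (intro sum_mono assms)
  also have "\<dots> = g 0 + 2 * (\<Sum>k<M. g (Suc k))"
    unfolding sum_box_sites by (simp add: sum_distrib_left nat_add_distrib)
  also have "(\<Sum>k<M. g (Suc k)) \<le> (\<Sum>k<Suc M. g k)"
    unfolding sum.lessThan_Suc_shift using assms(2)[of 0] by simp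
  also have "(\<Sum>k<Suc M. g k) \<le> suminf g"
    using assms by (intro sum_le_suminf) auto
  finally show ?thesis by simp
qed

lemma sum_japanese_bracket_bounded:
  assumes "q > 1"
  obtains C where "C > 0" "\<And>M. (\<Sum>n\<in>box_sites M. japanese_bracket n powr (- q)) \<le> C"
proof -
  \<comment> \<open>The value at 0 is set by hand, since \<open>0 powr (- q)\<close> is 0 and would
    not dominate the bracket, which is 1 there.\<close>
  define g where "g = (\<lambda>k::nat. if k = 0 then 1 else real k powr (- q))"
  have g: "summable g"
  proof -
    have "summable (\<lambda>k::nat. real k powr (- q))" using assms by (subst summable_real_powr_iff) simp
    then show ?thesis
      by (rule summable_cong[THEN iffD1, rotated]) (auto simp: g_def eventually_sequentially intro!: exI[of _ 1])
  qed
  have g0: "g k \<ge> 0" for k by (simp add: g_def)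
  have le: "japanese_bracket n powr (- q) \<le> g (nat \<bar>n\<bar>)" for n
  proof (cases "n = 0")
    case True
    then show ?thesis by (simp add: g_def japanese_bracket_def)
  next
    case False
    have "real_of_int \<bar>n\<bar> \<le> japanese_bracket n"
      unfolding japanese_bracket_def by (rule real_le_rsqrt) simp
    then have "japanese_bracket n powr (- q) \<le> real_of_int \<bar>n\<bar> powr (- q)"
      using False assms by (intro powr_mono2') auto
    then show ?thesis using False by (simp add: g_def)
  qed
  show ?thesis
  proof (rule that)
    show "(\<Sum>n\<in>box_sites M. japanese_bracket n powr (- q)) \<le> g 0 + 2 * suminf g" for M
      by (rule sum_box_sites_bounded[OF g g0 le])
    show "g 0 + 2 * suminf g > 0" using suminf_nonneg[OF g] g0 by (auto simp: g_def add_pos_nonneg)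
  qed
qed

lemma nn_integral_white_noise_prod:
  assumes \<beta>: "\<beta> > 0" and g [measurable]: "g \<in> borel_measurable borel" and "finite F"
  shows "(\<integral>\<^sup>+x. (\<Prod>n\<in>F. g (x n)) \<partial>white_noise \<beta>) = (\<integral>\<^sup>+z. g z \<partial>site_law \<beta>) ^ card F"
  using \<open>finite F\<close>
proof induction
  case empty
  then show ?case
    using prob_space.emeasure_space_1[OF prob_space_white_noise[OF \<beta>]] by simp
next
  case (insert n F)
  let ?P = "\<Pi>\<^sub>M k\<in>UNIV - {n}. site_law \<beta>" and ?A = "\<integral>\<^sup>+z. g z \<partial>site_law \<beta>"
  interpret s: prob_space "site_law \<beta>" by (rule prob_space_site_law) fact
  have upd: "(\<Prod>k\<in>F. g ((X(n := z)) k)) = (\<Prod>k\<in>F. g (X k))" for X z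
    using insert by (intro prod.cong) auto
  have G: "(\<integral>\<^sup>+x. (\<Prod>k\<in>F. g (x k)) \<partial>white_noise \<beta>) = (\<integral>\<^sup>+X. (\<Prod>k\<in>F. g (X k)) \<partial>?P)"
  proof -
    have "(\<integral>\<^sup>+x. (\<Prod>k\<in>F. g (x k)) \<partial>white_noise \<beta>) = (\<integral>\<^sup>+X. \<integral>\<^sup>+z. (\<Prod>k\<in>F. g ((X(n := z)) k)) \<partial>site_law \<beta> \<partial>?P)"
      by (rule nn_integral_white_noise_update(1)[OF \<beta>]) measurable
    then show ?thesis using s.emeasure_space_1 by (simp only: upd nn_integral_const mult_1_right)
  qed
  have m: "(\<lambda>X. \<Prod>k\<in>F. g (X k)) \<in> borel_measurable ?P"
  proof (rule borel_measurable_prod_ennreal)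
    fix k assume "k \<in> F"
    then have k: "k \<in> UNIV - {n}" using insert by auto
    have "g \<in> borel_measurable (site_law \<beta>)" by (simp add: measurable_cong_sets[OF sets_site_law refl])
    then show "(\<lambda>X. g (X k)) \<in> borel_measurable ?P"
      by (rule measurable_compose[OF measurable_component_singleton[OF k]])
  qed
  have "(\<integral>\<^sup>+x. (\<Prod>k\<in>insert n F. g (x k)) \<partial>white_noise \<beta>) = (\<integral>\<^sup>+x. g (x n) * (\<Prod>k\<in>F. g (x k)) \<partial>white_noise \<beta>)"
    using insert by simp
  also have "\<dots> = (\<integral>\<^sup>+X. \<integral>\<^sup>+z. g z * (\<Prod>k\<in>F. g (X k)) \<partial>site_law \<beta> \<partial>?P)"
    by (rule trans[OF nn_integral_white_noise_update(1)[OF \<beta>, where n = n]]) (measurable, simp only: upd fun_upd_same)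
  also have "\<dots> = (\<integral>\<^sup>+X. ?A * (\<Prod>k\<in>F. g (X k)) \<partial>?P)"
    by (intro nn_integral_cong nn_integral_multc) (auto simp: measurable_cong_sets[OF sets_site_law refl])
  also have "\<dots> = ?A * (\<integral>\<^sup>+X. (\<Prod>k\<in>F. g (X k)) \<partial>?P)"
    using m by (rule nn_integral_cmult)
  finally show ?case using insert G by simp
qed

text \<open>Exponential Markov inequality: exp of the log energy is a product of 2 N + 1 independent
  factors 1 + |x_n|^2, each of mean (1 + 2 \<beta>) / (2 \<beta>).\<close>

lemma emeasure_log_energy:
  assumes \<beta>: "\<beta> > 0"
  shows "emeasure (white_noise \<beta>) {x. log_energy N x > K} \<le> ennreal (((1 + 2 * \<beta>) / (2 * \<beta>)) ^ (2 * N + 1) * exp (- K))"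
proof -
  let ?g = "\<lambda>z :: complex. ennreal (1 + (cmod z)\<^sup>2)"
  have c: "card (box_sites N) = 2 * N + 1" by (simp add: box_sites_def)
  have e: "ennreal (exp (log_energy N x)) = (\<Prod>n\<in>box_sites N. ?g (x n))" for x
  proof -
    have "exp (log_energy N x) = (\<Prod>n\<in>box_sites N. 1 + (cmod (x n))\<^sup>2)"
      unfolding log_energy_def by (subst exp_sum) (auto intro!: prod.cong simp: add_pos_nonneg)
    then show ?thesis by (simp only: prod_ennreal[symmetric] add_nonneg_nonneg zero_le_one zero_le_power2)
  qed
  have s: "{x\<in>space (white_noise \<beta>). 1 \<le> ennreal (exp (- K)) * ennreal (exp (log_energy N x))} \<in> sets (white_noise \<beta>)"
    by measurable
  have "{x. log_energy N x > K} = {x\<in>space (white_noise \<beta>). 1 \<le> ennreal (exp (- K)) * ennreal (exp (log_energy N x))} - {x\<in>space (white_noise \<beta>). log_energy N x = K}"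
    by (auto simp: ennreal_mult[symmetric] exp_add[symmetric])
  then have "emeasure (white_noise \<beta>) {x. log_energy N x > K}
    \<le> emeasure (white_noise \<beta>) {x\<in>space (white_noise \<beta>). 1 \<le> ennreal (exp (- K)) * ennreal (exp (log_energy N x))}"
    by (intro emeasure_mono s) auto
  also have "\<dots> \<le> ennreal (exp (- K)) * (\<integral>\<^sup>+x. ennreal (exp (log_energy N x)) \<partial>white_noise \<beta>)"
    using nn_integral_Markov_inequality[where A = UNIV and c = "ennreal (exp (- K))" and M = "white_noise \<beta>"
        and u = "\<lambda>x. ennreal (exp (log_energy N x))"] sets.top[of "white_noise \<beta>"] by simp
  also have "(\<integral>\<^sup>+x. ennreal (exp (log_energy N x)) \<partial>white_noise \<beta>) = (\<integral>\<^sup>+z. ?g z \<partial>site_law \<beta>) ^ (2 * N + 1)"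
    unfolding e by (subst nn_integral_white_noise_prod[OF \<beta>]) (auto simp: c)
  also have "(\<integral>\<^sup>+z. ?g z \<partial>site_law \<beta>) = ennreal ((1 + 2 * \<beta>) / (2 * \<beta>))"
  proof -
    have "(\<integral>\<^sup>+z. ?g z \<partial>site_law \<beta>) = (\<integral>\<^sup>+z. ennreal ((1 + (cmod z)\<^sup>2) powr 1) \<partial>site_law \<beta>)"
      by (intro nn_integral_cong) (simp add: add_pos_nonneg)
    then show ?thesis using site_law_moment[OF \<beta>, of 1] \<beta> by simp
  qed
  finally show ?thesis using \<beta> by (simp add: ennreal_power ennreal_mult[symmetric] mult.commute)
qed

text \<open>The condition p < 1 + 2 \<beta> makes the moments finite and q > 1 makes the weights
  summable, so the bound is uniform in the box.\<close>

lemma nn_integral_mass: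
  assumes \<beta>: "\<beta> > 0" and p: "0 < p" "p < 1 + 2 * \<beta>" and q: "q > 1"
  obtains C where "C > 0" "\<And>M. (\<integral>\<^sup>+x. ennreal (mass p q M x) \<partial>white_noise \<beta>) \<le> ennreal C"
proof -
  obtain C where C: "C > 0" "\<And>M. (\<Sum>n\<in>box_sites M. japanese_bracket n powr (- q)) \<le> C"
    using sum_japanese_bracket_bounded[OF q] by blast
  define A where "A = (1 + 2 * \<beta>) / (1 + 2 * \<beta> - p)"
  have A: "A > 0" using \<beta> p by (simp add: A_def)
  have mom: "(\<integral>\<^sup>+x. ennreal (cmod (x n) powr (2 * p)) \<partial>white_noise \<beta>) \<le> ennreal A" for n
  proof -
    have "(\<integral>\<^sup>+x. ennreal (cmod (x n) powr (2 * p)) \<partial>white_noise \<beta>) = (\<integral>\<^sup>+z. ennreal (cmod z powr (2 * p)) \<partial>site_law \<beta>)"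
      by (rule nn_integral_white_noise_component[OF \<beta>]) auto
    also have "\<dots> \<le> (\<integral>\<^sup>+z. ennreal ((1 + (cmod z)\<^sup>2) powr p) \<partial>site_law \<beta>)"
    proof (intro nn_integral_mono ennreal_leI)
      fix z :: complex
      have "cmod z powr (2 * p) = (cmod z powr 2) powr p" by (simp only: powr_powr)
      also have "\<dots> = ((cmod z)\<^sup>2) powr p" by simp
      also have "\<dots> \<le> (1 + (cmod z)\<^sup>2) powr p" using p by (intro powr_mono2) auto
      finally show "cmod z powr (2 * p) \<le> (1 + (cmod z)\<^sup>2) powr p" .
    qed
    also have "\<dots> = ennreal A" unfolding A_def by (rule site_law_moment[OF \<beta> p(2)])
    finally show ?thesis .
  qed
  show ?thesis
  proof (rule that[of "C * A"])
    show "C * A > 0" using C A by simp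
    fix M
    have "(\<integral>\<^sup>+x. ennreal (mass p q M x) \<partial>white_noise \<beta>)
      = (\<integral>\<^sup>+x. (\<Sum>n\<in>box_sites M. ennreal (japanese_bracket n powr (- q)) * ennreal (cmod (x n) powr (2 * p))) \<partial>white_noise \<beta>)"
      unfolding mass_def by (intro nn_integral_cong) (simp add: ennreal_mult sum_ennreal[symmetric])
    also have "\<dots> = (\<Sum>n\<in>box_sites M. ennreal (japanese_bracket n powr (- q)) * (\<integral>\<^sup>+x. ennreal (cmod (x n) powr (2 * p)) \<partial>white_noise \<beta>))"
      by (subst nn_integral_sum) (auto intro!: sum.cong nn_integral_cmult)
    also have "\<dots> \<le> (\<Sum>n\<in>box_sites M. ennreal (japanese_bracket n powr (- q)) * ennreal A)"
      by (intro sum_mono mult_left_mono mom) auto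
    also have "\<dots> = ennreal ((\<Sum>n\<in>box_sites M. japanese_bracket n powr (- q)) * A)"
      using A by (simp add: ennreal_mult[symmetric] sum_ennreal sum_distrib_right)
    also have "\<dots> \<le> ennreal (C * A)" using C(2) A by (intro ennreal_leI mult_right_mono) auto
    finally show "(\<integral>\<^sup>+x. ennreal (mass p q M x) \<partial>white_noise \<beta>) \<le> ennreal (C * A)" .
  qed
qed

text \<open>A Borel-Cantelli argument: almost surely the sum is finite, so only finitely many terms
  reach 1. It is applied to indicators and to rescaled integrals of the mass.\<close>

lemma AE_eventually_less_1:
  fixes f :: "nat \<Rightarrow> 'a \<Rightarrow> ennreal"
  assumes [measurable]: "\<And>j. f j \<in> borel_measurable M" and fin: "(\<Sum>j. \<integral>\<^sup>+x. f j x \<partial>M) < \<infinity>"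
  shows "AE x in M. \<forall>\<^sub>F j in sequentially. f j x < 1"
proof -
  have "(\<integral>\<^sup>+x. (\<Sum>j. f j x) \<partial>M) \<noteq> \<infinity>"
    using fin by (subst nn_integral_suminf) auto
  then have "AE x in M. (\<Sum>j. f j x) \<noteq> \<infinity>"
    by (intro nn_integral_noteq_infinite) auto
  then show ?thesis
  proof eventually_elim
    case (elim x)
    show ?case
    proof (rule ccontr)
      assume "\<not> (\<forall>\<^sub>F j in sequentially. f j x < 1)"
      then have inf: "infinite {j. f j x \<ge> 1}"
        by (auto simp: frequently_def[symmetric] not_eventually INFM_iff_infinite[symmetric] cofinite_eq_sequentially not_less)
      have "ennreal (real n) \<le> (\<Sum>j. f j x)" for n
      proof -
        obtain I where I: "finite I" "card I = n" "I \<subseteq> {j. f j x \<ge> 1}"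
          using infinite_arbitrarily_large[OF inf, of n] by blast
        have "ennreal (real n) = (\<Sum>j\<in>I. 1)" using I by (simp add: ennreal_of_nat_eq_real_of_nat)
        also have "\<dots> \<le> (\<Sum>j\<in>I. f j x)" using I by (intro sum_mono) auto
        also have "\<dots> \<le> (\<Sum>j. f j x)" using I by (intro sum_le_suminf) auto
        finally show ?thesis .
      qed
      moreover obtain r where "(\<Sum>j. f j x) = ennreal r" "r \<ge> 0" using elim by (cases "\<Sum>j. f j x") auto
      moreover obtain n :: nat where "r < real n" using reals_Archimedean2 by blast
      ultimately show False by (metis ennreal_less_iff leD)
    qed
  qed
qed

section \<open>Almost sure bounds along the approximation\<close>

lemma measurable_mass [measurable (raw)]:
  assumes [measurable]: "f \<in> M \<rightarrow>\<^sub>M (\<Pi>\<^sub>M n\<in>UNIV. borel)"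
  shows "(\<lambda>x. mass p q N (f x)) \<in> borel_measurable M"
  unfolding mass_def by measurable

lemma mass_mono: "M \<le> M' \<Longrightarrow> mass p q M x \<le> mass p q M' x"
  unfolding mass_def by (intro sum_mono2) (auto simp: box_sites_def)

lemma approx_solution_mono:
  assumes "approx_solution \<sigma> T M \<eta> a y" "T' \<le> T" "M' \<le> M" "\<eta> \<le> \<eta>'"
  shows "approx_solution \<sigma> T' M' \<eta>' a y"
  unfolding approx_solution_def
proof (intro conjI allI impI)
  fix n assume "\<bar>n\<bar> \<le> int M'"
  then have "\<bar>n\<bar> \<le> int M" using assms(3) by linarith
  then have "continuous_on {0..T} (y n)" using assms(1) unfolding approx_solution_def by blast
  then show "continuous_on {0..T'} (y n)" by (rule continuous_on_subset) (use assms(2) in auto)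
next
  fix n t assume "\<bar>n\<bar> < int M'" "t \<in> {0..T'}"
  then have "\<bar>n\<bar> < int M" "t \<in> {0..T}" using assms(2,3) by auto
  then have "cmod (y n t - a n - of_real \<sigma> * integral {0..t} (\<lambda>s. AL_field (y n s) (y (n + 1) s + y (n - 1) s))) \<le> \<eta>"
    using assms(1) unfolding approx_solution_def by blast
  then show "cmod (y n t - a n - of_real \<sigma> * integral {0..t} (\<lambda>s. AL_field (y n s) (y (n + 1) s + y (n - 1) s))) \<le> \<eta>'"
    using assms(4) by linarith
qed

section \<open>The dyadic scheme of approximations\<close>

text \<open>The box at scale j has half-width 2 * 2^j, so that 2^j iterations of the comparison fit
  into it. The defect exp (-2 * 2^j) survives the factor exp (2^j) of that comparison, and the
  horizon j + 1 exhausts all times. In \<open>C0\<close> the factor 5 covers the 4 * 2^j + 1 sites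
  of the box, and the summand 1 leaves high energy a probability of at most exp (-2^j).\<close>

locale AL_scheme =
  fixes \<beta> C0 :: real and h :: "nat \<Rightarrow> real"
  assumes \<beta>: "\<beta> > 0" and C0: "C0 = 5 * ln ((1 + 2 * \<beta>) / (2 * \<beta>)) + 1"
    and faithful: "\<And>j. faithful \<beta> (2 * 2 ^ j) (C0 * 2 ^ j) (real j + 1) (exp (- (2 * 2 ^ j))) (h j)"
begin

definition Y :: "nat \<Rightarrow> real \<Rightarrow> (int \<Rightarrow> complex) \<Rightarrow> int \<Rightarrow> complex" where
  "Y j t x = traj (2 * 2 ^ j) (h j) t x"

definition low :: "nat \<Rightarrow> (int \<Rightarrow> complex) set" where
  "low j = {x. log_energy (2 * 2 ^ j) x \<le> C0 * 2 ^ j}"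

text \<open>The exponents satisfy 1 < q < p < 1 + 2 \<beta>. The small \<open>r\<close> permits a
  slow growth of the mass bound with the scale while (q + r) / p stays below 1.\<close>

abbreviation "p \<equiv> 1 + \<beta>"
abbreviation "q \<equiv> 1 + \<beta> / 2"
abbreviation "r \<equiv> \<beta> / 8"

text \<open>Only the expectation of the mass is under control. Letting the pathwise bound grow like
  2^(j r) makes Markov's estimate summable in j even though the horizon grows.\<close>

definition good :: "nat \<Rightarrow> (int \<Rightarrow> complex) \<Rightarrow> bool" where
  "good j x \<longleftrightarrow> x \<in> low j \<and> (\<forall>\<sigma>\<in>{1, -1}. integral {0..real j + 1} (\<lambda>t. mass p q (2 * 2 ^ j) (Y j (\<sigma> * t) x)) \<le> (2 ^ j) powr r)"

text \<open>Where the sequence diverges \<open>lim\<close> is unspecified, but as a total function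
  this is still jointly measurable in time and configuration.\<close>

definition G :: "real \<Rightarrow> (int \<Rightarrow> complex) \<Rightarrow> int \<Rightarrow> complex" where
  "G t x = (\<lambda>n. lim (\<lambda>j. Y j t x n))"

lemma C0_pos: "C0 > 0"
  using \<beta> by (simp add: C0 add_nonneg_pos)

lemma measurable_Y [measurable (raw)]:
  assumes "f \<in> M \<rightarrow>\<^sub>M (\<Pi>\<^sub>M n\<in>UNIV. borel)" "g \<in> borel_measurable M"
  shows "(\<lambda>x. Y j (g x) (f x)) \<in> M \<rightarrow>\<^sub>M (\<Pi>\<^sub>M n\<in>UNIV. borel)"
  unfolding Y_def by (rule measurable_traj[OF assms])

lemma measurable_G [measurable (raw)]:
  assumes [measurable]: "f \<in> M \<rightarrow>\<^sub>M (\<Pi>\<^sub>M n\<in>UNIV. borel)" "g \<in> borel_measurable M"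
  shows "(\<lambda>x. G (g x) (f x)) \<in> M \<rightarrow>\<^sub>M (\<Pi>\<^sub>M n\<in>UNIV. borel)"
proof (rule measurable_PiM_single')
  fix n :: int
  have "(\<lambda>x. Y j (g x) (f x) n) \<in> borel_measurable M" for j by measurable
  then show "(\<lambda>x. G (g x) (f x) n) \<in> borel_measurable M"
    unfolding G_def by (rule borel_measurable_lim_metric)
qed (simp add: space_PiM)

lemma sets_low [measurable]: "low j \<in> sets (white_noise \<beta>)"
proof -
  have "{x \<in> space (white_noise \<beta>). log_energy (2 * 2 ^ j) x \<le> C0 * 2 ^ j} \<in> sets (white_noise \<beta>)" by measurable
  then show ?thesis by (simp add: low_def)
qed

lemma AE_low: "AE x in white_noise \<beta>. \<forall>\<^sub>F j in sequentially. x \<in> low j"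
proof -
  have "(\<integral>\<^sup>+x. indicator (- low j) x \<partial>white_noise \<beta>) \<le> ennreal ((1 / 2) ^ j)" for j
  proof -
    let ?A = "(1 + 2 * \<beta>) / (2 * \<beta>)"
    have A: "?A \<ge> 1" using \<beta> by simp
    have "(\<integral>\<^sup>+x. indicator (- low j) x \<partial>white_noise \<beta>) = emeasure (white_noise \<beta>) (- low j)"
      using sets.compl_sets[OF sets_low[of j]] by (simp add: Compl_eq_Diff_UNIV)
    also have "\<dots> \<le> ennreal (?A ^ (2 * (2 * 2 ^ j) + 1) * exp (- (C0 * 2 ^ j)))"
    proof -
      have "- low j = {x. log_energy (2 * 2 ^ j) x > C0 * 2 ^ j}" by (auto simp: low_def)
      then show ?thesis using emeasure_log_energy[OF \<beta>, of "C0 * 2 ^ j" "2 * 2 ^ j"] by simp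
    qed
    also have "\<dots> \<le> ennreal ((1 / 2) ^ j)"
    proof (rule ennreal_leI)
      have "(2::nat) * (2 * 2 ^ j) + 1 \<le> 5 * 2 ^ j" by simp
      then have "?A ^ (2 * (2 * 2 ^ j) + 1) \<le> ?A ^ (5 * 2 ^ j)" by (rule power_increasing) (rule A)
      also have "\<dots> = exp (5 * ln ?A * 2 ^ j)"
      proof -
        have "?A ^ (5 * 2 ^ j) = exp (ln ?A) ^ (5 * 2 ^ j)" using A by simp
        also have "\<dots> = exp (real (5 * 2 ^ j) * ln ?A)" by (rule exp_of_nat_mult[symmetric])
        finally show ?thesis by (simp add: mult_ac)
      qed
      finally have "?A ^ (2 * (2 * 2 ^ j) + 1) * exp (- (C0 * 2 ^ j)) \<le> exp (5 * ln ?A * 2 ^ j) * exp (- (C0 * 2 ^ j))"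
        by (rule mult_right_mono) simp
      also have "\<dots> = exp (- (2 ^ j))" unfolding exp_add[symmetric] C0 by (simp add: algebra_simps)
      also have "\<dots> = 1 / exp (2 ^ j)" by (simp add: exp_minus divide_inverse)
      also have "\<dots> \<le> 1 / 2 ^ j"
      proof (rule divide_left_mono)
        show "2 ^ j \<le> exp (2 ^ j :: real)" using exp_ge_add_one_self[of "2 ^ j :: real"] by linarith
      qed auto
      finally show "?A ^ (2 * (2 * 2 ^ j) + 1) * exp (- (C0 * 2 ^ j)) \<le> (1 / 2) ^ j"
        by (simp add: power_one_over)
    qed
    finally show ?thesis .
  qed
  then have "(\<Sum>j. \<integral>\<^sup>+x. indicator (- low j) x \<partial>white_noise \<beta>) \<le> (\<Sum>j. ennreal ((1 / 2) ^ j))"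
    by (intro suminf_le) auto
  also have "\<dots> < \<infinity>"
    by (subst suminf_ennreal2) (auto simp: summable_geometric)
  finally have "AE x in white_noise \<beta>. \<forall>\<^sub>F j in sequentially. indicator (- low j) x < (1 :: ennreal)"
    by (intro AE_eventually_less_1) (auto simp: Compl_eq_Diff_UNIV sets.compl_sets[OF sets_low, simplified])
  then show ?thesis
  proof eventually_elim
    case (elim x)
    then show ?case
      by (rule eventually_mono) (rule ccontr, simp)
  qed
qed

lemma Y_cont: "\<sigma> \<in> {1, -1} \<Longrightarrow> x \<in> low j \<Longrightarrow> continuous_on {0..real j + 1} (\<lambda>t. Y j (\<sigma> * t) x n)"
  using faithful[of j] unfolding faithful_def Y_def low_def by blast

lemma Y_law: "\<bar>t\<bar> \<le> real j + 1 \<Longrightarrow> f \<in> borel_measurable (white_noise \<beta>) \<Longrightarrow>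
    (\<integral>\<^sup>+x. indicator (low j) x * f (Y j t x) \<partial>white_noise \<beta>) \<le> ennreal (exp (exp (- (2 * 2 ^ j)))) * (\<integral>\<^sup>+x. f x \<partial>white_noise \<beta>)"
  using faithful[of j] unfolding faithful_def Y_def low_def by blast

lemma Y_approx:
  assumes \<sigma>: "\<sigma> \<in> {1, -1}" and x: "x \<in> low j"
  shows "approx_solution \<sigma> (real j + 1) (2 * 2 ^ j) (exp (- (2 * 2 ^ j))) x (\<lambda>n t. Y j (\<sigma> * t) x n)"
  unfolding approx_solution_def
proof (intro conjI allI impI)
  show "continuous_on {0..real j + 1} (\<lambda>t. Y j (\<sigma> * t) x n)" for n by (rule Y_cont[OF assms])
  fix n t assume n: "\<bar>n\<bar> < int (2 * 2 ^ j)" and t: "t \<in> {0..real j + 1}"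
  \<comment> \<open>Strictly inside the box both neighbours belong to it, so the truncated neighbour
    sum is the full one.\<close>
  then have "n \<in> box_sites (2 * 2 ^ j)" "n + 1 \<in> box_sites (2 * 2 ^ j)" "n - 1 \<in> box_sites (2 * 2 ^ j)"
    by (auto simp: box_sites_def)
  then show "cmod (Y j (\<sigma> * t) x n - x n - of_real \<sigma> * integral {0..t} (\<lambda>s. AL_field (Y j (\<sigma> * s) x n) (Y j (\<sigma> * s) x (n + 1) + Y j (\<sigma> * s) x (n - 1))))
      \<le> exp (- (2 * 2 ^ j))"
    using faithful[of j, unfolded faithful_def, THEN conjunct2, THEN conjunct1, rule_format, OF \<sigma> _ t, of n x] x
    unfolding Y_def low_def nbr_sum_def by simp
qed

lemma Y_bound:
  assumes "x \<in> low j" "\<bar>t\<bar> \<le> real j + 1" "n \<in> box_sites (2 * 2 ^ j)"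
  shows "cmod (Y j t x n) \<le> exp (C0 * 2 ^ j + 1)"
proof -
  have "log_energy (2 * 2 ^ j) (Y j t x) \<le> C0 * 2 ^ j + 1"
    using faithful[of j] assms(1,2) unfolding faithful_def Y_def low_def by blast
  then show ?thesis
    using cmod_le_log_energy[OF assms(3), of "Y j t x"] by (meson exp_le_cancel_iff order_trans)
qed

lemma measurable_mass_Y:
  assumes "\<sigma> \<in> {1, -1}"
  shows "(\<lambda>z. mass p q N (Y j (\<sigma> * snd z) (fst z))) \<in> borel_measurable (white_noise \<beta> \<Otimes>\<^sub>M lborel)"
proof -
  have [measurable]: "fst \<in> white_noise \<beta> \<Otimes>\<^sub>M lborel \<rightarrow>\<^sub>M (\<Pi>\<^sub>M n\<in>UNIV. borel)"
    by (rule measurable_compose[OF measurable_fst measurable_ident_sets[OF sets_white_noise]])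
  show ?thesis by measurable
qed

text \<open>Tonelli and \<open>Y_law\<close> bound the expected time integral by e C (j + 1). The
  factor 2^(-j r) makes these bounds summable, and the Borel-Cantelli argument applies.\<close>

lemma AE_mass:
  assumes \<sigma>: "\<sigma> \<in> {1, -1}"
  shows "AE x in white_noise \<beta>. \<forall>\<^sub>F j in sequentially. x \<in> low j \<longrightarrow>
    integral {0..real j + 1} (\<lambda>t. mass p q (2 * 2 ^ j) (Y j (\<sigma> * t) x)) \<le> (2 ^ j) powr r"
proof -
  interpret W: prob_space "white_noise \<beta>" by (rule prob_space_white_noise[OF \<beta>])
  interpret pair_sigma_finite "white_noise \<beta>" lborel ..
  obtain C where C: "C > 0" "\<And>M. (\<integral>\<^sup>+x. ennreal (mass p q M x) \<partial>white_noise \<beta>) \<le> ennreal C"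
    by (rule nn_integral_mass[OF \<beta>, of p q]) (use \<beta> in auto)
  define g where "g = (\<lambda>j x t. indicator (low j) x * ennreal (mass p q (2 * 2 ^ j) (Y j (\<sigma> * t) x)) * indicator {0..real j + 1} t)"
  have [measurable]: "case_prod (g j) \<in> borel_measurable (white_noise \<beta> \<Otimes>\<^sub>M lborel)" for j
    using measurable_mass_Y[OF \<sigma>] unfolding g_def case_prod_beta by measurable
  define f where "f = (\<lambda>j x. ennreal ((2 ^ j) powr (- r)) * (\<integral>\<^sup>+t. g j x t \<partial>lborel))"
  have fm: "f j \<in> borel_measurable (white_noise \<beta>)" for j unfolding f_def by measurable
  \<comment> \<open>The ratio of the geometric sequence 2^(-j r); the sum of (j + 1) \<rho>^j is a
    differentiated geometric series.\<close>
  define \<rho> where "\<rho> = 2 powr (- r)"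
  have \<rho>: "0 < \<rho>" "\<rho> < 1" using \<beta> powr_less_mono[of "- r" 0 2] by (auto simp: \<rho>_def)
  have pw: "(2 ^ j) powr (- r) = \<rho> ^ j" for j :: nat
    unfolding \<rho>_def by (simp add: powr_realpow[symmetric] powr_powr mult.commute)
  have fint: "(\<integral>\<^sup>+x. f j x \<partial>white_noise \<beta>) \<le> ennreal (exp 1 * C * (real (Suc j) * \<rho> ^ j))" for j
  proof -
    have "(\<integral>\<^sup>+x. f j x \<partial>white_noise \<beta>) = ennreal (\<rho> ^ j) * (\<integral>\<^sup>+x. (\<integral>\<^sup>+t. g j x t \<partial>lborel) \<partial>white_noise \<beta>)"
      unfolding f_def pw by (rule nn_integral_cmult) measurable
    also have "(\<integral>\<^sup>+x. (\<integral>\<^sup>+t. g j x t \<partial>lborel) \<partial>white_noise \<beta>) = (\<integral>\<^sup>+t. (\<integral>\<^sup>+x. g j x t \<partial>white_noise \<beta>) \<partial>lborel)"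
      by (rule Fubini'[symmetric]) measurable
    also have "\<dots> \<le> (\<integral>\<^sup>+t. ennreal (exp 1 * C) * indicator {0..real j + 1} t \<partial>lborel)"
    proof (rule nn_integral_mono)
      fix t
      show "(\<integral>\<^sup>+x. g j x t \<partial>white_noise \<beta>) \<le> ennreal (exp 1 * C) * indicator {0..real j + 1} t"
      proof (cases "t \<in> {0..real j + 1}")
        case True
        then have "\<bar>\<sigma> * t\<bar> \<le> real j + 1" using \<sigma> by (auto simp: abs_mult)
        moreover have "(\<lambda>x. ennreal (mass p q (2 * 2 ^ j) x)) \<in> borel_measurable (white_noise \<beta>)"
          using measurable_mass[OF measurable_ident_sets[OF sets_white_noise]] by measurable
        ultimately have "(\<integral>\<^sup>+x. indicator (low j) x * ennreal (mass p q (2 * 2 ^ j) (Y j (\<sigma> * t) x)) \<partial>white_noise \<beta>)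
          \<le> ennreal (exp (exp (- (2 * 2 ^ j)))) * (\<integral>\<^sup>+x. ennreal (mass p q (2 * 2 ^ j) x) \<partial>white_noise \<beta>)"
          by (rule Y_law)
        also have "\<dots> \<le> ennreal (exp 1) * ennreal C"
          by (intro mult_mono C) auto
        finally show ?thesis using True C by (simp add: g_def ennreal_mult)
      qed (simp add: g_def)
    qed
    also have "\<dots> = ennreal (exp 1 * C) * ennreal (real j + 1)"
      by (subst nn_integral_cmult) auto
    finally have "(\<integral>\<^sup>+x. f j x \<partial>white_noise \<beta>) \<le> ennreal (\<rho> ^ j) * (ennreal (exp 1 * C) * ennreal (real j + 1))"
      by (simp add: mult_left_mono)
    also have "\<dots> = ennreal (exp 1 * C * (real (Suc j) * \<rho> ^ j))"
    proof -
      have "exp 1 * C * (real (Suc j) * \<rho> ^ j) = \<rho> ^ j * (exp 1 * C * (real j + 1))" by (simp add: algebra_simps)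
      moreover have "ennreal (\<rho> ^ j * (exp 1 * C * (real j + 1))) = ennreal (\<rho> ^ j) * (ennreal (exp 1 * C) * ennreal (real j + 1))"
        using C \<rho> by (simp only: ennreal_mult[of "\<rho> ^ j" "exp 1 * C * (real j + 1)"] ennreal_mult[of "exp 1 * C" "real j + 1"]
            zero_le_power less_imp_le mult_nonneg_nonneg exp_ge_zero add_nonneg_nonneg of_nat_0_le_iff zero_le_one)
      ultimately show ?thesis by (simp only:)
    qed
    finally show ?thesis .
  qed
  have sm: "summable (\<lambda>j. exp 1 * C * (real (Suc j) * \<rho> ^ j))"
    using geometric_deriv_sums[of \<rho>] \<rho> by (intro summable_mult) (auto simp: sums_iff)
  have "(\<Sum>j. \<integral>\<^sup>+x. f j x \<partial>white_noise \<beta>) \<le> (\<Sum>j. ennreal (exp 1 * C * (real (Suc j) * \<rho> ^ j)))"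
    by (intro suminf_le fint) auto
  also have "\<dots> < \<infinity>"
    using sm C \<rho> by (subst suminf_ennreal2) auto
  finally have "AE x in white_noise \<beta>. \<forall>\<^sub>F j in sequentially. f j x < 1"
    using fm by (intro AE_eventually_less_1)
  then show ?thesis
  proof eventually_elim
    case (elim x)
    then show ?case
    proof eventually_elim
      case (elim j)
      show ?case
      proof
        assume low: "x \<in> low j"
        have "(\<integral>\<^sup>+t. g j x t \<partial>lborel) = (\<integral>\<^sup>+t\<in>{0..real j + 1}. ennreal (mass p q (2 * 2 ^ j) (Y j (\<sigma> * t) x)) \<partial>lborel)"
          using low by (simp add: g_def)
        also have "\<dots> = ennreal (integral {0..real j + 1} (\<lambda>t. mass p q (2 * 2 ^ j) (Y j (\<sigma> * t) x)))"
          using \<beta> by (intro set_nn_integral_continuous continuous_on_mass[where y = "\<lambda>n t. Y j (\<sigma> * t) x n"] Y_cont[OF \<sigma> low] mass_nonneg) auto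
        finally have "f j x = ennreal ((2 ^ j) powr (- r) * integral {0..real j + 1} (\<lambda>t. mass p q (2 * 2 ^ j) (Y j (\<sigma> * t) x)))"
          by (simp add: f_def ennreal_mult')
        then have "(2 ^ j) powr (- r) * integral {0..real j + 1} (\<lambda>t. mass p q (2 * 2 ^ j) (Y j (\<sigma> * t) x)) < 1"
          using elim by (metis ennreal_1 ennreal_less_iff not_le ennreal_leI)
        then show "integral {0..real j + 1} (\<lambda>t. mass p q (2 * 2 ^ j) (Y j (\<sigma> * t) x)) \<le> (2 ^ j) powr r"
          by (simp add: powr_minus field_simps)
      qed
    qed
  qed
qed

lemma AE_good: "AE x in white_noise \<beta>. \<forall>\<^sub>F j in sequentially. good j x"
  using AE_low AE_mass[of 1, simplified] AE_mass[of "-1", simplified]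
proof eventually_elim
  case (elim x)
  from elim(1,2,3) show ?case
    by eventually_elim (simp add: good_def)
qed

end

section \<open>Convergence\<close>

lemma geometric_Cauchy_limit:
  fixes f :: "nat \<Rightarrow> complex"
  assumes "\<And>k. k \<ge> j \<Longrightarrow> cmod (f k - f (Suc k)) \<le> 4 * (1 / 2) ^ k"
  shows "convergent f" "cmod (f j - lim f) \<le> 8 * (1 / 2) ^ j"
proof -
  \<comment> \<open>The geometric remainder is kept in the bound, because the plain bound 8 * 2^(-i)
    would not survive the induction.\<close>
  have *: "cmod (f i - f (i + d)) \<le> 8 * (1 / 2) ^ i - 8 * (1 / 2) ^ (i + d)" if "i \<ge> j" for i d
  proof (induction d)
    case (Suc d)
    have "cmod (f i - f (i + Suc d)) \<le> cmod (f i - f (i + d)) + cmod (f (i + d) - f (Suc (i + d)))"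
      using norm_triangle_ineq[of "f i - f (i + d)" "f (i + d) - f (Suc (i + d))"] by simp
    then show ?case using Suc assms[of "i + d"] that by simp
  qed simp
  have close: "cmod (f i - f k) \<le> 8 * (1 / 2) ^ i" if "i \<ge> j" "k \<ge> i" for i k
    using *[OF that(1), of "k - i"] that(2) zero_le_power[of "1 / 2 :: real" k] by (simp del: zero_le_power)
  have "(\<lambda>i. 8 * (1 / 2) ^ i) \<longlonglongrightarrow> (8 * 0 :: real)"
    by (intro tendsto_mult tendsto_const LIMSEQ_realpow_zero) auto
  then have small: "\<exists>M. \<forall>i\<ge>M. 8 * (1 / 2) ^ i < e" if "e > 0" for e :: real
    using order_tendstoD(2)[of "\<lambda>i. 8 * (1 / 2) ^ i" 0 sequentially e] that by (simp add: eventually_sequentially)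
  have "Cauchy f"
  proof (rule CauchyI')
    fix e :: real assume "e > 0"
    then obtain M where M: "\<And>i. i \<ge> M \<Longrightarrow> 8 * (1 / 2) ^ i < e" using small by blast
    show "\<exists>M. \<forall>m\<ge>M. \<forall>n>m. dist (f m) (f n) < e"
    proof (intro exI[of _ "max M j"] allI impI)
      fix m n assume "max M j \<le> m" "m < n"
      then show "dist (f m) (f n) < e" using close[of m n] M[of m] by (simp add: dist_norm)
    qed
  qed
  then show c: "convergent f" by (simp add: Cauchy_convergent_iff)
  have "(\<lambda>k. cmod (f j - f k)) \<longlonglongrightarrow> cmod (f j - lim f)"
    using c by (intro tendsto_intros) (simp add: convergent_LIMSEQ_iff)
  then show "cmod (f j - lim f) \<le> 8 * (1 / 2) ^ j"
    by (rule LIMSEQ_le_const2) (use close[of j] in auto)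
qed

text \<open>A mass factor of at least 1 lets the same product that bounds the mass terms also bound
  the time horizon itself.\<close>

lemma japanese_powr_ge_1:
  assumes "m > 0" "b \<ge> 1" "q \<ge> 0" "r \<ge> 0" "p > 0"
  shows "(japanese_bracket n powr q * (b * real m powr r)) powr (1 / p) \<ge> 1"
proof (rule ge_one_powr_ge_zero)
  have "1 * (1 * 1) \<le> japanese_bracket n powr q * (b * real m powr r)"
    using assms japanese_bracket_ge_1[of n] by (intro mult_mono ge_one_powr_ge_zero) auto
  then show "1 \<le> japanese_bracket n powr q * (b * real m powr r)" by simp
qed (use assms in auto)

context AL_scheme
begin

text \<open>On the box of scale j both trajectories are approximate solutions with the same data, so
  the comparison applies with m = 2^j. Mass bound and horizon grow slowly enough for the rate to
  remain sublinear in m.\<close>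

lemma eventually_small_increments:
  assumes good: "\<forall>\<^sub>F j in sequentially. good j x"
  shows "\<forall>\<^sub>F j in sequentially. \<forall>\<sigma>\<in>{1, -1}. \<forall>n t. \<bar>n\<bar> \<le> 2 ^ j \<longrightarrow> t \<in> {0..real j + 1} \<longrightarrow>
    cmod (Y j (\<sigma> * t) x n - Y (Suc j) (\<sigma> * t) x n) \<le> 4 * (1 / 2) ^ j"
proof -
  \<comment> \<open>Room for the growing horizon: (q + r) / p + s equals (1 + 6 \<beta> / 8) / (1 +
    \<beta>), still below 1, while j + 2 \<le> 2^(j s) for large j.\<close>
  define s where "s = \<beta> / (8 * (1 + \<beta>))"
  \<comment> \<open>Dictated by the energy level of the finer scale: C0 * 2^(j+1) + 1 \<le> c *
    2^j.\<close>
  define c where "c = 2 * C0 + 1"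
  \<comment> \<open>The growth of the mass bound from one scale to the next, so that both scales
    share the bound \<open>b * real m powr r\<close>.\<close>
  define b where "b = 2 powr r"
  \<comment> \<open>The time term and the two mass terms add up to at most 16 \<delta> m, and 16/32
    is the half that the comparison permits.\<close>
  define \<delta> where "\<delta> = exp (- 1 - c) / 32"
  have c: "c \<ge> 0" and s: "s > 0" and b: "b \<ge> 1" and \<delta>: "\<delta> > 0"
    using C0_pos \<beta> by (auto simp: c_def s_def b_def \<delta>_def ge_one_powr_ge_zero)
  have "(q + r) / p + s = (1 + 6 * \<beta> / 8) / (1 + \<beta>)"
  proof -
    have "s = (\<beta> / 8) / (1 + \<beta>)" by (simp add: s_def)
    then have "(q + r) / p + s = (q + r + \<beta> / 8) / (1 + \<beta>)" by (simp only: add_divide_distrib)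
    also have "q + r + \<beta> / 8 = 1 + 6 * \<beta> / 8" by simp
    finally show ?thesis .
  qed
  also have "\<dots> < 1" using \<beta> by simp
  finally have lt: "(q + r) / p + s < 1" .
  have "\<forall>\<^sub>F m :: nat in sequentially. (japanese_bracket (int (2 * m)) powr q * (b * m powr r)) powr (1 / p) * m powr s \<le> \<delta> * m"
    using \<beta> lt b \<delta> by (intro eventually_sublinear) auto
  moreover have "filterlim (\<lambda>j. 2 ^ j :: nat) sequentially sequentially"
    by (intro filterlim_subseq) (simp add: strict_mono_def)
  ultimately have ev1: "\<forall>\<^sub>F j in sequentially. (japanese_bracket (int (2 * 2 ^ j)) powr q * (b * real (2 ^ j) powr r)) powr (1 / p) * real (2 ^ j) powr s \<le> \<delta> * real (2 ^ j)"
    by (rule eventually_compose_filterlim)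
  define \<rho> where "\<rho> = 2 powr (- s)"
  have \<rho>: "0 < \<rho>" "\<rho> < 1" using s powr_less_mono[of "- s" 0 2] by (auto simp: \<rho>_def)
  have "summable (\<lambda>j. real (Suc j) * \<rho> ^ j)"
    using geometric_deriv_sums[of \<rho>] \<rho> by (auto simp: sums_iff)
  from summable_LIMSEQ_zero[OF this] have "\<forall>\<^sub>F j in sequentially. real (Suc j) * \<rho> ^ j < 1 / 2"
    by (rule order_tendstoD) simp
  then have ev2: "\<forall>\<^sub>F j in sequentially. real j + 2 \<le> real (2 ^ j) powr s"
  proof eventually_elim
    case (elim j)
    have "\<rho> ^ j = real (2 ^ j) powr (- s)"
      unfolding \<rho>_def by (simp add: powr_realpow[symmetric] powr_powr mult.commute)
    then have "real (Suc j) / real (2 ^ j) powr s < 1 / 2"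
      using elim by (simp add: powr_minus_divide)
    moreover have "real (2 ^ j) powr s > 0" by simp
    moreover have "2 * a < P" if "a / P < 1 / 2" "P > 0" for a P :: real
      using that by (simp add: field_simps)
    ultimately have "2 * real (Suc j) < real (2 ^ j) powr s" by blast
    then show ?case by simp
  qed
  have ev3: "\<forall>\<^sub>F j in sequentially. good (Suc j) x"
    using good by (rule eventually_all_ge_at_top[THEN eventually_mono]) auto
  from good ev1 ev2 ev3 show ?thesis
  proof eventually_elim
    case (elim j)
    define m where "m = (2 ^ j :: nat)"
    have m: "m > 0" "real m \<ge> 1" by (auto simp: m_def)
    define T where "T = real j + 1"
    have T: "T \<ge> 0" by (simp add: T_def)
    have low: "x \<in> low j" "x \<in> low (Suc j)" using elim by (auto simp: good_def)
    have jm: "j \<le> m" unfolding m_def by (rule less_imp_le, rule less_exp)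
    show ?case
    proof (intro ballI allI impI)
      fix \<sigma> t and n :: int assume \<sigma>: "\<sigma> \<in> {1, -1 :: real}" and n: "\<bar>n\<bar> \<le> 2 ^ j" and t: "t \<in> {0..real j + 1}"
      have app1: "approx_solution \<sigma> T (2 * m) (exp (- (2 * 2 ^ j))) x (\<lambda>n t. Y j (\<sigma> * t) x n)"
        using Y_approx[OF \<sigma> low(1)] by (simp add: T_def m_def)
      have app2: "approx_solution \<sigma> T (2 * m) (exp (- (2 * 2 ^ j))) x (\<lambda>n t. Y (Suc j) (\<sigma> * t) x n)"
        using Y_approx[OF \<sigma> low(2)] by (rule approx_solution_mono) (auto simp: T_def m_def)
      have H1: "integral {0..T} (\<lambda>t. mass p q (2 * m) (Y j (\<sigma> * t) x)) \<le> b * real m powr r"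
      proof -
        have "integral {0..T} (\<lambda>t. mass p q (2 * m) (Y j (\<sigma> * t) x)) \<le> 1 * real m powr r"
          using elim(1) \<sigma> by (auto simp: good_def T_def m_def)
        also have "\<dots> \<le> b * real m powr r" using b by (intro mult_right_mono) auto
        finally show ?thesis .
      qed
      have H2: "integral {0..T} (\<lambda>t. mass p q (2 * m) (Y (Suc j) (\<sigma> * t) x)) \<le> b * real m powr r"
      proof -
        have cm: "continuous_on {0..real (Suc j) + 1} (\<lambda>t. mass p q M (Y (Suc j) (\<sigma> * t) x))" for M
          using \<beta> by (intro continuous_on_mass[where y = "\<lambda>n t. Y (Suc j) (\<sigma> * t) x n"] Y_cont[OF \<sigma> low(2)]) auto
        have "integral {0..T} (\<lambda>t. mass p q (2 * m) (Y (Suc j) (\<sigma> * t) x)) \<le> integral {0..T} (\<lambda>t. mass p q (2 * 2 ^ Suc j) (Y (Suc j) (\<sigma> * t) x))"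
          by (intro integral_le integrable_continuous_real continuous_on_subset[OF cm] mass_mono) (auto simp: T_def m_def)
        also have "\<dots> \<le> integral {0..real (Suc j) + 1} (\<lambda>t. mass p q (2 * 2 ^ Suc j) (Y (Suc j) (\<sigma> * t) x))"
          by (intro integral_subset_le integrable_continuous_real continuous_on_subset[OF cm]) (auto simp: T_def mass_nonneg)
        also have "\<dots> \<le> (2 ^ Suc j) powr r" using elim(4) \<sigma> by (auto simp: good_def)
        also have "\<dots> = b * real m powr r" by (simp add: b_def m_def powr_mult)
        finally show ?thesis .
      qed
      have "cmod (Y j (\<sigma> * t) x n - Y (Suc j) (\<sigma> * t) x n) \<le> 2 * exp (- (2 * 2 ^ j)) * exp m + 2 * (1 / 2) ^ m"
      proof (rule box_comparison[OF app1 app2, where c = c and p = p and q = q and p' = p and q' = q and H = "b * real m powr r" and H' = "b * real m powr r"])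
        show "\<bar>\<sigma>\<bar> = 1" using \<sigma> by auto
        show "b * real m powr r > 0" using b m by simp
        show "integral {0..T} (\<lambda>t. mass p q (2 * m) (\<lambda>n. Y j (\<sigma> * t) x n)) \<le> b * real m powr r" using H1 .
        show "integral {0..T} (\<lambda>t. mass p q (2 * m) (\<lambda>n. Y (Suc j) (\<sigma> * t) x n)) \<le> b * real m powr r" using H2 .
        show "cmod (Y j (\<sigma> * u) x k) \<le> exp (c * real m) \<and> cmod (Y (Suc j) (\<sigma> * u) x k) \<le> exp (c * real m)"
          if k: "\<bar>k\<bar> \<le> int (2 * m)" and u: "u \<in> {0..T}" for k u
        proof -
          have "\<bar>\<sigma> * u\<bar> \<le> real j + 1" using \<sigma> u by (auto simp: abs_mult T_def)
          then have u': "\<bar>\<sigma> * u\<bar> \<le> real j + 1" "\<bar>\<sigma> * u\<bar> \<le> real (Suc j) + 1" by simp_all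
          have k': "k \<in> box_sites (2 * 2 ^ j)" "k \<in> box_sites (2 * 2 ^ Suc j)"
            using k by (auto simp: box_sites_def m_def)
          have "0 \<le> C0 * 2 ^ j" "(1 :: real) \<le> 2 ^ j" using C0_pos by simp_all
          moreover have "c * real m = 2 * (C0 * 2 ^ j) + 2 ^ j" "C0 * 2 ^ Suc j = 2 * (C0 * 2 ^ j)"
            by (simp_all add: c_def m_def algebra_simps)
          ultimately have "C0 * 2 ^ j + 1 \<le> c * real m" "C0 * 2 ^ Suc j + 1 \<le> c * real m"
            by linarith+
          moreover note Y_bound[OF low(1) u'(1) k'(1)] Y_bound[OF low(2) u'(2) k'(2)]
          ultimately show ?thesis by (meson exp_le_cancel_iff order_trans)
        qed
        let ?X = "(japanese_bracket (int (2 * m)) powr q * (b * real m powr r)) powr (1 / p)"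
        have X1: "?X * real m powr s \<le> \<delta> * real m" using elim(2) by (simp add: m_def)
        have X2: "?X \<ge> 1" using m b \<beta> by (intro japanese_powr_ge_1) auto
        have T1: "T + 1 \<le> real m powr s" using elim(3) by (simp add: T_def m_def)
        have A: "?X * (T + 1) \<le> ?X * real m powr s" using X2 T1 by (intro mult_left_mono) auto
        have "1 * (T + 1) \<le> ?X * (T + 1)" using X2 T by (intro mult_right_mono) auto
        note B = this
        have E: "?X * (T + 1) \<le> \<delta> * real m" by (rule order_trans[OF A X1])
        have "T \<le> \<delta> * real m" using order_trans[OF B E] by simp
        moreover have "4 * T + 6 * (Z + Z) \<le> 16 * d" if "Z \<le> d" "T \<le> d" for Z d :: real
          using that by argo
        ultimately have "4 * T + 6 * (?X * (T + 1) + ?X * (T + 1)) \<le> 16 * (\<delta> * real m)" using E by blast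
        also have "\<dots> = real m * exp (- 1 - c) / 2" by (simp add: \<delta>_def)
        finally show "4 * T + 6 * (?X * (T + 1) + ?X * (T + 1)) \<le> real m * exp (- 1 - c) / 2" .
        show "t \<in> {0..T}" using t by (simp add: T_def)
        show "\<bar>n\<bar> \<le> int m" using n by (simp add: m_def)
      qed (use c \<beta> m b in auto)
      \<comment> \<open>With m = 2^j the first term is 2 exp (-m); as j \<le> m, both terms are at
        most 2 * 2^(-j).\<close>
      also have "2 * exp (- (2 * 2 ^ j)) * exp m + 2 * (1 / 2) ^ m \<le> 2 * (1 / 2) ^ j + 2 * (1 / 2) ^ j"
      proof -
        have "exp (- (2 * 2 ^ j)) * exp m = exp (- real m)"
          unfolding exp_add[symmetric] by (simp add: m_def)
        also have "\<dots> \<le> exp (- real j)" using jm by simp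
        also have "\<dots> = (1 / exp 1) ^ j" by (simp add: exp_minus power_inverse divide_inverse exp_of_nat_mult[of j 1, simplified])
        also have "\<dots> \<le> (1 / 2) ^ j" using exp_ge_add_one_self[of 1] by (intro power_mono divide_left_mono) auto
        finally have "exp (- (2 * 2 ^ j)) * exp m \<le> (1 / 2) ^ j" .
        moreover have "(1 / 2 :: real) ^ m \<le> (1 / 2) ^ j" using jm by (intro power_decreasing) auto
        ultimately show ?thesis unfolding mult.assoc by (intro add_mono mult_left_mono) auto
      qed
      finally show "cmod (Y j (\<sigma> * t) x n - Y (Suc j) (\<sigma> * t) x n) \<le> 4 * (1 / 2) ^ j" by simp
    qed
  qed
qed

text \<open>The index \<open>J\<close> depends on \<open>x\<close> alone while the window in space
  and time grows with j, so at each site the convergence is uniform on bounded time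
  intervals.\<close>

lemma convergence:
  assumes "\<forall>\<^sub>F j in sequentially. good j x"
  obtains J where "\<And>j. j \<ge> J \<Longrightarrow> good j x"
    "\<And>j t n. j \<ge> J \<Longrightarrow> \<bar>n\<bar> \<le> 2 ^ j \<Longrightarrow> \<bar>t\<bar> \<le> real j + 1 \<Longrightarrow> cmod (Y j t x n - G t x n) \<le> 8 * (1 / 2) ^ j"
    "\<And>t n. (\<lambda>j. Y j t x n) \<longlonglongrightarrow> G t x n"
proof -
  obtain J1 where J1: "\<And>j. j \<ge> J1 \<Longrightarrow> good j x"
    using assms by (auto simp: eventually_sequentially)
  obtain J2 where J2: "\<And>j \<sigma> n t. j \<ge> J2 \<Longrightarrow> \<sigma>\<in>{1, -1} \<Longrightarrow> \<bar>n\<bar> \<le> 2 ^ j \<Longrightarrow> t \<in> {0..real j + 1} \<Longrightarrow>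
      cmod (Y j (\<sigma> * t) x n - Y (Suc j) (\<sigma> * t) x n) \<le> 4 * (1 / 2) ^ j"
    using eventually_small_increments[OF assms] unfolding eventually_sequentially by blast
  have inc: "cmod (Y j t x n - Y (Suc j) t x n) \<le> 4 * (1 / 2) ^ j" if "j \<ge> J2" "\<bar>n\<bar> \<le> 2 ^ j" "\<bar>t\<bar> \<le> real j + 1" for j n t
    using J2[of j 1 n "\<bar>t\<bar>"] J2[of j "-1" n "\<bar>t\<bar>"] that by (cases "t \<ge> 0") auto
  have inc': "cmod (Y k t x n - Y (Suc k) t x n) \<le> 4 * (1 / 2) ^ k" if "j \<ge> J2" "\<bar>n\<bar> \<le> 2 ^ j" "\<bar>t\<bar> \<le> real j + 1" "k \<ge> j" for j k n t
  proof -
    have "(2::int) ^ j \<le> 2 ^ k" using that by (intro power_increasing) auto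
    then have "\<bar>n\<bar> \<le> 2 ^ k" using that(2) by linarith
    then show ?thesis using that by (intro inc) auto
  qed
  show ?thesis
  proof (rule that[of "max J1 J2"])
    show "good j x" if "j \<ge> max J1 J2" for j using J1 that by simp
    show "cmod (Y j t x n - G t x n) \<le> 8 * (1 / 2) ^ j" if "j \<ge> max J1 J2" "\<bar>n\<bar> \<le> 2 ^ j" "\<bar>t\<bar> \<le> real j + 1" for j t n
      unfolding G_def using that by (intro geometric_Cauchy_limit inc'[of j]) auto
    show "(\<lambda>j. Y j t x n) \<longlonglongrightarrow> G t x n" for t n
    proof -
      define j where "j = max J2 (max (nat \<bar>n\<bar>) (nat \<lceil>\<bar>t\<bar>\<rceil>))"
      have "nat \<bar>n\<bar> \<le> j" unfolding j_def by (rule max.coboundedI2, rule max.cobounded1)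
      moreover have "j < 2 ^ j" by (rule less_exp)
      ultimately have "nat \<bar>n\<bar> \<le> 2 ^ j" by linarith
      then have "\<bar>n\<bar> \<le> 2 ^ j" by (simp add: nat_le_iff)
      moreover have J2j: "J2 \<le> j" unfolding j_def by (rule max.cobounded1)
      moreover have "\<bar>t\<bar> \<le> real j + 1"
      proof -
        have "nat \<lceil>\<bar>t\<bar>\<rceil> \<le> j" unfolding j_def by (rule max.coboundedI2, rule max.cobounded2)
        then show ?thesis by linarith
      qed
      ultimately have "convergent (\<lambda>j. Y j t x n)"
        using J2j by (intro geometric_Cauchy_limit(1)[of j] inc'[of j])
      then show ?thesis unfolding G_def by (simp only: convergent_LIMSEQ_iff)
    qed
  qed
qed

end

section \<open>The limit is a good solution\<close>

text \<open>The equation is given separately for the two directions of time. Rewriting both as one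
  indefinite integral based at -T yields a two-sided derivative, in particular at time 0.\<close>

lemma AL_solution_from_integral:
  fixes \<alpha> :: "int \<Rightarrow> real \<Rightarrow> complex"
  assumes cont: "\<And>\<sigma> T n. \<sigma> \<in> {1, -1} \<Longrightarrow> T \<ge> 0 \<Longrightarrow> continuous_on {0..T} (\<lambda>t. \<alpha> n (\<sigma> * t))"
    and eq: "\<And>\<sigma> t n. \<sigma> \<in> {1, -1} \<Longrightarrow> t \<ge> 0 \<Longrightarrow>
      \<alpha> n (\<sigma> * t) = \<alpha> n 0 + of_real \<sigma> * integral {0..t} (\<lambda>s. AL_field (\<alpha> n (\<sigma> * s)) (\<alpha> (n + 1) (\<sigma> * s) + \<alpha> (n - 1) (\<sigma> * s)))"
  shows "AL_solution \<alpha>"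
  unfolding AL_solution_iff
proof (intro allI)
  fix n :: int and t :: real
  define F where "F = (\<lambda>s. AL_field (\<alpha> n s) (\<alpha> (n + 1) s + \<alpha> (n - 1) s))"
  define T where "T = \<bar>t\<bar> + 1"
  have T: "T > 0" "- T < t" "t < T" by (auto simp: T_def)
  have c: "continuous_on {-T..T} (\<alpha> k)" for k
  proof -
    have "continuous_on {0..T} (\<alpha> k)" using cont[of 1 T k] T by simp
    moreover have "continuous_on {-T..0} (\<alpha> k)"
    proof -
      have "continuous_on {-T..0} (\<lambda>s. \<alpha> k (- 1 * (- s)))"
        by (rule continuous_on_compose2[OF cont[of "-1" T k]]) (use T in \<open>auto intro!: continuous_intros\<close>)
      then show ?thesis by simp
    qed
    ultimately have "continuous_on ({-T..0} \<union> {0..T}) (\<alpha> k)"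
      by (intro continuous_on_closed_Un) auto
    moreover have "{-T..0} \<union> {0..T} = {-T..T}" using T by auto
    ultimately show ?thesis by simp
  qed
  have cF: "continuous_on {-T..T} F" unfolding F_def by (intro continuous_intros c)
  have int: "F integrable_on {a..b}" if "- T \<le> a" "b \<le> T" for a b
    using that by (intro integrable_continuous_real continuous_on_subset[OF cF]) auto
  have neg: "\<alpha> n s = \<alpha> n 0 - integral {s..0} F" if "s \<le> 0" for s
  proof -
    have "integral {0..- s} (\<lambda>u. F (- u)) = integral {s..0} F"
      using Henstock_Kurzweil_Integration.integral_reflect_real[where a = s and b = 0 and f = F] by simp
    then show ?thesis using eq[of "-1" "- s" n] that by (simp add: F_def)
  qed
  have repr: "\<alpha> n s = \<alpha> n (- T) + integral {-T..s} F" if s: "s \<in> {-T..T}" for s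
  proof (cases "s \<ge> 0")
    case True
    have "integral {-T..s} F = integral {-T..0} F + integral {0..s} F"
      using T s True int[of "-T" s] by (intro Henstock_Kurzweil_Integration.integral_combine[symmetric]) auto
    then show ?thesis using eq[of 1 s n] neg[of "-T"] True T by (simp add: F_def)
  next
    case False
    have "integral {-T..0} F = integral {-T..s} F + integral {s..0} F"
      using T s False int[of "-T" 0] by (intro Henstock_Kurzweil_Integration.integral_combine[symmetric]) auto
    then show ?thesis using neg[of s] neg[of "-T"] False T by simp
  qed
  have "((\<lambda>s. integral {-T..s} F) has_vector_derivative F t) (at t within {-T..T})"
    by (rule integral_has_vector_derivative[OF cF]) (use T in auto)
  from has_vector_derivative_add[OF has_vector_derivative_const this]
  have "((\<lambda>s. \<alpha> n (- T) + integral {-T..s} F) has_vector_derivative F t) (at t within {-T..T})"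
    by simp
  from has_vector_derivative_transform[OF _ repr this]
  have "(\<alpha> n has_vector_derivative F t) (at t within {-T..T})"
    using T by simp
  moreover have "at t within {-T..T} = at t" using T by (intro at_within_interior) auto
  ultimately show "(\<alpha> n has_vector_derivative AL_field (\<alpha> n t) (\<alpha> (n + 1) t + \<alpha> (n - 1) t)) (at t)"
    by (simp add: F_def)
qed

context AL_scheme
begin

text \<open>At a site and its neighbours the approximations converge uniformly on the time interval,
  so the Lipschitz bound of the field lets the integral equation pass to the limit.\<close>

lemma G_integral_equation:
  assumes good: "\<forall>\<^sub>F j in sequentially. good j x" and \<sigma>: "\<sigma> \<in> {1, -1}" and T: "T \<ge> 0"
  shows "continuous_on {0..T} (\<lambda>t. G (\<sigma> * t) x n)"
    and "G (\<sigma> * T) x n = x n + of_real \<sigma> * integral {0..T} (\<lambda>s. AL_field (G (\<sigma> * s) x n) (G (\<sigma> * s) x (n + 1) + G (\<sigma> * s) x (n - 1)))"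
proof -
  obtain J where J: "\<And>j. j \<ge> J \<Longrightarrow> good j x"
    "\<And>j t n. j \<ge> J \<Longrightarrow> \<bar>n\<bar> \<le> 2 ^ j \<Longrightarrow> \<bar>t\<bar> \<le> real j + 1 \<Longrightarrow> cmod (Y j t x n - G t x n) \<le> 8 * (1 / 2) ^ j"
    using convergence[OF good] by metis
  have pow: "\<forall>\<^sub>F j in sequentially. \<bar>k\<bar> \<le> 2 ^ j" for k :: int
  proof -
    have "\<bar>k\<bar> \<le> 2 ^ j" if "j \<ge> nat \<bar>k\<bar>" for j
    proof -
      have "nat \<bar>k\<bar> < 2 ^ j" using that less_exp[of j] by linarith
      then show ?thesis by (simp add: nat_less_iff)
    qed
    then show ?thesis unfolding eventually_sequentially by blast
  qed
  have evT: "\<forall>\<^sub>F j in sequentially. T \<le> real j + 1"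
    using eventually_ge_at_top[of "nat \<lceil>T\<rceil>"] by eventually_elim linarith
  have close: "\<forall>\<^sub>F j in sequentially. \<forall>t\<in>{0..T}. cmod (Y j (\<sigma> * t) x k - G (\<sigma> * t) x k) \<le> 8 * (1 / 2) ^ j" for k
    using pow[of k] evT eventually_ge_at_top[of J]
  proof eventually_elim
    case (elim j)
    show ?case using \<sigma> elim by (intro ballI J(2)) (auto simp: abs_mult)
  qed
  have to0: "(\<lambda>j. 8 * (1 / 2) ^ j) \<longlonglongrightarrow> (8 * 0 :: real)"
    by (intro tendsto_mult tendsto_const LIMSEQ_realpow_zero) auto
  have cont: "continuous_on {0..T} (\<lambda>t. G (\<sigma> * t) x k)" for k
  proof (rule uniform_limit_theorem)
    show "\<forall>\<^sub>F j in sequentially. continuous_on {0..T} (\<lambda>t. Y j (\<sigma> * t) x k)"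
      using evT eventually_ge_at_top[of J]
    proof eventually_elim
      case (elim j)
      then have "x \<in> low j" using J(1) by (auto simp: good_def)
      from Y_cont[OF \<sigma> this] show ?case by (rule continuous_on_subset) (use elim in auto)
    qed
    show "uniform_limit {0..T} (\<lambda>j t. Y j (\<sigma> * t) x k) (\<lambda>t. G (\<sigma> * t) x k) sequentially"
    proof (rule uniform_limitI)
      fix e :: real assume "e > 0"
      then have "\<forall>\<^sub>F j in sequentially. 8 * (1 / 2) ^ j < e"
        using to0 by (intro order_tendstoD(2)) auto
      then show "\<forall>\<^sub>F j in sequentially. \<forall>t\<in>{0..T}. dist (Y j (\<sigma> * t) x k) (G (\<sigma> * t) x k) < e"
        using close[of k] by eventually_elim (auto simp: dist_norm intro: le_less_trans)
    qed
  qed simp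
  show "continuous_on {0..T} (\<lambda>t. G (\<sigma> * t) x n)" by (rule cont)
  let ?g = "\<lambda>k s. G (\<sigma> * s) x k" and ?y = "\<lambda>j k s. Y j (\<sigma> * s) x k"
  obtain B where B: "B \<ge> 0" "\<And>k s. k \<in> {n - 1..n + 1} \<Longrightarrow> s \<in> {0..T} \<Longrightarrow> cmod (?g k s) \<le> B"
  proof -
    have "\<exists>b. \<forall>s\<in>{0..T}. cmod (?g k s) \<le> b" for k
      by (rule continuous_on_compact_bound[OF compact_Icc cont]) blast
    then obtain b where b: "\<And>k s. s \<in> {0..T} \<Longrightarrow> cmod (?g k s) \<le> b k" by metis
    show ?thesis
    proof (rule that[of "\<bar>b (n - 1)\<bar> + \<bar>b n\<bar> + \<bar>b (n + 1)\<bar>"])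
      fix k s assume k: "k \<in> {n - 1..n + 1}" and s: "s \<in> {0..T}"
      then have "k = n - 1 \<or> k = n \<or> k = n + 1" by auto
      then show "cmod (?g k s) \<le> \<bar>b (n - 1)\<bar> + \<bar>b n\<bar> + \<bar>b (n + 1)\<bar>"
        using b[OF s, of k] by auto
    qed simp
  qed
  \<comment> \<open>The approximations in use stay within 8 of the limit, so B + 8 bounds
    both.\<close>
  define A where "A = (B + 8)\<^sup>2"
  have sqA: "sqrt A = B + 8" using B(1) by (simp add: A_def)
  \<comment> \<open>The three terms are the distance to the limit at time T, a bound for the defect
    of the approximate equation, and the integrated difference of the fields.\<close>
  define e where "e = (\<lambda>j. 8 * (1 / 2) ^ j + exp (- real j) + T * ((4 + 6 * A) * (8 * (1 / 2) ^ j)))"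
  have "\<forall>\<^sub>F j in sequentially. cmod (?g n T - x n - of_real \<sigma> * integral {0..T} (\<lambda>s. AL_field (?g n s) (?g (n + 1) s + ?g (n - 1) s))) \<le> e j"
    using close[of n] close[of "n + 1"] close[of "n - 1"] evT pow[of "\<bar>n\<bar>"] pow[of "\<bar>n\<bar> + 1"] eventually_ge_at_top[of J] eventually_ge_at_top[of 0]
  proof eventually_elim
    case (elim j)
    let ?d = "8 * (1 / 2 :: real) ^ j"
    have d8: "?d \<le> 8" using power_le_one[of "1 / 2 :: real" j] by simp
    have low: "x \<in> low j" using J(1) elim by (auto simp: good_def)
    let ?Fg = "\<lambda>s. AL_field (?g n s) (?g (n + 1) s + ?g (n - 1) s)"
    let ?Fy = "\<lambda>s. AL_field (?y j n s) (?y j (n + 1) s + ?y j (n - 1) s)"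
    have yc: "continuous_on {0..T} (?y j k)" for k
      using Y_cont[OF \<sigma> low, of k] by (rule continuous_on_subset) (use elim in auto)
    have "n + 1 \<in> box_sites (2 * 2 ^ j)" "n - 1 \<in> box_sites (2 * 2 ^ j)" "\<bar>n\<bar> < int (2 * 2 ^ j)"
      using elim(6) by (auto simp: box_sites_def)
    then have a1: "cmod (?y j n T - x n - of_real \<sigma> * integral {0..T} ?Fy) \<le> exp (- (2 * 2 ^ j))"
      using Y_approx[OF \<sigma> low, unfolded approx_solution_def, THEN conjunct2, rule_format, of n T] T elim(4) by simp
    have "real j \<le> 2 ^ j" using less_exp[of j] by (metis less_imp_le of_nat_le_iff of_nat_numeral of_nat_power)
    moreover have "(0 :: real) \<le> 2 ^ j" by simp
    ultimately have "exp (- (2 * 2 ^ j)) \<le> exp (- real j)" by (subst exp_le_cancel_iff) linarith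
    then have a1': "cmod (?y j n T - x n - of_real \<sigma> * integral {0..T} ?Fy) \<le> exp (- real j)" using a1 by linarith
    have a2: "cmod (?y j n T - ?g n T) \<le> ?d" using elim(1) T by simp
    have Fd: "cmod (?Fy s - ?Fg s) \<le> (4 + 6 * A) * ?d" if s: "s \<in> {0..T}" for s
    proof (rule AL_field_lipschitz)
      have g: "cmod (?g k s) \<le> B" if "k \<in> {n - 1..n + 1}" for k using B(2)[OF that s] .
      have "cmod (?y j n s - ?g n s) \<le> ?d" using elim(1) s by blast
      moreover have "cmod (?g n s) \<le> B" by (rule g) simp
      ultimately have y: "cmod (?y j n s) \<le> B + 8"
        using d8 norm_triangle_sub[of "?y j n s" "?g n s"] by linarith
      then show "(cmod (?y j n s))\<^sup>2 \<le> A" unfolding A_def by (intro power_mono) auto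
      show "(cmod (?g n s))\<^sup>2 \<le> A" unfolding A_def using g[of n] by (intro power_mono) auto
      show "cmod (?g (n + 1) s + ?g (n - 1) s) \<le> 2 * sqrt A"
        unfolding sqA using norm_triangle_ineq[of "?g (n + 1) s" "?g (n - 1) s"] g[of "n + 1"] g[of "n - 1"] by simp
      have eq: "?y j (n + 1) s + ?y j (n - 1) s - (?g (n + 1) s + ?g (n - 1) s) = (?y j (n + 1) s - ?g (n + 1) s) + (?y j (n - 1) s - ?g (n - 1) s)"
        by simp
      have "cmod (?y j (n + 1) s - ?g (n + 1) s) \<le> ?d" "cmod (?y j (n - 1) s - ?g (n - 1) s) \<le> ?d"
        using elim(2,3) s by auto
      then show "cmod (?y j (n + 1) s + ?y j (n - 1) s - (?g (n + 1) s + ?g (n - 1) s)) \<le> 2 * ?d"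
        unfolding eq using norm_triangle_ineq[of "?y j (n + 1) s - ?g (n + 1) s" "?y j (n - 1) s - ?g (n - 1) s"] by linarith
      show "cmod (?y j n s - ?g n s) \<le> ?d" using elim(1) s by auto
    qed
    have "cmod (integral {0..T} (\<lambda>s. ?Fy s - ?Fg s)) \<le> ((4 + 6 * A) * ?d) * (T - 0)"
      using T Fd by (intro integral_bound continuous_intros yc cont) auto
    also have "integral {0..T} (\<lambda>s. ?Fy s - ?Fg s) = integral {0..T} ?Fy - integral {0..T} ?Fg"
      by (intro integral_diff integrable_continuous_real continuous_intros yc cont)
    finally have a3: "cmod (of_real \<sigma> * (integral {0..T} ?Fy - integral {0..T} ?Fg)) \<le> T * ((4 + 6 * A) * ?d)"
      using \<sigma> by (auto simp: norm_mult mult_ac)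
    have eq: "?g n T - x n - of_real \<sigma> * integral {0..T} ?Fg = (?y j n T - x n - of_real \<sigma> * integral {0..T} ?Fy)
        - (?y j n T - ?g n T) + of_real \<sigma> * (integral {0..T} ?Fy - integral {0..T} ?Fg)"
      by (simp add: algebra_simps)
    have tri: "cmod (a - b + c) \<le> cmod b + cmod a + cmod c" for a b c :: complex
      using norm_triangle_ineq[of "a - b" c] norm_triangle_ineq4[of a b] by linarith
    show ?case
      unfolding eq e_def by (rule order_trans[OF tri add_mono[OF add_mono[OF a2 a1'] a3]])
  qed
  moreover have "e \<longlonglongrightarrow> 8 * 0 + 0 + T * ((4 + 6 * A) * (8 * 0))"
    unfolding e_def
  proof (intro tendsto_add tendsto_mult tendsto_const LIMSEQ_realpow_zero)
    show "(\<lambda>j. exp (- real j)) \<longlonglongrightarrow> 0"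
      by (intro filterlim_compose[OF exp_at_bot] filterlim_compose[OF filterlim_uminus_at_bot_at_top] filterlim_real_sequentially)
  qed auto
  ultimately have "cmod (?g n T - x n - of_real \<sigma> * integral {0..T} (\<lambda>s. AL_field (?g n s) (?g (n + 1) s + ?g (n - 1) s))) \<le> 0"
    by (intro tendsto_le[OF _ _ tendsto_const]) auto
  then show "G (\<sigma> * T) x n = x n + of_real \<sigma> * integral {0..T} (\<lambda>s. AL_field (G (\<sigma> * s) x n) (G (\<sigma> * s) x (n + 1) + G (\<sigma> * s) x (n - 1)))"
    by (simp add: algebra_simps)
qed

lemma G_solution:
  assumes "\<forall>\<^sub>F j in sequentially. good j x"
  shows "AL_solution (\<lambda>n t. G t x n)" "G 0 x n = x n"
proof -
  show init: "G 0 x n = x n" for n using G_integral_equation(2)[OF assms, of 1 0 n] by simp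
  show "AL_solution (\<lambda>n t. G t x n)"
  proof (rule AL_solution_from_integral)
    fix \<sigma> T n assume \<sigma>: "\<sigma> \<in> {1, -1 :: real}" and T: "(0 :: real) \<le> T"
    show "continuous_on {0..T} (\<lambda>t. G (\<sigma> * t) x n)" by (rule G_integral_equation(1)[OF assms \<sigma> T])
    show "G (\<sigma> * T) x n = G 0 x n + of_real \<sigma> * integral {0..T} (\<lambda>s. AL_field (G (\<sigma> * s) x n) (G (\<sigma> * s) x (n + 1) + G (\<sigma> * s) x (n - 1)))"
      unfolding init by (rule G_integral_equation(2)[OF assms \<sigma> T])
  qed
qed

text \<open>Each site is treated at the smallest admissible scale whose window contains it. Then 2^j
  is at most linear in |n|, and the energy bound at that scale becomes exponential growth in
  |n|.\<close>

lemma G_growth: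
  assumes "\<forall>\<^sub>F j in sequentially. good j x" and T: "T > 0"
  shows "(SUP t\<in>{-T..T}. (\<Sum>\<^sub>\<infinity>n. ennreal (exp (- (8 * C0 + 1) * japanese_bracket n) * (cmod (G t x n))\<^sup>2))) < \<infinity>"
proof -
  obtain J where J: "\<And>j. j \<ge> J \<Longrightarrow> good j x"
    "\<And>j t n. j \<ge> J \<Longrightarrow> \<bar>n\<bar> \<le> 2 ^ j \<Longrightarrow> \<bar>t\<bar> \<le> real j + 1 \<Longrightarrow> cmod (Y j t x n - G t x n) \<le> 8 * (1 / 2) ^ j"
    using convergence[OF assms(1)] by metis
  define i where "i = max J (nat \<lceil>T\<rceil>)"
  have i: "J \<le> i" "T \<le> real i + 1"
  proof -
    show "J \<le> i" unfolding i_def by (rule max.cobounded1)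
    have "nat \<lceil>T\<rceil> \<le> i" unfolding i_def by (rule max.cobounded2)
    then show "T \<le> real i + 1" by linarith
  qed
  \<comment> \<open>In the exponent, 1 comes from \<open>Y_bound\<close> and 3 absorbs the distance
    8 to the limit: X + 8 \<le> 5 X \<le> exp 3 * X for X \<ge> 2.\<close>
  define B where "B = exp (C0 * 2 ^ i + 4)"
  have bound: "cmod (G t x n) \<le> B * exp (2 * C0 * \<bar>n\<bar>)" if t: "\<bar>t\<bar> \<le> T" for t n
  proof -
    have "\<exists>j\<ge>i. \<bar>n\<bar> \<le> 2 ^ j"
    proof (intro exI[of _ "max i (nat \<bar>n\<bar>)"] conjI)
      have "nat \<bar>n\<bar> \<le> max i (nat \<bar>n\<bar>)" by (rule max.cobounded2)
      also have "\<dots> < 2 ^ max i (nat \<bar>n\<bar>)" by (rule less_exp)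
      finally show "\<bar>n\<bar> \<le> 2 ^ max i (nat \<bar>n\<bar>)" by (simp add: nat_less_iff)
    qed simp
    define j where "j = (LEAST j. i \<le> j \<and> \<bar>n\<bar> \<le> 2 ^ j)"
    have j: "i \<le> j" "\<bar>n\<bar> \<le> 2 ^ j"
      using LeastI_ex[OF \<open>\<exists>j\<ge>i. \<bar>n\<bar> \<le> 2 ^ j\<close>[unfolded Bex_def]] unfolding j_def by auto
    have pj: "2 ^ j \<le> 2 ^ i + 2 * real_of_int \<bar>n\<bar>"
    proof (cases "j = i")
      case False
      then obtain k where k: "j = Suc k" "i \<le> k" using j(1) by (cases j) auto
      have "\<not> (i \<le> k \<and> \<bar>n\<bar> \<le> 2 ^ k)"
        using not_less_Least[of k "\<lambda>j. i \<le> j \<and> \<bar>n\<bar> \<le> 2 ^ j"] k(1) unfolding j_def by simp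
      then have "2 ^ k < \<bar>n\<bar>" using k(2) by simp
      then have "real_of_int (2 ^ k) < real_of_int \<bar>n\<bar>" by (simp only: of_int_less_iff)
      then show ?thesis unfolding k(1) by (simp add: add_increasing)
    qed simp
    have ji: "j \<ge> J" "\<bar>t\<bar> \<le> real j + 1" using j i t by auto
    have low: "x \<in> low j" using J(1)[OF ji(1)] by (simp add: good_def)
    have "n \<in> box_sites (2 * 2 ^ j)" using j(2) by (auto simp: box_sites_def)
    from Y_bound[OF low ji(2) this] J(2)[OF ji(1) j(2) ji(2)]
    have "cmod (G t x n) \<le> exp (C0 * 2 ^ j + 1) + 8 * (1 / 2) ^ j"
      using norm_triangle_sub[of "G t x n" "Y j t x n"] by (simp add: norm_minus_commute)
    also have "\<dots> \<le> exp (C0 * 2 ^ j + 1) + 8"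
      using power_le_one[of "1 / 2 :: real" j] by simp
    also have "\<dots> \<le> exp (C0 * 2 ^ j + 1) * exp 3"
    proof -
      have "0 \<le> C0 * 2 ^ j" using C0_pos by simp
      then have 1: "exp (C0 * 2 ^ j + 1) \<ge> 2" using exp_ge_add_one_self[of "C0 * 2 ^ j + 1"] by linarith
      have "exp (3 :: real) \<ge> 1 + 3 + 3\<^sup>2 / 2" using exp_lower_Taylor_quadratic[of 3] by simp
      then have 2: "exp (3 :: real) \<ge> 5" by simp
      have "exp (C0 * 2 ^ j + 1) * 5 \<le> exp (C0 * 2 ^ j + 1) * exp 3" using 2 by (intro mult_left_mono) auto
      then show ?thesis using 1 by linarith
    qed
    also have "\<dots> = exp (C0 * 2 ^ j + 4)" by (simp add: exp_add[symmetric])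
    also have "\<dots> \<le> exp (C0 * (2 ^ i + 2 * real_of_int \<bar>n\<bar>) + 4)"
      using pj C0_pos by simp
    also have "\<dots> = B * exp (2 * C0 * \<bar>n\<bar>)" unfolding B_def exp_add[symmetric] by (simp add: algebra_simps)
    finally show ?thesis .
  qed
  define g where "g = (\<lambda>k::nat. B\<^sup>2 * exp (- 1) ^ k)"
  have g: "summable g" "\<And>k. 0 \<le> g k" unfolding g_def by (auto intro!: summable_mult summable_geometric)
  \<comment> \<open>The square grows at rate 4 C0, so the weight with rate 8 C0 + 1 leaves at least
    the decay exp (-|n|).\<close>
  have weighted: "exp (- (8 * C0 + 1) * japanese_bracket n) * (cmod (G t x n))\<^sup>2 \<le> g (nat \<bar>n\<bar>)" if "\<bar>t\<bar> \<le> T" for t n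
  proof -
    have jn: "real_of_int \<bar>n\<bar> \<le> japanese_bracket n"
      unfolding japanese_bracket_def by (rule real_le_rsqrt) simp
    have "(cmod (G t x n))\<^sup>2 \<le> (B * exp (2 * C0 * \<bar>n\<bar>))\<^sup>2"
      by (intro power_mono bound that) auto
    also have "\<dots> = B\<^sup>2 * exp (4 * C0 * \<bar>n\<bar>)"
      by (simp add: power_mult_distrib power2_eq_square exp_add[symmetric])
    finally have "exp (- (8 * C0 + 1) * japanese_bracket n) * (cmod (G t x n))\<^sup>2
       \<le> exp (- (8 * C0 + 1) * \<bar>n\<bar>) * (B\<^sup>2 * exp (4 * C0 * \<bar>n\<bar>))"
      using jn C0_pos by (intro mult_mono) auto
    also have "\<dots> = B\<^sup>2 * (exp (- (8 * C0 + 1) * \<bar>n\<bar>) * exp (4 * C0 * \<bar>n\<bar>))" by simp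
    also have "exp (- (8 * C0 + 1) * \<bar>n\<bar>) * exp (4 * C0 * \<bar>n\<bar>) = exp (- (4 * C0 * \<bar>n\<bar>) - \<bar>n\<bar>)"
      unfolding exp_add[symmetric] by (simp add: algebra_simps)
    also have "B\<^sup>2 * \<dots> \<le> B\<^sup>2 * exp (- real_of_int \<bar>n\<bar>)"
      using C0_pos by (intro mult_left_mono) auto
    also have "exp (- real_of_int \<bar>n\<bar>) = exp (- 1) ^ nat \<bar>n\<bar>"
      using exp_of_nat_mult[of "nat \<bar>n\<bar>" "- 1 :: real"] by simp
    finally show ?thesis by (simp add: g_def)
  qed
  have "(SUP t\<in>{-T..T}. (\<Sum>\<^sub>\<infinity>n. ennreal (exp (- (8 * C0 + 1) * japanese_bracket n) * (cmod (G t x n))\<^sup>2))) \<le> ennreal (g 0 + 2 * suminf g)"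
  proof (intro SUP_least)
    fix t assume "t \<in> {-T..T}"
    then have t: "\<bar>t\<bar> \<le> T" by auto
    show "(\<Sum>\<^sub>\<infinity>n. ennreal (exp (- (8 * C0 + 1) * japanese_bracket n) * (cmod (G t x n))\<^sup>2)) \<le> ennreal (g 0 + 2 * suminf g)"
      unfolding infsum_ennreal_box
      by (intro SUP_least) (subst sum_ennreal, simp, intro ennreal_leI sum_box_sites_bounded g weighted t)
  qed
  then show ?thesis by (rule le_less_trans) simp
qed

end

section \<open>Invariance\<close>

lemma tendsto_coordinatewise:
  fixes f :: "nat \<Rightarrow> 'a \<Rightarrow> 'b :: topological_space"
  assumes "\<And>n. (\<lambda>j. f j n) \<longlonglongrightarrow> l n"
  shows "f \<longlonglongrightarrow> l"
proof -
  have "limitin (product_topology (\<lambda>i. euclidean) UNIV) f l sequentially"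
    using assms by (auto simp: limitin_componentwise)
  then show ?thesis by (simp add: euclidean_product_topology)
qed

text \<open>Outer regularity extends the inequality from open to Borel sets, and passing to
  complements reverses it because both masses are 1.\<close>

lemma measure_eqI_open_le:
  fixes M N :: "'a :: polish_space measure"
  assumes M: "prob_space M" "sets M = sets borel" and N: "prob_space N" "sets N = sets borel"
    and le: "\<And>U. open U \<Longrightarrow> emeasure M U \<le> emeasure N U"
  shows "M = N"
proof (rule measure_eqI)
  show "sets M = sets N" using assms by simp
  interpret M: prob_space M by fact
  interpret N: prob_space N by fact
  have sp: "space M = UNIV" "space N = UNIV"
    using sets_eq_imp_space_eq[OF M(2)] sets_eq_imp_space_eq[OF N(2)] by simp_all
  have le': "measure M A \<le> measure N A" if A: "A \<in> sets borel" for A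
  proof -
    have "emeasure M A \<le> emeasure N U" if "open U" "A \<subseteq> U" for U
    proof -
      have "emeasure M A \<le> emeasure M U" using that M(2) by (intro emeasure_mono) auto
      also have "\<dots> \<le> emeasure N U" by (rule le) fact
      finally show ?thesis .
    qed
    then have "emeasure M A \<le> (INF U \<in> {U. A \<subseteq> U \<and> open U}. emeasure N U)"
      by (intro INF_greatest) auto
    also have "\<dots> = emeasure N A"
      by (rule outer_regular[symmetric, OF N(2) _ A]) (simp add: N.emeasure_space_1)
    finally show ?thesis by (simp add: M.emeasure_eq_measure N.emeasure_eq_measure)
  qed
  fix A assume "A \<in> sets M"
  then have A: "A \<in> sets borel" "- A \<in> sets borel" using M(2) by auto
  have "measure M (- A) = 1 - measure M A" "measure N (- A) = 1 - measure N A"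
    using M.prob_compl[of A] N.prob_compl[of A] A M(2) N(2) sp by (simp_all add: Compl_eq_Diff_UNIV)
  then have "measure M A = measure N A" using le'[OF A(1)] le'[OF A(2)] by linarith
  then show "emeasure M A = emeasure N A" by (simp add: M.emeasure_eq_measure N.emeasure_eq_measure)
qed

context AL_scheme
begin

lemma measurable_G_white_noise: "G t \<in> white_noise \<beta> \<rightarrow>\<^sub>M white_noise \<beta>"
  using measurable_G[OF measurable_ident_sets[OF sets_white_noise], of "\<lambda>_. t" \<beta>]
  by (simp add: measurable_cong_sets[OF refl sets_white_noise])

lemma measurable_Y_white_noise: "Y j t \<in> white_noise \<beta> \<rightarrow>\<^sub>M white_noise \<beta>"
  using measurable_Y[OF measurable_ident_sets[OF sets_white_noise], of "\<lambda>_. t" \<beta>]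
  by (simp add: measurable_cong_sets[OF refl sets_white_noise])

lemma distr_G: "distr (white_noise \<beta>) (white_noise \<beta>) (G t) = white_noise \<beta>"
proof (rule measure_eqI_open_le)
  interpret W: prob_space "white_noise \<beta>" by (rule prob_space_white_noise[OF \<beta>])
  note [measurable] = measurable_G_white_noise measurable_Y_white_noise
  show "prob_space (distr (white_noise \<beta>) (white_noise \<beta>) (G t))"
    by (rule W.prob_space_distr) measurable
  show "prob_space (white_noise \<beta>)" by (rule prob_space_white_noise[OF \<beta>])
  show "sets (distr (white_noise \<beta>) (white_noise \<beta>) (G t)) = sets borel" "sets (white_noise \<beta>) = sets borel"
    by (simp_all add: sets_white_noise_borel)
  fix U :: "(int \<Rightarrow> complex) set" assume U: "open U"
  then have Us [measurable]: "U \<in> sets (white_noise \<beta>)" by (simp add: sets_white_noise_borel)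
  let ?f = "\<lambda>j x. indicator (low j) x * indicator U (Y j t x) :: ennreal"
  have "emeasure (distr (white_noise \<beta>) (white_noise \<beta>) (G t)) U = (\<integral>\<^sup>+x. indicator U x \<partial>distr (white_noise \<beta>) (white_noise \<beta>) (G t))"
    by simp
  also have "\<dots> = (\<integral>\<^sup>+x. indicator U (G t x) \<partial>white_noise \<beta>)"
    by (rule nn_integral_distr) measurable
  \<comment> \<open>If the limit lies in the open set \<open>U\<close>, the approximations
    eventually do so too, and the cutoff to \<open>low j\<close> eventually equals 1.\<close>
  also have "\<dots> \<le> (\<integral>\<^sup>+x. liminf (\<lambda>j. ?f j x) \<partial>white_noise \<beta>)"
  proof (rule nn_integral_mono_AE)
    show "AE x in white_noise \<beta>. indicator U (G t x) \<le> liminf (\<lambda>j. ?f j x)"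
      using AE_good
    proof eventually_elim
      case (elim x)
      show ?case
      proof (cases "G t x \<in> U")
        case True
        have "(\<lambda>j. Y j t x) \<longlonglongrightarrow> G t x"
          by (rule convergence[OF elim]) (rule tendsto_coordinatewise)
        then have "\<forall>\<^sub>F j in sequentially. Y j t x \<in> U" using U True by (rule topological_tendstoD)
        then have "\<forall>\<^sub>F j in sequentially. 1 \<le> ?f j x"
          using elim by eventually_elim (simp add: good_def)
        then show ?thesis using True by (simp add: Liminf_bounded)
      qed simp
    qed
  qed
  also have "\<dots> \<le> liminf (\<lambda>j. \<integral>\<^sup>+x. ?f j x \<partial>white_noise \<beta>)"
    by (rule nn_integral_liminf) measurable
  also have "\<dots> \<le> liminf (\<lambda>j. ennreal (exp (exp (- (2 * 2 ^ j)))) * emeasure (white_noise \<beta>) U)"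
  proof (rule Liminf_mono)
    show "\<forall>\<^sub>F j in sequentially. (\<integral>\<^sup>+x. ?f j x \<partial>white_noise \<beta>) \<le> ennreal (exp (exp (- (2 * 2 ^ j)))) * emeasure (white_noise \<beta>) U"
      using eventually_ge_at_top[of "nat \<lceil>\<bar>t\<bar>\<rceil>"]
    proof eventually_elim
      case (elim j)
      then have "\<bar>t\<bar> \<le> real j + 1" by linarith
      from Y_law[OF this, of "indicator U"] show ?case by simp
    qed
  qed
  also have "\<dots> = emeasure (white_noise \<beta>) U"
  proof (rule lim_imp_Liminf)
    have "(\<lambda>j. exp (- (2 * 2 ^ j :: real))) \<longlonglongrightarrow> 0"
    proof (rule filterlim_compose[OF exp_at_bot], rule filterlim_compose[OF filterlim_uminus_at_bot_at_top])
      show "filterlim (\<lambda>j. 2 * 2 ^ j :: real) at_top sequentially"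
      proof (rule filterlim_at_top_mono[OF filterlim_real_sequentially], rule always_eventually, rule allI)
        fix j :: nat
        show "real j \<le> 2 * 2 ^ j" using of_nat_less_two_power[of j, where 'a = real] by linarith
      qed
    qed
    then have "(\<lambda>j. ennreal (exp (exp (- (2 * 2 ^ j)))) * emeasure (white_noise \<beta>) U) \<longlonglongrightarrow> ennreal (exp 0) * emeasure (white_noise \<beta>) U"
      by (intro tendsto_mult_ennreal tendsto_ennrealI tendsto_exp tendsto_const) auto
    then show "(\<lambda>j. ennreal (exp (exp (- (2 * 2 ^ j)))) * emeasure (white_noise \<beta>) U) \<longlonglongrightarrow> emeasure (white_noise \<beta>) U"
      by simp
  qed simp
  finally show "emeasure (distr (white_noise \<beta>) (white_noise \<beta>) (G t)) U \<le> emeasure (white_noise \<beta>) U" .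
qed

text \<open>Invariance is already used here: at each time \<open>G t x\<close> has the law of white
  noise, so the expected weighted sum is bounded uniformly in time and Tonelli gives a finite time
  integral. The pathwise bounds on the approximations grow with j and would not pass to the
  limit.\<close>

lemma AE_G_mass:
  "AE x in white_noise \<beta>. \<forall>T>0. (\<integral>\<^sup>+t\<in>{-T..T}.
     (\<Sum>\<^sub>\<infinity>n. ennreal (japanese_bracket n powr (- q) * cmod (G t x n) powr (2 * p))) \<partial>lborel) < \<infinity>"
proof -
  interpret W: prob_space "white_noise \<beta>" by (rule prob_space_white_noise[OF \<beta>])
  interpret pair_sigma_finite "white_noise \<beta>" lborel ..
  obtain C where C: "C > 0" "\<And>M. (\<integral>\<^sup>+x. ennreal (mass p q M x) \<partial>white_noise \<beta>) \<le> ennreal C"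
    by (rule nn_integral_mass[OF \<beta>, of p q]) (use \<beta> in auto)
  define S where "S = (\<lambda>x. SUP N. ennreal (mass p q N x))"
  have S: "(\<Sum>\<^sub>\<infinity>n. ennreal (japanese_bracket n powr (- q) * cmod (x n) powr (2 * p))) = S x" for x :: "int \<Rightarrow> complex"
    unfolding infsum_ennreal_box S_def mass_def by (subst sum_ennreal) auto
  have mm [measurable]: "(\<lambda>x. mass p q N x) \<in> borel_measurable (white_noise \<beta>)" for N
    by (rule measurable_mass[OF measurable_ident_sets[OF sets_white_noise]])
  have Sm [measurable]: "S \<in> borel_measurable (white_noise \<beta>)" unfolding S_def by measurable
  have ES: "(\<integral>\<^sup>+x. S x \<partial>white_noise \<beta>) \<le> ennreal C"
  proof -
    have "(\<integral>\<^sup>+x. S x \<partial>white_noise \<beta>) = (SUP N. \<integral>\<^sup>+x. ennreal (mass p q N x) \<partial>white_noise \<beta>)"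
      unfolding S_def by (rule nn_integral_monotone_convergence_SUP) (auto simp: incseq_def le_fun_def intro!: ennreal_leI mass_mono)
    also have "\<dots> \<le> ennreal C" by (intro SUP_least C)
    finally show ?thesis .
  qed
  have fst_m [measurable]: "fst \<in> white_noise \<beta> \<Otimes>\<^sub>M lborel \<rightarrow>\<^sub>M (\<Pi>\<^sub>M n\<in>UNIV. borel)"
    by (rule measurable_compose[OF measurable_fst measurable_ident_sets[OF sets_white_noise]])
  have GS: "(\<lambda>z. S (G (snd z) (fst z))) \<in> borel_measurable (white_noise \<beta> \<Otimes>\<^sub>M lborel)"
    unfolding S_def by measurable
  \<comment> \<open>Integer horizons suffice, and they leave only countably many exceptional null
    sets.\<close>
  have "AE x in white_noise \<beta>. (\<integral>\<^sup>+t. S (G t x) * indicator {- real T..real T} t \<partial>lborel) \<noteq> \<infinity>" for T :: nat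
  proof (rule nn_integral_noteq_infinite)
    have [measurable]: "(\<lambda>(x, t). S (G t x) * indicator {- real T..real T} t) \<in> borel_measurable (white_noise \<beta> \<Otimes>\<^sub>M lborel)"
      using GS unfolding case_prod_beta by measurable
    show "(\<lambda>x. \<integral>\<^sup>+t. S (G t x) * indicator {- real T..real T} t \<partial>lborel) \<in> borel_measurable (white_noise \<beta>)"
      by measurable
    have "(\<integral>\<^sup>+x. \<integral>\<^sup>+t. S (G t x) * indicator {- real T..real T} t \<partial>lborel \<partial>white_noise \<beta>)
        = (\<integral>\<^sup>+t. \<integral>\<^sup>+x. S (G t x) * indicator {- real T..real T} t \<partial>white_noise \<beta> \<partial>lborel)"
      by (rule Fubini'[symmetric]) measurable
    also have "\<dots> \<le> (\<integral>\<^sup>+t. ennreal C * indicator {- real T..real T} t \<partial>lborel)"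
    proof (rule nn_integral_mono)
      fix t
      note [measurable] = measurable_G_white_noise
      have "(\<integral>\<^sup>+x. S (G t x) \<partial>white_noise \<beta>) = (\<integral>\<^sup>+x. S x \<partial>distr (white_noise \<beta>) (white_noise \<beta>) (G t))"
        by (rule nn_integral_distr[symmetric]) measurable
      then have "(\<integral>\<^sup>+x. S (G t x) \<partial>white_noise \<beta>) \<le> ennreal C" using ES by (simp add: distr_G)
      moreover have "(\<integral>\<^sup>+x. S (G t x) * indicator {- real T..real T} t \<partial>white_noise \<beta>) = (\<integral>\<^sup>+x. S (G t x) \<partial>white_noise \<beta>) * indicator {- real T..real T} t"
        by (rule nn_integral_multc) measurable
      ultimately show "(\<integral>\<^sup>+x. S (G t x) * indicator {- real T..real T} t \<partial>white_noise \<beta>) \<le> ennreal C * indicator {- real T..real T} t"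
        by (simp add: mult_right_mono)
    qed
    also have "\<dots> = ennreal C * ennreal (2 * real T)" by (subst nn_integral_cmult) auto
    also have "\<dots> < \<infinity>" by (simp add: ennreal_mult_less_top)
    finally show "(\<integral>\<^sup>+x. \<integral>\<^sup>+t. S (G t x) * indicator {- real T..real T} t \<partial>lborel \<partial>white_noise \<beta>) \<noteq> \<infinity>" by simp
  qed
  then have "AE x in white_noise \<beta>. \<forall>T :: nat. (\<integral>\<^sup>+t. S (G t x) * indicator {- real T..real T} t \<partial>lborel) \<noteq> \<infinity>"
    by (simp add: AE_all_countable)
  then show ?thesis
  proof eventually_elim
    case (elim x)
    show ?case
    proof (intro allI impI)
      fix T :: real assume "T > 0"
      define k where "k = nat \<lceil>T\<rceil>"
      have "T \<le> real k" unfolding k_def by linarith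
      then have "(\<integral>\<^sup>+t\<in>{-T..T}. S (G t x) \<partial>lborel) \<le> (\<integral>\<^sup>+t. S (G t x) * indicator {- real k..real k} t \<partial>lborel)"
        by (intro nn_integral_mono mult_left_mono) (auto simp: indicator_def)
      also have "\<dots> < \<infinity>" using elim by (simp add: less_top)
      finally show "(\<integral>\<^sup>+t\<in>{-T..T}. (\<Sum>\<^sub>\<infinity>n. ennreal (japanese_bracket n powr (- q) * cmod (G t x n) powr (2 * p))) \<partial>lborel) < \<infinity>"
        unfolding S .
    qed
  qed
qed

lemma AE_good_solution: "AE x in white_noise \<beta>. good_solution_from x (\<lambda>n t. G t x n)"
  using AE_good AE_G_mass
proof eventually_elim
  case (elim x)
  have "p > q" "q > 1" "8 * C0 + 1 > 0" using \<beta> C0_pos by auto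
  then show ?case
    using G_solution[OF elim(1)] G_growth[OF elim(1)] elim(2)
    unfolding good_solution_from_def good_solution_def by blast
qed

lemma AE_unique_solution: "AE x in white_noise \<beta>. \<exists>!\<alpha>. good_solution_from x \<alpha>"
  using AE_good_solution
  by eventually_elim (metis good_solution_unique)

lemma AE_flow_eq: "AE x in white_noise \<beta>. AL_flow t x = G t x"
  using AE_good_solution
proof eventually_elim
  case (elim x)
  have "(THE \<alpha>. good_solution_from x \<alpha>) = (\<lambda>n t. G t x n)"
    using elim good_solution_unique by (intro the_equality) blast+
  then show ?case by (simp add: AL_flow_def)
qed

end

section \<open>From the limit to the flow\<close>

text \<open>Off the null set where \<open>f\<close> and \<open>g\<close> differ, the preimages of a
  set under the two maps agree; within that null set every subset is measurable for the
  completion.\<close>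

lemma leaves_invariant_AE:
  assumes sp: "space M = UNIV" and g: "g \<in> M \<rightarrow>\<^sub>M M" "distr M M g = M" and eq: "AE x in M. f x = g x"
  shows "leaves_invariant f M"
proof -
  have gm: "g \<in> completion M \<rightarrow>\<^sub>M M" using g(1) by (rule measurable_completion)
  have fm: "f \<in> completion M \<rightarrow>\<^sub>M M"
  proof (rule measurableI)
    fix A assume A: "A \<in> sets M"
    have [measurable]: "Measurable.pred (completion M) (\<lambda>x. g x \<in> A)"
      using measurable_sets[OF gm A] by (simp add: pred_def vimage_def Int_def conj_commute)
    have [measurable]: "Measurable.pred (completion M) (\<lambda>x. f x \<noteq> g x)"
      using eq by (intro sets_completion_AE) simp
    have [measurable]: "Measurable.pred (completion M) (\<lambda>x. f x \<in> A \<and> f x \<noteq> g x)"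
      using eq by (intro sets_completion_AE) (auto elim: eventually_mono)
    have "Measurable.pred (completion M) (\<lambda>x. (g x \<in> A \<and> \<not> f x \<noteq> g x) \<or> (f x \<in> A \<and> f x \<noteq> g x))"
      by measurable
    moreover have "(g x \<in> A \<and> \<not> f x \<noteq> g x) \<or> (f x \<in> A \<and> f x \<noteq> g x) \<longleftrightarrow> f x \<in> A" for x by auto
    ultimately show "f -` A \<inter> space (completion M) \<in> sets (completion M)"
      by (simp add: pred_def vimage_def Int_def conj_commute)
  qed (simp add: sp)
  have "distr (completion M) M f = distr (completion M) M g"
    using fm gm AE_completion[OF eq] by (intro distr_cong_AE) auto
  also have "\<dots> = M" using distr_completion[OF g(1)] g(2) by simp
  finally show ?thesis using fm by (simp add: leaves_invariant_def)
qed

lemma AL_scheme_exists: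
  assumes \<beta>: "\<beta> > 0"
  obtains C0 h where "AL_scheme \<beta> C0 h"
proof -
  define C0 where "C0 = 5 * ln ((1 + 2 * \<beta>) / (2 * \<beta>)) + 1"
  have "\<forall>j :: nat. \<exists>h. faithful \<beta> (2 * 2 ^ j) (C0 * 2 ^ j) (real j + 1) (exp (- (2 * 2 ^ j))) h"
    using \<beta> by (intro allI approximation) auto
  from choice[OF this] obtain h
    where "\<And>j. faithful \<beta> (2 * 2 ^ j) (C0 * 2 ^ j) (real j + 1) (exp (- (2 * 2 ^ j))) (h j)"
    by blast
  then have "AL_scheme \<beta> C0 h" using \<beta> C0_def by unfold_locales
  then show ?thesis by (rule that)
qed

theorem theorem4p4:
  fixes \<beta> :: real
  assumes "\<beta> > 0"
  shows "(AE a in white_noise \<beta>. \<exists>!\<alpha>. good_solution_from a \<alpha>) \<and>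
         (\<forall>t :: real. leaves_invariant (AL_flow t) (white_noise \<beta>))"
proof -
  obtain C0 h where "AL_scheme \<beta> C0 h" by (rule AL_scheme_exists[OF assms])
  then interpret AL_scheme \<beta> C0 h .
  show ?thesis
    using AE_unique_solution leaves_invariant_AE[OF space_white_noise measurable_G_white_noise distr_G AE_flow_eq] by blast
qed

end
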